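(* Let $F(X_1,\ldots,X_n):=\sum_{k=0}^\infty\sum_{|\alpha|=k}X_\alpha\otimes A_{(\alpha)}$, $A_{(\alpha)}\in B(\mathcal{H})$, be a (universal) holomorphic function on $[B(\mathcal{X})^n]_{<1}$ with coefficients in $B(\mathcal{H})$ such that $F(0)\geq0$ and $$\mathrm{Re}\,F(X_1,\ldots,X_n)\leq I\quad\text{for any }(X_1,\ldots,X_n)\in[B(\mathcal{X})^n]_{<1}\text{ and any Hilbert space }\mathcal{X}.$$ Then (i) for any $k=1,2,\ldots$, the operator matrix $$P_k:=\begin{pmatrix}2(I_{\mathcal{H}}-A_{(0)})&[A_{(\alpha)}^*:\ |\alpha|=k]\\ \left[\begin{matrix}A_{(\alpha)}\\ :\\ |\alpha|=k\end{matrix}\right]&\left[\begin{matrix}2(I_{\mathcal{H}}-A_{(0)})&\cdots&0\\ \vdots&\ddots&\vdots\\0&\cdots&2(I_{\mathcal{H}}-A_{(0)})\end{matrix}\right]\end{pmatrix}$$ (acting on $\mathcal{H}\oplus\bigoplus_{|\alpha|=k}\mathcal{H}$) is positive; (ii) if $\{Y_{(\alpha)}\}_{\alpha\in\mathbb{F}_n^+}$ is a sequence of operators in $B(\mathcal{K})$ ($\mathcal{K}$ a Hilbert space) with $$\|Y_{(0)}\|\leq1\quad\text{and}\quad\sum_{k=1}^\infty\left\|\sum_{|\alpha|=k}Y_{(\alpha)}^*Y_{(\alpha)}\right\|^{1/2}\leq\frac12,$$ then $$\left\|\sum_{k=0}^\infty\sum_{|\alpha|=k}S_\alpha\otimes A_{(\alpha)}\otimes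 Y_{(\alpha)}\right\|\leq1,$$ where the series (in $k$) converges in the norm topology of $B(F^2(H_n)\otimes\mathcal{H}\otimes\mathcal{K})$.
   Context: $\mathbb{F}_n^+$ is the unital free semigroup on $g_1,\dots,g_n$ with identity $g_0$; $|g_{i_1}\cdots g_{i_k}|=k$, $|g_0|=0$; for $\alpha=g_{i_1}\cdots g_{i_k}$, $X_\alpha:=X_{i_1}\cdots X_{i_k}$, $X_{g_0}:=I$. $H_n$ is an $n$-dimensional complex Hilbert space with orthonormal basis $e_1,\dots,e_n$; $F^2(H_n)=\bigoplus_{k\ge0}H_n^{\otimes k}$ (with $H_n^{\otimes0}=\mathbb{C}1$) is the full Fock space and $S_i\varphi=e_i\otimes\varphi$ are the left creation operators. $[B(\mathcal{X})^n]_{<1}:=\{(X_1,\ldots,X_n)\in B(\mathcal{X})^n:\|X_1X_1^*+\cdots+X_nX_n^*\|<1\}$. A family $\{A_{(\alpha)}\}_{\alpha\in\mathbb{F}_n^+}\subset B(\mathcal{H})$ defines a (universal) holomorphic function $F$ on $[B(\mathcal{X})^n]_{<1}$ with coefficients in $B(\mathcal{H})$ if $\sum_{k=0}^\infty\left(\sum_{|\alpha|=k}X_\alpha\otimes A_{(\alpha)}\right)$ converges in operator norm for every Hilbert space $\mathcal{X}$ and every $(X_1,\ldots,X_n)\in[B(\mathcal{X})^n]_{<1}$. $A_{(0)}:=A_{(g_0)}$, $Y_{(0)}:=Y_{(g_0)}$; $F(0)\ge0$ means $A_{(0)}\ge0$; $\mathrm{Re}\,A=\frac12(A+A^* )$.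 $[A_{(\alpha)}^*:|\alpha|=k]$ is the row operator matrix with entries $A_{(\alpha)}^*$, $|\alpha|=k$ (in some fixed order, the same as for the column). *)

theory Defs
  imports "HOL-Analysis.Analysis"
begin

section \<open>Complex Hilbert spaces\<close>

class scaleC =
  fixes scaleC :: "complex \<Rightarrow> 'a \<Rightarrow> 'a"  (infixr \<open>*\<^sub>C\<close> 75)

text \<open>
  The complex inner product is conjugate-linear in the first argument; its real part is the
  inner product of the underlying real inner product space, so that norm, topology, limits and
  series are those of the library.
\<close>

class complex_inner = real_inner + scaleC +
  fixes cinner :: "'a \<Rightarrow> 'a \<Rightarrow> complex"
  assumes scaleC_add_right: "a *\<^sub>C (x + y) = a *\<^sub>C x + a *\<^sub>C y"
    and scaleC_add_left: "(a + b) *\<^sub>C x = a *\<^sub>C x + b *\<^sub>C x"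
    and scaleC_scaleC: "a *\<^sub>C (b *\<^sub>C x) = (a * b) *\<^sub>C x"
    and scaleR_scaleC: "r *\<^sub>R x = complex_of_real r *\<^sub>C x"
    and cinner_commute: "cinner x y = cnj (cinner y x)"
    and cinner_add_right: "cinner x (y + z) = cinner x y + cinner x z"
    and cinner_scaleC_right: "cinner x (a *\<^sub>C y) = a * cinner x y"
    and inner_eq_Re_cinner: "inner x y = Re (cinner x y)"

class chilbert_space = complex_inner + complete_space

lemma scaleC_one: "1 *\<^sub>C x = (x::'a::complex_inner)"
  using scaleR_scaleC[of 1 x] by simp

lemma cinner_add_left: "cinner (x + y) z = cinner x z + cinner y z"
  by (metis cinner_commute cinner_add_right complex_cnj_add)

lemma cinner_scaleC_left: "cinner (a *\<^sub>C x) y = cnj a * cinner x y"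
  by (metis cinner_commute cinner_scaleC_right complex_cnj_mult)

lemma cinner_zero_right [simp]: "cinner x (0::'a::complex_inner) = 0"
  using cinner_add_right[of x 0 0] by simp

lemma cinner_zero_left [simp]: "cinner (0::'a::complex_inner) x = 0"
  by (metis cinner_commute cinner_zero_right complex_cnj_zero)

lemma cinner_minus_right: "cinner x (- y) = - cinner x y"
  using cinner_add_right[of x y "- y"] by (simp add: minus_unique)

lemma cinner_minus_left: "cinner (- x) y = - cinner x y"
  by (metis cinner_commute cinner_minus_right complex_cnj_minus)

lemma cinner_diff_right: "cinner x (y - z) = cinner x y - cinner x z"
  using cinner_add_right[of x y "- z"] by (simp add: cinner_minus_right)

lemma cinner_diff_left: "cinner (x - y) z = cinner x z - cinner y z"
  using cinner_add_left[of x "- y" z] by (simp add: cinner_minus_left)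

lemma cinner_sum_right: "cinner x (\<Sum>i\<in>I. f i) = (\<Sum>i\<in>I. cinner x (f i))"
  by (induction I rule: infinite_finite_induct) (auto simp: cinner_add_right)

lemma cinner_sum_left: "cinner (\<Sum>i\<in>I. f i) x = (\<Sum>i\<in>I. cinner (f i) x)"
  by (induction I rule: infinite_finite_induct) (auto simp: cinner_add_left)

lemma cinner_self: "cinner x x = complex_of_real ((norm x)\<^sup>2)"
proof (rule complex_eqI)
  show "Re (cinner x x) = Re (complex_of_real ((norm x)\<^sup>2))"
    by (simp add: power2_norm_eq_inner inner_eq_Re_cinner)
  show "Im (cinner x x) = Im (complex_of_real ((norm x)\<^sup>2))"
    using cinner_commute[of x x] by (metis Im_complex_of_real complex_is_Real_iff Reals_cnj_iff)
qed

lemma scaleC_diff_right: "a *\<^sub>C (x - y::'a::complex_inner) = a *\<^sub>C x - a *\<^sub>C y"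
  using scaleC_add_right[of a "x - y" y] by (simp add: eq_diff_eq)

lemma scaleC_zero_right [simp]: "a *\<^sub>C 0 = (0::'a::complex_inner)"
  using scaleC_add_right[of a 0 0] by simp

lemma scaleC_sum_right: "a *\<^sub>C (\<Sum>i\<in>I. f i::'a::complex_inner) = (\<Sum>i\<in>I. a *\<^sub>C f i)"
  by (induction I rule: infinite_finite_induct) (auto simp: scaleC_add_right)

lemma norm_scaleC: "norm (a *\<^sub>C (x::'a::complex_inner)) = cmod a * norm x"
proof -
  have "cinner (a *\<^sub>C x) (a *\<^sub>C x) = cnj a * a * cinner x x"
    by (simp add: cinner_scaleC_left cinner_scaleC_right)
  hence "complex_of_real ((norm (a *\<^sub>C x))\<^sup>2) = complex_of_real ((cmod a * norm x)\<^sup>2)"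
    by (simp add: cinner_self power_mult_distrib mult.commute[of "cnj a"]
        complex_norm_square[symmetric])
  hence "(norm (a *\<^sub>C x))\<^sup>2 = (cmod a * norm x)\<^sup>2"
    using of_real_eq_iff by blast
  thus ?thesis
    by (simp add: power2_eq_iff_nonneg)
qed

lemma cinner_Cauchy_Schwarz:
  fixes x y :: "'a::complex_inner"
  shows "cmod (cinner x y) \<le> norm x * norm y"
proof (cases "cinner x y = 0")
  case False
  define c where "c = cnj (cinner x y) / cmod (cinner x y)"
  have c: "cmod c = 1" using False by (simp add: c_def norm_divide)
  have "cinner x (c *\<^sub>C y) = complex_of_real (cmod (cinner x y))"
    using False unfolding c_def cinner_scaleC_right
    by (simp add: complex_norm_square[symmetric] mult.commute power2_eq_square)
  hence "cmod (cinner x y) = inner x (c *\<^sub>C y)"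
    by (simp add: inner_eq_Re_cinner)
  also have "\<dots> \<le> norm x * norm (c *\<^sub>C y)"
    by (rule norm_cauchy_schwarz)
  finally show ?thesis by (simp add: norm_scaleC c)
qed simp

lemma bounded_linear_scaleC: "bounded_linear (\<lambda>x::'a::complex_inner. a *\<^sub>C x)"
  by (rule bounded_linear_intro[where K = "cmod a"])
    (auto simp: scaleC_add_right scaleR_scaleC scaleC_scaleC mult.commute norm_scaleC)

lemma bounded_linear_cinner_right: "bounded_linear (\<lambda>y::'a::complex_inner. cinner x y)"
  by (rule bounded_linear_intro[where K = "norm x"])
    (auto simp: cinner_add_right scaleR_scaleC cinner_scaleC_right scaleR_conv_of_real
      mult.commute intro: order_trans[OF cinner_Cauchy_Schwarz])


section \<open>The Hilbert space of square-summable families\<close>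

typedef 'a ell2 = "{f :: 'a \<Rightarrow> complex. (\<lambda>i. (cmod (f i))\<^sup>2) summable_on UNIV}"
  by (rule exI[of _ "\<lambda>_. 0"]) simp

setup_lifting type_definition_ell2

lemma ell2_cinner_summable:
  assumes "(\<lambda>i. (cmod (f i))\<^sup>2) summable_on UNIV" "(\<lambda>i. (cmod (g i))\<^sup>2) summable_on UNIV"
  shows "(\<lambda>i. cnj (f i) * g i) summable_on UNIV"
proof -
  have "(\<lambda>i. (cmod (f i))\<^sup>2 + (cmod (g i))\<^sup>2) summable_on UNIV"
    by (rule summable_on_add[OF assms])
  moreover have "norm (cnj (f i) * g i) \<le> (cmod (f i))\<^sup>2 + (cmod (g i))\<^sup>2" for i
  proof -
    have "2 * (cmod (f i) * cmod (g i)) \<le> (cmod (f i))\<^sup>2 + (cmod (g i))\<^sup>2"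
      using sum_squares_bound[of "cmod (f i)" "cmod (g i)"] by simp
    moreover have "0 \<le> cmod (f i) * cmod (g i)" by simp
    ultimately have "cmod (f i) * cmod (g i) \<le> (cmod (f i))\<^sup>2 + (cmod (g i))\<^sup>2" by linarith
    thus ?thesis by (simp add: norm_mult)
  qed
  ultimately have "(\<lambda>i. norm (cnj (f i) * g i)) summable_on UNIV"
    by (auto intro: summable_on_comparison_test)
  thus ?thesis by (rule abs_summable_summable)
qed

lemma ell2_add_summable:
  assumes "(\<lambda>i. (cmod (f i))\<^sup>2) summable_on UNIV" "(\<lambda>i. (cmod (g i))\<^sup>2) summable_on UNIV"
  shows "(\<lambda>i. (cmod (f i + g i))\<^sup>2) summable_on UNIV"
proof -
  have "(\<lambda>i. 2 * ((cmod (f i))\<^sup>2 + (cmod (g i))\<^sup>2)) summable_on UNIV"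
    by (intro summable_on_cmult_right summable_on_add assms)
  moreover have "(cmod (f i + g i))\<^sup>2 \<le> 2 * ((cmod (f i))\<^sup>2 + (cmod (g i))\<^sup>2)" for i
  proof -
    have "(cmod (f i + g i))\<^sup>2 \<le> (cmod (f i) + cmod (g i))\<^sup>2"
      by (intro power_mono norm_triangle_ineq norm_ge_zero)
    also have "\<dots> \<le> 2 * ((cmod (f i))\<^sup>2 + (cmod (g i))\<^sup>2)"
      using sum_squares_bound[of "cmod (f i)" "cmod (g i)"] by (simp add: power2_sum)
    finally show ?thesis .
  qed
  ultimately show ?thesis
    by (auto intro: summable_on_comparison_test)
qed

lemma ell2_scale_summable:
  assumes "(\<lambda>i. (cmod (f i))\<^sup>2) summable_on UNIV"
  shows "(\<lambda>i. (cmod (c * f i))\<^sup>2) summable_on UNIV"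
  using summable_on_cmult_right[OF assms, of "(cmod c)\<^sup>2"]
  by (simp add: norm_mult power_mult_distrib)

instantiation ell2 :: (type) complex_inner
begin

lift_definition zero_ell2 :: "'a ell2" is "\<lambda>_. 0" by simp
lift_definition plus_ell2 :: "'a ell2 \<Rightarrow> 'a ell2 \<Rightarrow> 'a ell2" is "\<lambda>f g i. f i + g i"
  by (rule ell2_add_summable)
lift_definition uminus_ell2 :: "'a ell2 \<Rightarrow> 'a ell2" is "\<lambda>f i. - f i" by simp
lift_definition minus_ell2 :: "'a ell2 \<Rightarrow> 'a ell2 \<Rightarrow> 'a ell2" is "\<lambda>f g i. f i - g i"
  subgoal for f g using ell2_add_summable[of f "\<lambda>i. - g i"] by simp
  done
lift_definition scaleC_ell2 :: "complex \<Rightarrow> 'a ell2 \<Rightarrow> 'a ell2" is "\<lambda>c f i. c * f i"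
  by (rule ell2_scale_summable)
lift_definition scaleR_ell2 :: "real \<Rightarrow> 'a ell2 \<Rightarrow> 'a ell2" is "\<lambda>r f i. complex_of_real r * f i"
  by (rule ell2_scale_summable)
lift_definition cinner_ell2 :: "'a ell2 \<Rightarrow> 'a ell2 \<Rightarrow> complex"
  is "\<lambda>f g. \<Sum>\<^sub>\<infinity>i. cnj (f i) * g i" .

definition inner_ell2 :: "'a ell2 \<Rightarrow> 'a ell2 \<Rightarrow> real" where "inner_ell2 f g = Re (cinner f g)"
definition norm_ell2 :: "'a ell2 \<Rightarrow> real" where "norm_ell2 f = sqrt (inner f f)"
definition dist_ell2 :: "'a ell2 \<Rightarrow> 'a ell2 \<Rightarrow> real" where "dist_ell2 f g = norm (f - g)"
definition sgn_ell2 :: "'a ell2 \<Rightarrow> 'a ell2" where "sgn_ell2 f = inverse (norm f) *\<^sub>R f"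
definition uniformity_ell2 :: "('a ell2 \<times> 'a ell2) filter" where
  "uniformity_ell2 = (INF e\<in>{0<..}. principal {(x, y). dist x y < e})"
definition open_ell2 :: "'a ell2 set \<Rightarrow> bool" where
  "open_ell2 U = (\<forall>x\<in>U. eventually (\<lambda>(x', y). x' = x \<longrightarrow> y \<in> U) uniformity)"

instance
proof
  fix x y z :: "'a ell2" and a b :: complex and r s :: real
  show "x + y + z = x + (y + z)" by transfer (simp add: add.assoc)
  show "x + y = y + x" by transfer (simp add: add.commute)
  show "0 + x = x" by transfer simp
  show "- x + x = 0" by transfer simp
  show "x - y = x + - y" by transfer simp
  show "r *\<^sub>R (x + y) = r *\<^sub>R x + r *\<^sub>R y" by transfer (simp add: algebra_simps)
  show "(r + s) *\<^sub>R x = r *\<^sub>R x + s *\<^sub>R x" by transfer (simp add: algebra_simps)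
  show "r *\<^sub>R s *\<^sub>R x = (r * s) *\<^sub>R x" by transfer (simp add: algebra_simps)
  show "1 *\<^sub>R x = x" by transfer simp
  show "sgn x = inverse (norm x) *\<^sub>R x" by (rule sgn_ell2_def)
  show "dist x y = norm (x - y)" by (rule dist_ell2_def)
  show "uniformity = (INF e\<in>{0<..}. principal {(x, y). dist (x::'a ell2) y < e})"
    by (rule uniformity_ell2_def)
  show "open U = (\<forall>x\<in>U. \<forall>\<^sub>F (x', y) in uniformity. x' = x \<longrightarrow> y \<in> U)" for U :: "'a ell2 set"
    by (rule open_ell2_def)
  show "norm x = sqrt (inner x x)" by (rule norm_ell2_def)
  show comm: "cinner x y = cnj (cinner y x)" for x y :: "'a ell2"
    by transfer (simp add: infsum_cnj[symmetric] mult.commute del: infsum_cnj)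
  show addr: "cinner x (y + z) = cinner x y + cinner x z" for x y z :: "'a ell2"
    by transfer (simp add: distrib_left infsum_add ell2_cinner_summable)
  show scr: "cinner x (a *\<^sub>C y) = a * cinner x y" for x y :: "'a ell2" and a
    by transfer (simp add: mult.left_commute infsum_cmult_right')
  show "inner x y = Re (cinner x y)" by (rule inner_ell2_def)
  show "a *\<^sub>C (x + y) = a *\<^sub>C x + a *\<^sub>C y" by transfer (simp add: algebra_simps)
  show "(a + b) *\<^sub>C x = a *\<^sub>C x + b *\<^sub>C x" by transfer (simp add: algebra_simps)
  show "a *\<^sub>C b *\<^sub>C x = (a * b) *\<^sub>C x" by transfer (simp add: algebra_simps)
  show sR: "r *\<^sub>R x = complex_of_real r *\<^sub>C x" for r and x :: "'a ell2" by transfer simp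
  show icomm: "inner x y = inner y x" for x y :: "'a ell2"
    unfolding inner_ell2_def by (subst comm) simp
  show "inner (x + y) z = inner x z + inner y z"
    unfolding icomm[of _ z] by (simp add: inner_ell2_def addr)
  show "inner (r *\<^sub>R x) y = r * inner x y"
    unfolding icomm[of _ y] by (simp add: inner_ell2_def sR scr)
  have self: "inner x x = (\<Sum>\<^sub>\<infinity>i. (cmod (Rep_ell2 x i))\<^sup>2)"
  proof -
    have "cinner x x = (\<Sum>\<^sub>\<infinity>i. complex_of_real ((cmod (Rep_ell2 x i))\<^sup>2))"
      by (simp only: cinner_ell2.rep_eq complex_norm_square mult.commute)
    also have "\<dots> = complex_of_real (\<Sum>\<^sub>\<infinity>i. (cmod (Rep_ell2 x i))\<^sup>2)"
      using Rep_ell2[of x] by (intro infsumI has_sum_of_real) simp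
    finally show ?thesis by (simp add: inner_ell2_def)
  qed
  show "0 \<le> inner x x" unfolding self by (rule infsum_nonneg) simp
  show "inner x x = 0 \<longleftrightarrow> x = 0"
  proof
    assume "inner x x = 0"
    hence "(cmod (Rep_ell2 x i))\<^sup>2 = 0" for i
      using nonneg_infsum_le_0D[of "\<lambda>i. (cmod (Rep_ell2 x i))\<^sup>2" UNIV i] Rep_ell2[of x]
      unfolding self by simp
    thus "x = 0" by (simp add: Rep_ell2_inject[symmetric] zero_ell2.rep_eq fun_eq_iff)
  next
    show "x = 0 \<Longrightarrow> inner x x = 0" unfolding self by (simp add: zero_ell2.rep_eq)
  qed
qed

end

lemma ell2_norm_sq: "(norm x)\<^sup>2 = (\<Sum>\<^sub>\<infinity>i. (cmod (Rep_ell2 x i))\<^sup>2)"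
proof -
  have "cinner x x = (\<Sum>\<^sub>\<infinity>i. complex_of_real ((cmod (Rep_ell2 x i))\<^sup>2))"
    by (simp only: cinner_ell2.rep_eq complex_norm_square mult.commute)
  also have "\<dots> = complex_of_real (\<Sum>\<^sub>\<infinity>i. (cmod (Rep_ell2 x i))\<^sup>2)"
    using Rep_ell2[of x] by (intro infsumI has_sum_of_real) simp
  finally show ?thesis by (simp add: cinner_self of_real_eq_iff del: of_real_power)
qed

lemma ell2_sum_le_norm_sq: "finite F \<Longrightarrow> (\<Sum>i\<in>F. (cmod (Rep_ell2 x i))\<^sup>2) \<le> (norm x)\<^sup>2"
  unfolding ell2_norm_sq using Rep_ell2[of x] by (intro finite_sum_le_infsum) auto

lemma ell2_coord_le_norm: "cmod (Rep_ell2 x i) \<le> norm x"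
  using ell2_sum_le_norm_sq[of "{i}" x] by (simp add: power2_le_iff_abs_le)

lemma ell2_bounded_finite_sums:
  assumes "\<And>F. finite F \<Longrightarrow> (\<Sum>i\<in>F. (cmod (f i))\<^sup>2) \<le> e\<^sup>2" "0 \<le> e"
  shows "(\<lambda>i. (cmod (f i))\<^sup>2) summable_on UNIV" "norm (Abs_ell2 f) \<le> e"
proof -
  show s: "(\<lambda>i. (cmod (f i))\<^sup>2) summable_on UNIV"
    by (rule nonneg_bdd_above_summable_on) (auto intro!: bdd_aboveI[of _ "e\<^sup>2"] assms)
  have "(norm (Abs_ell2 f))\<^sup>2 \<le> e\<^sup>2"
    unfolding ell2_norm_sq using s assms(1)
    by (simp add: Abs_ell2_inverse infsum_le_finite_sums)
  thus "norm (Abs_ell2 f) \<le> e" using assms(2) by (rule power2_le_imp_le)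
qed

instance ell2 :: (type) chilbert_space
proof
  fix X :: "nat \<Rightarrow> 'a ell2"
  assume C: "Cauchy X"
  have "Cauchy (\<lambda>n. Rep_ell2 (X n) i)" for i
  proof (rule metric_CauchyI)
    fix e :: real assume "0 < e"
    then obtain N where N: "\<And>m n. m \<ge> N \<Longrightarrow> n \<ge> N \<Longrightarrow> dist (X m) (X n) < e"
      using C unfolding Cauchy_def by blast
    have "dist (Rep_ell2 (X m) i) (Rep_ell2 (X n) i) \<le> dist (X m) (X n)" for m n
      using ell2_coord_le_norm[of "X m - X n" i] by (simp add: dist_norm minus_ell2.rep_eq)
    thus "\<exists>N. \<forall>m\<ge>N. \<forall>n\<ge>N. dist (Rep_ell2 (X m) i) (Rep_ell2 (X n) i) < e"
      using N by (meson le_less_trans)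
  qed
  hence "\<forall>i. \<exists>l. (\<lambda>n. Rep_ell2 (X n) i) \<longlonglongrightarrow> l"
    by (simp add: Cauchy_convergent_iff convergent_def)
  then obtain g where g: "\<And>i. (\<lambda>n. Rep_ell2 (X n) i) \<longlonglongrightarrow> g i" by metis
  define d where "d m i = Rep_ell2 (X m) i - g i" for m i
  have bound: "\<exists>N. \<forall>m\<ge>N. \<forall>F. finite F \<longrightarrow> (\<Sum>i\<in>F. (cmod (d m i))\<^sup>2) \<le> e\<^sup>2" if e0: "0 < e" for e
  proof -
    obtain N where N: "\<And>m n. m \<ge> N \<Longrightarrow> n \<ge> N \<Longrightarrow> dist (X m) (X n) < e"
      using C e0 unfolding Cauchy_def by blast
    have "(\<Sum>i\<in>F. (cmod (d m i))\<^sup>2) \<le> e\<^sup>2" if "m \<ge> N" "finite F" for m F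
    proof (rule LIMSEQ_le_const2)
      show "(\<lambda>n. \<Sum>i\<in>F. (cmod (Rep_ell2 (X m) i - Rep_ell2 (X n) i))\<^sup>2)
          \<longlonglongrightarrow> (\<Sum>i\<in>F. (cmod (d m i))\<^sup>2)"
        unfolding d_def by (intro tendsto_intros g)
      have "(\<Sum>i\<in>F. (cmod (Rep_ell2 (X m) i - Rep_ell2 (X n) i))\<^sup>2) \<le> e\<^sup>2" if "n \<ge> N" for n
      proof -
        have "(\<Sum>i\<in>F. (cmod (Rep_ell2 (X m - X n) i))\<^sup>2) \<le> (norm (X m - X n))\<^sup>2"
          using \<open>finite F\<close> by (rule ell2_sum_le_norm_sq)
        also have "\<dots> \<le> e\<^sup>2"
          using N[OF \<open>m \<ge> N\<close> that] by (intro power_mono) (auto simp: dist_norm)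
        finally show ?thesis by (simp add: minus_ell2.rep_eq)
      qed
      thus "\<exists>N. \<forall>n\<ge>N. (\<Sum>i\<in>F. (cmod (Rep_ell2 (X m) i - Rep_ell2 (X n) i))\<^sup>2) \<le> e\<^sup>2"
        by blast
    qed
    thus ?thesis by blast
  qed
  obtain N1 where N1: "\<And>F. finite F \<Longrightarrow> (\<Sum>i\<in>F. (cmod (d N1 i))\<^sup>2) \<le> 1\<^sup>2"
    using bound[of 1] by auto
  have d1: "(\<lambda>i. (cmod (d N1 i))\<^sup>2) summable_on UNIV"
    by (rule ell2_bounded_finite_sums(1)[OF N1]) auto
  define L where "L = X N1 - Abs_ell2 (d N1)"
  have L: "Rep_ell2 L = g"
    using d1 by (simp add: L_def minus_ell2.rep_eq Abs_ell2_inverse fun_eq_iff) (simp add: d_def)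
  have dL: "X m - L = Abs_ell2 (d m)" for m
    by (rule Rep_ell2_inject[THEN iffD1], subst Abs_ell2_inverse)
      (use Rep_ell2[of "X m - L"] in \<open>auto simp: minus_ell2.rep_eq L d_def fun_eq_iff\<close>)
  have "X \<longlonglongrightarrow> L"
  proof (rule metric_LIMSEQ_I)
    fix e :: real assume "0 < e"
    then obtain N where N: "\<And>m F. m \<ge> N \<Longrightarrow> finite F \<Longrightarrow> (\<Sum>i\<in>F. (cmod (d m i))\<^sup>2) \<le> (e/2)\<^sup>2"
      using bound[of "e/2"] by auto
    have "dist (X m) L < e" if "m \<ge> N" for m
      using ell2_bounded_finite_sums(2)[OF N[OF that]] \<open>0 < e\<close> by (simp add: dist_norm dL)
    thus "\<exists>N. \<forall>m\<ge>N. dist (X m) L < e" by blast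
  qed
  thus "convergent X" by (rule convergentI)
qed

section \<open>The Hilbert space tensor product\<close>

definition orthonormal :: "'a::complex_inner set \<Rightarrow> bool" where
  "orthonormal B \<longleftrightarrow> (\<forall>x\<in>B. \<forall>y\<in>B. cinner x y = (if x = y then 1 else 0))"

definition isometric_embedding :: "('a::complex_inner \<Rightarrow> 'b::complex_inner) \<Rightarrow> bool" where
  "isometric_embedding U \<longleftrightarrow> (\<forall>x y. U (x + y) = U x + U y) \<and> (\<forall>c x. U (c *\<^sub>C x) = c *\<^sub>C U x) \<and>
     (\<forall>x y. cinner (U x) (U y) = cinner x y)"

lemma exists_maximal_orthonormal:
  "\<exists>B::'a::complex_inner set. orthonormal B \<and> (\<forall>C. orthonormal C \<longrightarrow> B \<subseteq> C \<longrightarrow> C = B)"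
proof -
  have "\<exists>M\<in>Collect orthonormal. \<forall>X\<in>Collect orthonormal. M \<subseteq> X \<longrightarrow> X = (M::'a set)"
  proof (rule subset_Zorn')
    fix C :: "'a set set" assume C: "subset.chain (Collect orthonormal) C"
    have "cinner x y = (if x = y then 1 else 0)" if xy: "X \<in> C" "Y \<in> C" "x \<in> X" "y \<in> Y" for x y X Y
    proof -
      have "X \<subseteq> Y \<or> Y \<subseteq> X" using C xy by (auto simp: subset.chain_def)
      moreover have "orthonormal X" "orthonormal Y" using C xy by (auto simp: subset.chain_def)
      ultimately show ?thesis using xy by (auto simp: orthonormal_def)
    qed
    thus "\<Union>C \<in> Collect orthonormal" unfolding mem_Collect_eq orthonormal_def by blast
  qed
  thus ?thesis by auto
qed

lemma norm_sq_orthonormal_sum: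
  assumes "orthonormal B" "finite F" "F \<subseteq> B"
  shows "(norm (\<Sum>b\<in>F. c b *\<^sub>C b))\<^sup>2 = (\<Sum>b\<in>F. (cmod (c b))\<^sup>2)"
proof -
  have "cinner (\<Sum>b\<in>F. c b *\<^sub>C b) (\<Sum>b\<in>F. c b *\<^sub>C b)
      = (\<Sum>b\<in>F. \<Sum>b'\<in>F. cnj (c b) * c b' * cinner b b')"
    unfolding cinner_sum_left
    by (intro sum.cong refl)
      (simp add: cinner_sum_right cinner_scaleC_left cinner_scaleC_right sum_distrib_left mult_ac)
  also have "\<dots> = (\<Sum>b\<in>F. \<Sum>b'\<in>F. if b = b' then cnj (c b) * c b' else 0)"
  proof (intro sum.cong refl)
    fix b b' assume "b \<in> F" "b' \<in> F"
    hence "b \<in> B" "b' \<in> B" using assms by auto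
    hence "cinner b b' = (if b = b' then 1 else 0)" using assms unfolding orthonormal_def by blast
    thus "cnj (c b) * c b' * cinner b b' = (if b = b' then cnj (c b) * c b' else 0)" by simp
  qed
  also have "\<dots> = (\<Sum>b\<in>F. complex_of_real ((cmod (c b))\<^sup>2))"
    using assms(2) by (intro sum.cong refl) (simp add: complex_norm_square mult.commute del: of_real_power)
  finally have "complex_of_real ((norm (\<Sum>b\<in>F. c b *\<^sub>C b))\<^sup>2)
      = complex_of_real (\<Sum>b\<in>F. (cmod (c b))\<^sup>2)"
    by (simp add: cinner_self)
  thus ?thesis by (simp only: of_real_eq_iff)
qed

lemma cinner_orthonormal_sum:
  assumes "orthonormal B" "finite F" "F \<subseteq> B" "b \<in> B"
  shows "cinner b (\<Sum>b\<in>F. c b *\<^sub>C b) = (if b \<in> F then c b else 0)"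
proof -
  have "cinner b (\<Sum>b\<in>F. c b *\<^sub>C b) = (\<Sum>b'\<in>F. c b' * cinner b b')"
    by (simp add: cinner_sum_right cinner_scaleC_right)
  also have "\<dots> = (\<Sum>b'\<in>F. if b = b' then c b' else 0)"
  proof (intro sum.cong refl)
    fix b' assume "b' \<in> F"
    hence "b' \<in> B" using assms by auto
    hence "cinner b b' = (if b = b' then 1 else 0)" using assms unfolding orthonormal_def by blast
    thus "c b' * cinner b b' = (if b = b' then c b' else 0)" by simp
  qed
  finally show ?thesis using assms(2) by simp
qed

lemma Bessel:
  assumes "orthonormal B" "finite F" "F \<subseteq> B"
  shows "(\<Sum>b\<in>F. (cmod (cinner b x))\<^sup>2) \<le> (norm x)\<^sup>2"
proof -
  define p where "p = (\<Sum>b\<in>F. cinner b x *\<^sub>C b)"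
  have "cinner p x = (\<Sum>b\<in>F. complex_of_real ((cmod (cinner b x))\<^sup>2))"
    unfolding p_def cinner_sum_left cinner_scaleC_left
    by (intro sum.cong refl) (simp only: complex_norm_square mult.commute)
  hence "inner p x = (\<Sum>b\<in>F. (cmod (cinner b x))\<^sup>2)"
    by (simp add: inner_eq_Re_cinner)
  moreover have "inner p p = (\<Sum>b\<in>F. (cmod (cinner b x))\<^sup>2)"
    unfolding p_def power2_norm_eq_inner[symmetric] by (rule norm_sq_orthonormal_sum[OF assms])
  moreover have "0 \<le> inner (x - p) (x - p)" by simp
  ultimately show ?thesis
    by (simp add: power2_norm_eq_inner inner_diff_left inner_diff_right inner_commute)
qed

lemma Parseval:
  fixes x :: "'a::chilbert_space"
  assumes B: "orthonormal B" and max: "\<And>C. orthonormal C \<Longrightarrow> B \<subseteq> C \<Longrightarrow> C = B"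
  shows "(\<lambda>b. (cmod (cinner b x))\<^sup>2) summable_on B"
    and "(\<Sum>\<^sub>\<infinity>b\<in>B. (cmod (cinner b x))\<^sup>2) = (norm x)\<^sup>2"
proof -
  define a where "a b = (cmod (cinner b x))\<^sup>2" for b
  define c where "c = infsum a B"
  have a0: "0 \<le> a b" for b by (simp add: a_def)
  show sm: "(\<lambda>b. (cmod (cinner b x))\<^sup>2) summable_on B"
    by (rule nonneg_bdd_above_summable_on)
      (auto intro!: bdd_aboveI[of _ "(norm x)\<^sup>2"] Bessel[OF B])
  hence sa: "a summable_on B" by (simp add: a_def[abs_def])
  have fin: "sum a F \<le> c" if "finite F" "F \<subseteq> B" for F
    unfolding c_def using sa that by (intro finite_sum_le_infsum) (auto simp: a0)
  have "\<exists>F. finite F \<and> F \<subseteq> B \<and> c - 1 / real (Suc n) < sum a F" for n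
  proof -
    define e where "e = 1 / real (Suc n)"
    have e: "0 < e" by (simp add: e_def)
    then obtain F where F: "finite F" "F \<subseteq> B" "dist (sum a F) (infsum a B) \<le> e / 2"
      using infsum_finite_approximation[OF sa, of "e / 2"] by auto
    have "c - sum a F \<le> e / 2"
      using F(3) unfolding dist_real_def c_def by linarith
    hence "c - e < sum a F" using e by linarith
    thus ?thesis using F unfolding e_def by blast
  qed
  then obtain F where F: "\<And>n. finite (F n)" "\<And>n. F n \<subseteq> B" "\<And>n. c - 1 / real (Suc n) < sum a (F n)"
    by metis
  define G where "G n = (\<Union>k\<le>n. F k)" for n
  have G: "finite (G n)" "G n \<subseteq> B" for n using F by (auto simp: G_def)
  have Gm: "m \<le> n \<Longrightarrow> G m \<subseteq> G n" for m n by (fastforce simp: G_def)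
  have Gc: "c - 1 / real (Suc n) < sum a (G n)" for n
  proof -
    have "sum a (F n) \<le> sum a (G n)"
      by (rule sum_mono2) (auto simp: G a0 G_def F)
    thus ?thesis using F(3)[of n] by linarith
  qed
  define p where "p n = (\<Sum>b\<in>G n. cinner b x *\<^sub>C b)" for n
  have np: "(norm (p n))\<^sup>2 = sum a (G n)" for n
    unfolding p_def a_def by (rule norm_sq_orthonormal_sum[OF B G])
  have dp: "(norm (p n - p m))\<^sup>2 < 1 / real (Suc m)" if "m \<le> n" for m n
  proof -
    have "p n - p m = (\<Sum>b\<in>G n - G m. cinner b x *\<^sub>C b)"
      unfolding p_def by (rule sum_diff[symmetric]) (use G Gm that in auto)
    hence "(norm (p n - p m))\<^sup>2 = sum a (G n - G m)"
      using norm_sq_orthonormal_sum[OF B, of "G n - G m" "\<lambda>b. cinner b x"] G[of n]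
      by (simp add: a_def subset_eq)
    also have "\<dots> = sum a (G n) - sum a (G m)"
      by (rule sum_diff) (use G Gm that in auto)
    also have "\<dots> < 1 / real (Suc m)" using fin[OF G, of n] Gc[of m] by linarith
    finally show ?thesis .
  qed
  have "Cauchy p"
  proof (rule CauchyI')
    fix e :: real assume e: "0 < e"
    then obtain M where M: "1 / real (Suc M) < e\<^sup>2"
      using nat_approx_posE[of "e\<^sup>2"] by (auto simp: zero_less_power)
    have "dist (p m) (p n) < e" if "M \<le> m" "m < n" for m n
    proof -
      have "1 / real (Suc m) \<le> 1 / real (Suc M)" using that by (simp add: frac_le)
      hence "(norm (p n - p m))\<^sup>2 < e\<^sup>2" using dp[of m n] that M by linarith
      hence "norm (p n - p m) < e" using e by (simp add: power2_less_imp_less)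
      thus ?thesis by (simp add: dist_norm norm_minus_commute)
    qed
    thus "\<exists>M. \<forall>m\<ge>M. \<forall>n>m. dist (p m) (p n) < e" by blast
  qed
  then obtain s where s: "p \<longlonglongrightarrow> s" using Cauchy_convergent convergent_def by blast
  have bs: "cinner b s = cinner b x" if b: "b \<in> B" for b
  proof (rule LIMSEQ_unique)
    show "(\<lambda>n. cinner b (p n)) \<longlonglongrightarrow> cinner b s"
      by (rule bounded_linear.tendsto[OF bounded_linear_cinner_right s])
    show "(\<lambda>n. cinner b (p n)) \<longlonglongrightarrow> cinner b x"
    proof (rule metric_LIMSEQ_I)
      fix e :: real assume e: "0 < e"
      then obtain M where M: "1 / real (Suc M) < e\<^sup>2"
        using nat_approx_posE[of "e\<^sup>2"] by (auto simp: zero_less_power)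
      have "dist (cinner b (p n)) (cinner b x) < e" if "M \<le> n" for n
      proof (cases "b \<in> G n")
        case True
        thus ?thesis using e cinner_orthonormal_sum[OF B G b, of "\<lambda>b. cinner b x" n]
          by (simp add: p_def)
      next
        case False
        have "sum a (insert b (G n)) \<le> c" by (rule fin) (use G b in auto)
        hence "a b + sum a (G n) \<le> c" using False G by simp
        hence "a b < 1 / real (Suc n)" using Gc[of n] by linarith
        also have "\<dots> \<le> 1 / real (Suc M)" using that by (simp add: frac_le)
        finally have "(cmod (cinner b x))\<^sup>2 < e\<^sup>2" using M by (simp add: a_def)
        hence "cmod (cinner b x) < e" using e by (simp add: power2_less_imp_less)
        thus ?thesis using False cinner_orthonormal_sum[OF B G b, of "\<lambda>b. cinner b x" n]
          by (simp add: p_def dist_norm)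
      qed
      thus "\<exists>N. \<forall>n\<ge>N. dist (cinner b (p n)) (cinner b x) < e" by blast
    qed
  qed
  have "x = s"
  proof (rule ccontr)
    assume ne: "x \<noteq> s"
    define u where "u = complex_of_real (1 / norm (x - s)) *\<^sub>C (x - s)"
    have bu: "cinner b u = 0" if "b \<in> B" for b
      using bs[OF that] by (simp add: u_def cinner_scaleC_right cinner_diff_right)
    have ub: "cinner u b = 0" if "b \<in> B" for b
      using bu[OF that] cinner_commute[of u b] by simp
    have "norm u = 1" using ne by (simp add: u_def norm_scaleC norm_divide)
    hence uu: "cinner u u = 1" by (simp add: cinner_self)
    have uB: "u \<notin> B" using bu[of u] uu by auto
    have "orthonormal (insert u B)"
      using B bu ub uu uB unfolding orthonormal_def by auto
    hence "insert u B = B" by (rule max) auto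
    thus False using uB by blast
  qed
  have "(\<lambda>n. (norm (p n))\<^sup>2) \<longlonglongrightarrow> (norm x)\<^sup>2"
    unfolding \<open>x = s\<close> by (intro tendsto_intros s)
  moreover have "(norm (p n))\<^sup>2 \<le> c" for n unfolding np by (rule fin[OF G])
  ultimately have "(norm x)\<^sup>2 \<le> c" by (intro LIMSEQ_le_const2) auto
  moreover have "c \<le> (norm x)\<^sup>2"
    unfolding c_def a_def by (rule infsum_le_finite_sums[OF sm]) (rule Bessel[OF B])
  ultimately show "(\<Sum>\<^sub>\<infinity>b\<in>B. (cmod (cinner b x))\<^sup>2) = (norm x)\<^sup>2"
    by (simp add: c_def a_def[abs_def])
qed

lemma isometric_embedding_exists: "\<exists>U :: 'a::chilbert_space \<Rightarrow> 'a ell2. isometric_embedding U"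
proof -
  obtain B :: "'a set" where B: "orthonormal B" and max: "\<And>C. orthonormal C \<Longrightarrow> B \<subseteq> C \<Longrightarrow> C = B"
    using exists_maximal_orthonormal by metis
  define u where "u x b = (if b \<in> B then cinner b x else 0)" for x b
  have eqB: "(\<lambda>b. (cmod (u x b))\<^sup>2) summable_on UNIV \<longleftrightarrow> (\<lambda>b. (cmod (cinner b x))\<^sup>2) summable_on B"
    for x by (rule summable_on_cong_neutral) (auto simp: u_def)
  have su: "(\<lambda>b. (cmod (u x b))\<^sup>2) summable_on UNIV" for x
    unfolding eqB by (rule Parseval[OF B max])
  define U where "U x = Abs_ell2 (u x)" for x
  have RU: "Rep_ell2 (U x) = u x" for x using su by (simp add: U_def Abs_ell2_inverse)
  have add: "U (x + y) = U x + U y" for x y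
    by (simp add: Rep_ell2_inject[symmetric] plus_ell2.rep_eq RU fun_eq_iff)
      (simp add: u_def cinner_add_right)
  have sc: "U (c *\<^sub>C x) = c *\<^sub>C U x" for c x
    by (simp add: Rep_ell2_inject[symmetric] scaleC_ell2.rep_eq RU fun_eq_iff)
      (simp add: u_def cinner_scaleC_right)
  have nm: "(norm (U x))\<^sup>2 = (norm x)\<^sup>2" for x
  proof -
    have "(norm (U x))\<^sup>2 = (\<Sum>\<^sub>\<infinity>b\<in>B. (cmod (cinner b x))\<^sup>2)"
      unfolding ell2_norm_sq RU by (rule infsum_cong_neutral) (auto simp: u_def)
    thus ?thesis using Parseval(2)[OF B max, of x] by simp
  qed
  have inn: "inner (U x) (U y) = inner x y" for x y
    by (simp add: dot_norm add[symmetric] nm)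
  have "cinner (U x) (U y) = cinner x y" for x y
  proof (rule complex_eqI)
    show "Re (cinner (U x) (U y)) = Re (cinner x y)"
      using inn[of x y] by (simp add: inner_eq_Re_cinner)
    show "Im (cinner (U x) (U y)) = Im (cinner x y)"
      using inn[of x "\<i> *\<^sub>C y"] by (simp add: inner_eq_Re_cinner sc cinner_scaleC_right)
  qed
  thus ?thesis using add sc unfolding isometric_embedding_def by blast
qed

definition l2_coords :: "'a::chilbert_space \<Rightarrow> 'a ell2" where
  "l2_coords = (SOME U. isometric_embedding U)"

lemma l2_coords: "isometric_embedding l2_coords"
  unfolding l2_coords_def by (rule someI_ex[OF isometric_embedding_exists])

lemma infsum_prod_mult:
  fixes u :: "'a \<Rightarrow> 'c::{banach,real_normed_field}" and v :: "'b \<Rightarrow> 'c"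
  assumes u: "(\<lambda>i. norm (u i)) summable_on UNIV" and v: "(\<lambda>j. norm (v j)) summable_on UNIV"
  shows "(\<lambda>(i, j). norm (u i * v j)) summable_on UNIV"
    and "(\<Sum>\<^sub>\<infinity>(i, j). u i * v j) = (\<Sum>\<^sub>\<infinity>i. u i) * (\<Sum>\<^sub>\<infinity>j. v j)"
proof -
  have "(\<lambda>p. norm (case p of (i, j) \<Rightarrow> u i * v j)) summable_on (UNIV \<times> UNIV)"
  proof (rule Infinite_Sum.abs_summable_on_Sigma_iff[THEN iffD2], intro conjI ballI)
    fix i :: 'a
    show "(\<lambda>j. norm (case (i, j) of (i, j) \<Rightarrow> u i * v j)) summable_on UNIV"
      using summable_on_cmult_right[OF v, of "norm (u i)"] by (simp add: norm_mult)
  next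
    have "0 \<le> (\<Sum>\<^sub>\<infinity>j. norm (v j))" by (rule infsum_nonneg) simp
    hence "(\<lambda>i. norm (norm (u i) * (\<Sum>\<^sub>\<infinity>j. norm (v j)))) summable_on UNIV"
      using summable_on_cmult_left[OF u, of "\<Sum>\<^sub>\<infinity>j. norm (v j)"] by simp
    thus "(\<lambda>i. norm (\<Sum>\<^sub>\<infinity>j. norm (case (i, j) of (i, j) \<Rightarrow> u i * v j))) summable_on UNIV"
      by (simp add: norm_mult infsum_cmult_right')
  qed
  hence s: "(\<lambda>p. norm (case p of (i, j) \<Rightarrow> u i * v j)) summable_on UNIV" by simp
  thus "(\<lambda>(i, j). norm (u i * v j)) summable_on UNIV"
    by (simp add: case_prod_unfold)
  have "(\<lambda>(i, j). u i * v j) summable_on UNIV"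
    by (rule abs_summable_summable[OF s])
  hence "(\<lambda>(i, j). u i * v j) summable_on (UNIV \<times> UNIV)" by simp
  from infsum_Sigma'_banach[OF this]
  have "(\<Sum>\<^sub>\<infinity>(i, j)\<in>UNIV \<times> UNIV. u i * v j) = (\<Sum>\<^sub>\<infinity>i. \<Sum>\<^sub>\<infinity>j. u i * v j)" by simp
  thus "(\<Sum>\<^sub>\<infinity>(i, j). u i * v j) = (\<Sum>\<^sub>\<infinity>i. u i) * (\<Sum>\<^sub>\<infinity>j. v j)"
    by (simp add: infsum_cmult_right' infsum_cmult_left')
qed

lift_definition ell2_tensor :: "'a ell2 \<Rightarrow> 'b ell2 \<Rightarrow> ('a \<times> 'b) ell2" is "\<lambda>f g (i, j). f i * g j"
  subgoal premises prems for f g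
    using infsum_prod_mult(1)[of "\<lambda>i. (cmod (f i))\<^sup>2" "\<lambda>i. (cmod (g i))\<^sup>2"] prems
    by (simp add: case_prod_unfold norm_mult power_mult_distrib)
  done

lemma cinner_ell2_tensor:
  "cinner (ell2_tensor f g) (ell2_tensor f' g') = cinner f f' * cinner g g'"
proof -
  have s: "(\<lambda>i. norm (cnj (Rep_ell2 h i) * Rep_ell2 h' i)) summable_on UNIV" for h h' :: "'c ell2"
    using ell2_cinner_summable[of "Rep_ell2 h" "Rep_ell2 h'"] Rep_ell2[of h] Rep_ell2[of h']
    by (simp add: summable_on_iff_abs_summable_on_complex)
  show ?thesis
    using infsum_prod_mult(2)[OF s s, of f f' g g']
    by (simp add: cinner_ell2.rep_eq ell2_tensor.rep_eq case_prod_unfold mult_ac)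
qed

text \<open>
  The Hilbert tensor product: the completed span of the elementary tensors, realized inside
  the square-summable families by an arbitrary choice of coordinates.  What matters about it is
  \<open>cinner_tensor\<close>, the bilinearity of \<open>\<otimes>\<^sub>v\<close> and \<open>tensor_dense\<close> below, which determine it
  up to a unique unitary.
\<close>

definition tensor_subspace :: "('a::chilbert_space \<times> 'b::chilbert_space) ell2 set" where
  "tensor_subspace = closure (span {ell2_tensor (l2_coords x) (l2_coords y) |x y. True})"

lemma subspace_closure:
  fixes S :: "'a::real_normed_vector set"
  assumes "subspace S"
  shows "subspace (closure S)"
proof (rule subspaceI)
  show "0 \<in> closure S" using subspace_0[OF assms] closure_subset by blast
next
  fix x y assume "x \<in> closure S" "y \<in> closure S"
  then obtain f g where "\<And>n. f n \<in> S" "f \<longlonglongrightarrow> x" "\<And>n. g n \<in> S" "g \<longlonglongrightarrow> y"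
    unfolding closure_sequential by blast
  thus "x + y \<in> closure S"
    unfolding closure_sequential
    by (intro exI[of _ "\<lambda>n. f n + g n"]) (auto intro: tendsto_add subspace_add[OF assms])
next
  fix c :: real and x assume "x \<in> closure S"
  then obtain f where "\<And>n. f n \<in> S" "f \<longlonglongrightarrow> x"
    unfolding closure_sequential by blast
  thus "c *\<^sub>R x \<in> closure S"
    unfolding closure_sequential
    by (intro exI[of _ "\<lambda>n. c *\<^sub>R f n"]) (auto intro: tendsto_scaleR subspace_scale[OF assms])
qed

lemma subspace_tensor_subspace: "subspace tensor_subspace"
  unfolding tensor_subspace_def by (intro subspace_closure subspace_span)

lemma scaleC_tensor_subspace:
  fixes z :: "('a::chilbert_space \<times> 'b::chilbert_space) ell2"
  assumes "z \<in> tensor_subspace"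
  shows "c *\<^sub>C z \<in> tensor_subspace"
proof -
  let ?T = "{ell2_tensor (l2_coords x) (l2_coords y) |(x::'a) (y::'b). True}"
  have lin: "linear (\<lambda>z::('a \<times> 'b) ell2. c *\<^sub>C z)"
    by (rule bounded_linear.linear[OF bounded_linear_scaleC])
  have "(\<lambda>z. c *\<^sub>C z) ` ?T \<subseteq> ?T"
  proof clarsimp
    fix x :: 'a and y :: 'b
    have "c *\<^sub>C ell2_tensor (l2_coords x) (l2_coords y)
        = ell2_tensor (l2_coords (c *\<^sub>C x)) (l2_coords y)"
      using l2_coords[where 'a='a] unfolding isometric_embedding_def
      by (simp add: Rep_ell2_inject[symmetric] scaleC_ell2.rep_eq ell2_tensor.rep_eq fun_eq_iff)
    thus "\<exists>x' y'. c *\<^sub>C ell2_tensor (l2_coords x) (l2_coords y)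
        = ell2_tensor (l2_coords (x'::'a)) (l2_coords (y'::'b))" by blast
  qed
  hence "(\<lambda>z. c *\<^sub>C z) ` span ?T \<subseteq> span ?T"
    unfolding linear_span_image[OF lin, symmetric] by (rule span_mono)
  moreover have "(\<lambda>z. c *\<^sub>C z) ` closure (span ?T) \<subseteq> closure ((\<lambda>z. c *\<^sub>C z) ` span ?T)"
    by (rule closure_bounded_linear_image_subset[OF bounded_linear_scaleC])
  ultimately show ?thesis
    using assms closure_mono unfolding tensor_subspace_def by blast
qed

typedef (overloaded) ('a, 'b) htensor =
    "tensor_subspace :: ('a::chilbert_space \<times> 'b::chilbert_space) ell2 set"
  using subspace_0[OF subspace_tensor_subspace] by blast

setup_lifting type_definition_htensor

instantiation htensor :: (chilbert_space, chilbert_space) complex_inner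
begin

lift_definition zero_htensor :: "('a, 'b) htensor" is 0
  by (rule subspace_0[OF subspace_tensor_subspace])
lift_definition plus_htensor :: "('a, 'b) htensor \<Rightarrow> ('a, 'b) htensor \<Rightarrow> ('a, 'b) htensor" is "(+)"
  by (rule subspace_add[OF subspace_tensor_subspace])
lift_definition uminus_htensor :: "('a, 'b) htensor \<Rightarrow> ('a, 'b) htensor" is uminus
  by (rule subspace_neg[OF subspace_tensor_subspace])
lift_definition minus_htensor :: "('a, 'b) htensor \<Rightarrow> ('a, 'b) htensor \<Rightarrow> ('a, 'b) htensor" is "(-)"
  by (rule subspace_diff[OF subspace_tensor_subspace])
lift_definition scaleC_htensor :: "complex \<Rightarrow> ('a, 'b) htensor \<Rightarrow> ('a, 'b) htensor" is scaleC
  by (rule scaleC_tensor_subspace)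
lift_definition scaleR_htensor :: "real \<Rightarrow> ('a, 'b) htensor \<Rightarrow> ('a, 'b) htensor" is scaleR
  by (rule subspace_scale[OF subspace_tensor_subspace])
lift_definition cinner_htensor :: "('a, 'b) htensor \<Rightarrow> ('a, 'b) htensor \<Rightarrow> complex" is cinner .
lift_definition inner_htensor :: "('a, 'b) htensor \<Rightarrow> ('a, 'b) htensor \<Rightarrow> real" is inner .
lift_definition norm_htensor :: "('a, 'b) htensor \<Rightarrow> real" is norm .
lift_definition dist_htensor :: "('a, 'b) htensor \<Rightarrow> ('a, 'b) htensor \<Rightarrow> real" is dist .
lift_definition sgn_htensor :: "('a, 'b) htensor \<Rightarrow> ('a, 'b) htensor" is sgn
  by (simp add: sgn_div_norm subspace_scale[OF subspace_tensor_subspace])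
definition uniformity_htensor :: "(('a, 'b) htensor \<times> ('a, 'b) htensor) filter" where
  "uniformity_htensor = (INF e\<in>{0<..}. principal {(x, y). dist x y < e})"
definition open_htensor :: "('a, 'b) htensor set \<Rightarrow> bool" where
  "open_htensor U = (\<forall>x\<in>U. eventually (\<lambda>(x', y). x' = x \<longrightarrow> y \<in> U) uniformity)"

instance
proof
  fix x y z :: "('a, 'b) htensor" and a b :: complex and r s :: real
  show "x + y + z = x + (y + z)" by transfer (simp add: add.assoc)
  show "x + y = y + x" by transfer (simp add: add.commute)
  show "0 + x = x" by transfer simp
  show "- x + x = 0" by transfer simp
  show "x - y = x + - y" by transfer simp
  show "r *\<^sub>R (x + y) = r *\<^sub>R x + r *\<^sub>R y" by transfer (simp add: algebra_simps)
  show "(r + s) *\<^sub>R x = r *\<^sub>R x + s *\<^sub>R x" by transfer (simp add: algebra_simps)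
  show "r *\<^sub>R s *\<^sub>R x = (r * s) *\<^sub>R x" by transfer simp
  show "1 *\<^sub>R x = x" by transfer simp
  show "sgn x = inverse (norm x) *\<^sub>R x" by transfer (rule sgn_div_norm)
  show "dist x y = norm (x - y)" by transfer (rule dist_norm)
  show "uniformity = (INF e\<in>{0<..}. principal {(x, y). dist (x::('a, 'b) htensor) y < e})"
    by (rule uniformity_htensor_def)
  show "open U = (\<forall>x\<in>U. \<forall>\<^sub>F (x', y) in uniformity. x' = x \<longrightarrow> y \<in> U)"
    for U :: "('a, 'b) htensor set" by (rule open_htensor_def)
  show "norm x = sqrt (inner x x)" by transfer (rule norm_eq_sqrt_inner)
  show "cinner x y = cnj (cinner y x)" by transfer (rule cinner_commute)
  show "cinner x (y + z) = cinner x y + cinner x z" by transfer (rule cinner_add_right)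
  show "cinner x (a *\<^sub>C y) = a * cinner x y" by transfer (rule cinner_scaleC_right)
  show "inner x y = Re (cinner x y)" by transfer (rule inner_eq_Re_cinner)
  show "a *\<^sub>C (x + y) = a *\<^sub>C x + a *\<^sub>C y" by transfer (rule scaleC_add_right)
  show "(a + b) *\<^sub>C x = a *\<^sub>C x + b *\<^sub>C x" by transfer (rule scaleC_add_left)
  show "a *\<^sub>C b *\<^sub>C x = (a * b) *\<^sub>C x" by transfer (rule scaleC_scaleC)
  show "r *\<^sub>R x = complex_of_real r *\<^sub>C x" by transfer (rule scaleR_scaleC)
  show "inner x y = inner y x" by transfer (rule inner_commute)
  show "inner (x + y) z = inner x z + inner y z" by transfer (rule inner_add_left)
  show "inner (r *\<^sub>R x) y = r * inner x y" by transfer simp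
  show "0 \<le> inner x x" by transfer simp
  show "inner x x = 0 \<longleftrightarrow> x = 0" by transfer simp
qed

end

instance htensor :: (chilbert_space, chilbert_space) chilbert_space
proof
  fix X :: "nat \<Rightarrow> ('a, 'b) htensor"
  assume "Cauchy X"
  hence "Cauchy (\<lambda>n. Rep_htensor (X n))" by (simp add: Cauchy_def dist_htensor.rep_eq)
  then obtain l where l: "(\<lambda>n. Rep_htensor (X n)) \<longlonglongrightarrow> l"
    using Cauchy_convergent convergent_def by blast
  have "closed (tensor_subspace :: ('a \<times> 'b) ell2 set)" unfolding tensor_subspace_def by simp
  hence "l \<in> tensor_subspace" by (rule closed_sequentially[OF _ _ l]) (rule Rep_htensor)
  hence "X \<longlonglongrightarrow> Abs_htensor l"
    using l by (simp add: LIMSEQ_def dist_htensor.rep_eq Abs_htensor_inverse)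
  thus "convergent X" by (rule convergentI)
qed

lift_definition tensor_vec ::
    "'a::chilbert_space \<Rightarrow> 'b::chilbert_space \<Rightarrow> ('a, 'b) htensor"  (infixl \<open>\<otimes>\<^sub>v\<close> 70)
  is "\<lambda>x y. ell2_tensor (l2_coords x) (l2_coords y)"
  unfolding tensor_subspace_def by (rule closure_subset[THEN subsetD], rule span_base) blast

lemma cinner_tensor: "cinner (x \<otimes>\<^sub>v y) (x' \<otimes>\<^sub>v y') = cinner x x' * cinner y y'"
proof transfer
  fix x x' :: "'a::chilbert_space" and y y' :: "'b::chilbert_space"
  show "cinner (ell2_tensor (l2_coords x) (l2_coords y)) (ell2_tensor (l2_coords x') (l2_coords y'))
      = cinner x x' * cinner y y'"
    using l2_coords[where 'a='a] l2_coords[where 'a='b]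
    by (simp add: cinner_ell2_tensor isometric_embedding_def)
qed

lemma tensor_add_left: "(x + x') \<otimes>\<^sub>v y = x \<otimes>\<^sub>v y + x' \<otimes>\<^sub>v y"
proof transfer
  fix x x' :: "'a::chilbert_space" and y :: "'b::chilbert_space"
  show "ell2_tensor (l2_coords (x + x')) (l2_coords y) =
      ell2_tensor (l2_coords x) (l2_coords y) + ell2_tensor (l2_coords x') (l2_coords y)"
    using l2_coords[where 'a='a] unfolding isometric_embedding_def
    by (simp add: Rep_ell2_inject[symmetric] plus_ell2.rep_eq ell2_tensor.rep_eq fun_eq_iff
        algebra_simps)
qed

lemma tensor_add_right: "x \<otimes>\<^sub>v (y + y') = x \<otimes>\<^sub>v y + x \<otimes>\<^sub>v y'"
proof transfer
  fix x :: "'a::chilbert_space" and y y' :: "'b::chilbert_space"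
  show "ell2_tensor (l2_coords x) (l2_coords (y + y')) =
      ell2_tensor (l2_coords x) (l2_coords y) + ell2_tensor (l2_coords x) (l2_coords y')"
    using l2_coords[where 'a='b] unfolding isometric_embedding_def
    by (simp add: Rep_ell2_inject[symmetric] plus_ell2.rep_eq ell2_tensor.rep_eq fun_eq_iff
        algebra_simps)
qed

lemma tensor_scaleC_left: "(c *\<^sub>C x) \<otimes>\<^sub>v y = c *\<^sub>C (x \<otimes>\<^sub>v y)"
proof transfer
  fix c and x :: "'a::chilbert_space" and y :: "'b::chilbert_space"
  show "ell2_tensor (l2_coords (c *\<^sub>C x)) (l2_coords y) = c *\<^sub>C ell2_tensor (l2_coords x) (l2_coords y)"
    using l2_coords[where 'a='a] unfolding isometric_embedding_def
    by (simp add: Rep_ell2_inject[symmetric] scaleC_ell2.rep_eq ell2_tensor.rep_eq fun_eq_iff)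
qed

lemma tensor_scaleC_right: "x \<otimes>\<^sub>v (c *\<^sub>C y) = c *\<^sub>C (x \<otimes>\<^sub>v y)"
proof transfer
  fix c and x :: "'a::chilbert_space" and y :: "'b::chilbert_space"
  show "ell2_tensor (l2_coords x) (l2_coords (c *\<^sub>C y)) = c *\<^sub>C ell2_tensor (l2_coords x) (l2_coords y)"
    using l2_coords[where 'a='b] unfolding isometric_embedding_def
    by (simp add: Rep_ell2_inject[symmetric] scaleC_ell2.rep_eq ell2_tensor.rep_eq fun_eq_iff)
qed

lemma tensor_dense: "closure (span {x \<otimes>\<^sub>v y |x y. True}) = (UNIV :: ('a::chilbert_space, 'b::chilbert_space) htensor set)"
proof -
  let ?T = "{x \<otimes>\<^sub>v y |(x::'a) (y::'b). True}"
  let ?T' = "{ell2_tensor (l2_coords x) (l2_coords y) |(x::'a) (y::'b). True}"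
  have lin: "linear (Rep_htensor :: ('a, 'b) htensor \<Rightarrow> _)"
    by (rule linearI) (simp_all add: plus_htensor.rep_eq scaleR_htensor.rep_eq)
  have "Rep_htensor ` ?T = {Rep_htensor (x \<otimes>\<^sub>v y) |(x::'a) (y::'b). True}" by blast
  hence "Rep_htensor ` ?T = ?T'" by (simp add: tensor_vec.rep_eq)
  hence im: "Rep_htensor ` span ?T = span ?T'" by (simp add: linear_span_image[OF lin, symmetric])
  have "z \<in> closure (span ?T)" for z
  proof (subst closure_approachable, intro allI impI)
    fix e :: real assume "0 < e"
    have "Rep_htensor z \<in> closure (span ?T')"
      using Rep_htensor[of z] by (simp add: tensor_subspace_def)
    then obtain w' where "w' \<in> span ?T'" "dist w' (Rep_htensor z) < e"
      using \<open>0 < e\<close> by (auto simp: closure_approachable)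
    then obtain w where "w \<in> span ?T" "dist (Rep_htensor w) (Rep_htensor z) < e"
      unfolding im[symmetric] by blast
    thus "\<exists>w\<in>span ?T. dist w z < e" by (auto simp: dist_htensor.rep_eq)
  qed
  thus ?thesis by blast
qed

section \<open>Operators\<close>

definition bounded_ops :: "('a::complex_inner \<Rightarrow>\<^sub>L 'a) set"  (\<open>\<B>\<close>) where
  "\<B> = {T :: 'a \<Rightarrow>\<^sub>L 'a. \<forall>c x. T (c *\<^sub>C x) = c *\<^sub>C T x}"

definition adj :: "('a::complex_inner \<Rightarrow>\<^sub>L 'a) \<Rightarrow> ('a \<Rightarrow>\<^sub>L 'a)" where
  "adj T = (THE T' :: 'a \<Rightarrow>\<^sub>L 'a. \<forall>x y. cinner (T' x) y = cinner x (T y))"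

definition Re_op :: "('a::complex_inner \<Rightarrow>\<^sub>L 'a) \<Rightarrow> ('a \<Rightarrow>\<^sub>L 'a)" where
  "Re_op T = (1/2) *\<^sub>R (T + adj T)"

definition positive_op :: "('a::complex_inner \<Rightarrow>\<^sub>L 'a) \<Rightarrow> bool" where
  "positive_op T \<longleftrightarrow> (\<forall>x. cinner x (T x) \<in> \<real>\<^sub>\<ge>\<^sub>0)"

definition op_le :: "('a::complex_inner \<Rightarrow>\<^sub>L 'a) \<Rightarrow> ('a \<Rightarrow>\<^sub>L 'a) \<Rightarrow> bool" where
  "op_le S T \<longleftrightarrow> positive_op (T - S)"

definition tensor_op ::
    "('a::chilbert_space \<Rightarrow>\<^sub>L 'a) \<Rightarrow> ('b::chilbert_space \<Rightarrow>\<^sub>L 'b) \<Rightarrow> (('a, 'b) htensor \<Rightarrow>\<^sub>L ('a, 'b) htensor)"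
    (infixl \<open>\<otimes>\<^sub>o\<close> 70) where
  "S \<otimes>\<^sub>o T = (THE R :: ('a, 'b) htensor \<Rightarrow>\<^sub>L ('a, 'b) htensor. R \<in> \<B> \<and> (\<forall>x y. R (x \<otimes>\<^sub>v y) = S x \<otimes>\<^sub>v T y))"

text \<open>
  The free semigroup on generators indexed by \<open>'n\<close> is \<open>'n list\<close>.  The first argument
  is the identity of the operator algebra, i.e. the value at the empty word.
\<close>

fun word_op :: "('a::complex_inner \<Rightarrow>\<^sub>L 'a) \<Rightarrow> ('n \<Rightarrow> ('a \<Rightarrow>\<^sub>L 'a)) \<Rightarrow> 'n list \<Rightarrow> ('a \<Rightarrow>\<^sub>L 'a)" where
  "word_op E X [] = E"
| "word_op E X (i # \<alpha>) = X i o\<^sub>L word_op E X \<alpha>"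

text \<open>
  Since HOL cannot quantify over types inside a formula, ``every Hilbert space \<open>\<X>\<close>'' is
  rendered as ``every closed complex subspace \<open>M\<close> of \<open>'x\<close>'', where \<open>'x\<close> is an
  arbitrary infinite-dimensional Hilbert space that serves as universe: up to unitary equivalence
  these are all the Hilbert spaces of dimension at most that of \<open>'x\<close>.  An operator on \<open>M\<close> is
  represented by its extension by zero on the orthogonal complement of \<open>M\<close>; this is a
  *-isomorphism onto \<open>ops_on M\<close>, it preserves the operator norm, and it sends the identity of
  \<open>M\<close> to \<open>subspace_id M\<close>, the orthogonal projection onto \<open>M\<close>.  Likewise operators on the tensor product
  of \<open>M\<close> and \<open>'h\<close> live on \<open>('x, 'h) htensor\<close>, with identity \<open>subspace_id M \<otimes>\<^sub>o id_blinfun\<close>.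
\<close>

definition hilbert_subspace :: "'x::chilbert_space set \<Rightarrow> bool" where
  "hilbert_subspace M \<longleftrightarrow> subspace M \<and> (\<forall>c. \<forall>x\<in>M. c *\<^sub>C x \<in> M) \<and> closed M"

definition ops_on :: "'x::chilbert_space set \<Rightarrow> ('x \<Rightarrow>\<^sub>L 'x) set" where
  "ops_on M = {T \<in> \<B>. (\<forall>x. T x \<in> M) \<and> (\<forall>x. (\<forall>y\<in>M. cinner y x = 0) \<longrightarrow> T x = 0)}"

definition subspace_id :: "'x::chilbert_space set \<Rightarrow> ('x \<Rightarrow>\<^sub>L 'x)" where
  "subspace_id M = (THE P :: 'x \<Rightarrow>\<^sub>L 'x. P \<in> \<B> \<and> (\<forall>x. P x \<in> M \<and> (\<forall>y\<in>M. cinner y (x - P x) = 0)))"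

definition row_ball :: "'x::chilbert_space set \<Rightarrow> ('n::finite \<Rightarrow> ('x \<Rightarrow>\<^sub>L 'x)) set" where
  "row_ball M = {X. (\<forall>i. X i \<in> ops_on M) \<and> norm (\<Sum>i\<in>UNIV. X i o\<^sub>L adj (X i)) < 1}"

definition homogeneous_part ::
    "('n::finite list \<Rightarrow> ('h::chilbert_space \<Rightarrow>\<^sub>L 'h)) \<Rightarrow> 'x::chilbert_space set \<Rightarrow> ('n \<Rightarrow> ('x \<Rightarrow>\<^sub>L 'x))
      \<Rightarrow> nat \<Rightarrow> (('x, 'h) htensor \<Rightarrow>\<^sub>L ('x, 'h) htensor)" where
  "homogeneous_part A M X k = (\<Sum>\<alpha> | length \<alpha> = k. word_op (subspace_id M) X \<alpha> \<otimes>\<^sub>o A \<alpha>)"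

definition holomorphic_eval ::
    "('n::finite list \<Rightarrow> ('h::chilbert_space \<Rightarrow>\<^sub>L 'h)) \<Rightarrow> 'x::chilbert_space set \<Rightarrow> ('n \<Rightarrow> ('x \<Rightarrow>\<^sub>L 'x))
      \<Rightarrow> (('x, 'h) htensor \<Rightarrow>\<^sub>L ('x, 'h) htensor)" where
  "holomorphic_eval A M X = (\<Sum>k. homogeneous_part A M X k)"

definition universal_holomorphic ::
    "'x::chilbert_space itself \<Rightarrow> ('n::finite list \<Rightarrow> ('h::chilbert_space \<Rightarrow>\<^sub>L 'h)) \<Rightarrow> bool" where
  "universal_holomorphic _ A \<longleftrightarrow> (\<forall>\<alpha>. A \<alpha> \<in> \<B>) \<and>
     (\<forall>M :: 'x set. hilbert_subspace M \<longrightarrow> (\<forall>X \<in> row_ball M. summable (homogeneous_part A M X)))"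

section \<open>The full Fock space and the left creation operators\<close>

text \<open>
  With \<open>e\<^sub>i\<close> the standard basis of the \<open>n\<close>-dimensional space, its \<open>k\<close>-fold tensor power has the
  orthonormal basis of the elementary tensors \<open>e\<^sub>i\<^sub>1 \<otimes> \<dots> \<otimes> e\<^sub>i\<^sub>k\<close>, indexed by words of length \<open>k\<close>, so a
  vector of the full Fock space is a square-summable family of coefficients over all words
  (the empty word belonging to the vacuum vector).  Tensoring with \<open>e\<^sub>i\<close> on the left prepends the
  letter \<open>i\<close> to every word.
\<close>

type_synonym 'n fock = "'n list ell2"

lift_definition creation_map :: "'n \<Rightarrow> 'n fock \<Rightarrow> 'n fock"
  is "\<lambda>i \<phi> w. case w of [] \<Rightarrow> 0 | j # v \<Rightarrow> if j = i then \<phi> v else 0"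
  subgoal premises prems for i \<phi>
  proof -
    have "(\<lambda>w. (cmod (case w of [] \<Rightarrow> 0 | j # v \<Rightarrow> if j = i then \<phi> v else 0))\<^sup>2) summable_on ((#) i ` UNIV)"
      using prems by (subst summable_on_reindex) (auto simp: o_def)
    thus ?thesis
      by (rule summable_on_cong_neutral[THEN iffD1, rotated -1]) (auto split: list.splits)
  qed
  done

lift_definition creation :: "'n \<Rightarrow> ('n fock \<Rightarrow>\<^sub>L 'n fock)" is creation_map
proof (rule bounded_linear_intro[where K = 1])
  fix i :: 'n and x y :: "'n fock" and r :: real
  show "creation_map i (x + y) = creation_map i x + creation_map i y"
    by transfer (auto split: list.splits)
  show "creation_map i (r *\<^sub>R x) = r *\<^sub>R creation_map i x"
    by transfer (auto split: list.splits)
  have "(norm (creation_map i x))\<^sup>2 = (\<Sum>\<^sub>\<infinity>w\<in>(#) i ` UNIV. (cmod (Rep_ell2 (creation_map i x) w))\<^sup>2)"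
    unfolding ell2_norm_sq
    by (rule infsum_cong_neutral) (auto simp: creation_map.rep_eq split: list.splits)
  also have "\<dots> = (norm x)\<^sup>2"
    unfolding ell2_norm_sq by (subst infsum_reindex) (auto simp: o_def creation_map.rep_eq)
  finally show "norm (creation_map i x) \<le> norm x * 1"
    by simp
qed

section \<open>Operator matrices\<close>

text \<open>
  Positivity of an operator matrix on the direct sum of copies of \<open>'h\<close> indexed by the finite set
  \<open>J\<close>, whose vectors are families \<open>v\<close> with inner product \<open>\<Sum>p\<in>J. cinner (v p) (w p)\<close>.
\<close>

definition positive_op_matrix :: "'j set \<Rightarrow> ('j \<Rightarrow> 'j \<Rightarrow> ('h::complex_inner \<Rightarrow>\<^sub>L 'h)) \<Rightarrow> bool" where
  "positive_op_matrix J P \<longleftrightarrow>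
     (\<forall>v :: 'j \<Rightarrow> 'h. (\<Sum>p\<in>J. cinner (v p) (\<Sum>q\<in>J. P p q (v q))) \<in> \<real>\<^sub>\<ge>\<^sub>0)"

text \<open>\<open>None\<close> indexes the first summand, \<open>Some \<alpha>\<close> the summand belonging to the word \<open>\<alpha>\<close>.\<close>

definition block_index :: "nat \<Rightarrow> 'n list option set" where
  "block_index k = insert None (Some ` {\<alpha>. length \<alpha> = k})"

fun coeff_matrix :: "('n list \<Rightarrow> ('h::complex_inner \<Rightarrow>\<^sub>L 'h)) \<Rightarrow> 'n list option \<Rightarrow> 'n list option \<Rightarrow> ('h \<Rightarrow>\<^sub>L 'h)"
where
  "coeff_matrix A None None = 2 *\<^sub>R (id_blinfun - A [])"
| "coeff_matrix A None (Some \<beta>) = adj (A \<beta>)"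
| "coeff_matrix A (Some \<alpha>) None = A \<alpha>"
| "coeff_matrix A (Some \<alpha>) (Some \<beta>) = (if \<alpha> = \<beta> then 2 *\<^sub>R (id_blinfun - A []) else 0)"

end

theory Submission
  imports Defs
begin

text \<open>
  For (i), evaluate \<open>F\<close> at the left creation operators scaled by \<open>r < 1\<close> and truncated at words
  of length \<open>k\<close>. Compressing \<open>Re F \<le> I\<close> to the span of the vacuum and of the words of length
  \<open>k\<close> leaves only \<open>A\<^sub>0\<close> on the diagonal and \<open>r\<^sup>k A\<^sub>\<alpha>\<close> off it; let \<open>r\<close> tend to 1.

  For (ii), put \<open>G = I - A\<^sub>0\<close>, which is positive by (i). The positivity of \<open>P\<^sub>k\<close> survives tensoring
  with identities, and Cauchy--Schwarz for it bounds the form of the homogeneous part of degree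
  \<open>k\<close> by \<open>2 y\<^sub>k \<parallel>G\<^sup>1\<^sup>/\<^sup>2 \<xi>\<parallel> \<parallel>G\<^sup>1\<^sup>/\<^sup>2 \<eta>\<parallel>\<close>, where \<open>y\<^sub>k\<close> is the norm of the column of the
  \<open>Y\<^sub>\<alpha>\<close>. The constant term is bounded by \<open>\<parallel>A\<^sub>0\<^sup>1\<^sup>/\<^sup>2 \<xi>\<parallel> \<parallel>A\<^sub>0\<^sup>1\<^sup>/\<^sup>2 \<eta>\<parallel>\<close>, and since \<open>A\<^sub>0 + G = I\<close>
  and \<open>\<Sum> 2 y\<^sub>k \<le> 1\<close> the total is at most \<open>\<parallel>\<xi>\<parallel> \<parallel>\<eta>\<parallel>\<close>.
\<close>

section \<open>Adjoints\<close>

instance chilbert_space \<subseteq> banach ..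

lemma cinner_eqI:
  assumes "\<And>y. cinner x y = cinner x' y"
  shows "x = (x'::'a::complex_inner)"
proof -
  have "cinner (x - x') (x - x') = 0" using assms by (simp add: cinner_diff_left)
  thus ?thesis by (simp add: cinner_self)
qed

text \<open>Real inner products see only real parts; replacing \<open>y\<close> by
  \<open>\<i> *\<^sub>C y\<close> recovers the imaginary ones. A vector representing a real
  functional thereby represents the complex one.\<close>

lemma cinner_eq_of_inner_eq:
  fixes f g :: "'a::complex_inner \<Rightarrow> 'b::complex_inner"
  assumes "\<And>y. inner u (f y) = inner v (g y)"
    and "\<And>c y. f (c *\<^sub>C y) = c *\<^sub>C f y" "\<And>c y. g (c *\<^sub>C y) = c *\<^sub>C g y"
  shows "cinner u (f y) = cinner v (g y)"
  using assms(1)[of y] assms(1)[of "\<i> *\<^sub>C y"]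
  by (auto intro!: complex_eqI simp: inner_eq_Re_cinner assms(2,3) cinner_scaleC_right)

lemma scaleC_zero_left [simp]: "0 *\<^sub>C x = (0::'a::complex_inner)"
  using scaleR_scaleC[of 0 x] by simp

text \<open>The representing vector minimizes \<open>\<parallel>x\<parallel>\<^sup>2 - 2 f x\<close>.\<close>

lemma Riesz_representation:
  fixes f :: "'a::{real_inner,complete_space} \<Rightarrow> real"
  assumes "bounded_linear f"
  shows "\<exists>x. \<forall>y. f y = inner x y"
proof -
  interpret f: bounded_linear f by (rule assms)
  define J where "J x = (norm x)\<^sup>2 - 2 * f x" for x
  obtain K where K: "\<And>x. norm (f x) \<le> norm x * K" using f.bounded by blast
  \<comment> \<open>Completing the square: \<open>J x\<close> is at least
    \<open>(norm x - K)\<^sup>2 - K\<^sup>2\<close>.\<close>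
  have bd: "- (K\<^sup>2) \<le> J x" for x
  proof -
    have "f x \<le> norm x * K" using K[of x] by simp
    moreover have "0 \<le> (norm x - K)\<^sup>2" by simp
    ultimately show ?thesis unfolding J_def by (simp add: power2_diff)
  qed
  have bb: "bdd_below (range J)" using bd by (intro bdd_belowI2[of _ "- (K\<^sup>2)"]) auto
  define d where "d = Inf (range J)"
  have dJ: "d \<le> J x" for x unfolding d_def by (rule cINF_lower[OF bb]) simp
  have "\<exists>x. J x < d + 1 / real (Suc n)" for n
    using cInf_lessD[of "range J" "d + 1 / real (Suc n)"] by (auto simp: d_def)
  then obtain X where X: "\<And>n. J (X n) < d + 1 / real (Suc n)" by metis
  \<comment> \<open>Parallelogram law around the midpoint \<open>m\<close>: since \<open>J m\<close>
    is at least \<open>d\<close>, near-minimizers are close to each other, so a minimizing sequence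
    is Cauchy.\<close>
  have par: "(norm (x - y))\<^sup>2 \<le> 2 * (J x - d) + 2 * (J y - d)" for x y
  proof -
    define m where "m = (1/2) *\<^sub>R (x + y)"
    have "(norm (x - y))\<^sup>2 = 2 * J x + 2 * J y - 4 * J m"
      by (simp only: m_def J_def power2_norm_eq_inner f.scaleR f.add inner_simps inner_commute[of y x])
        (simp add: field_simps)
    thus ?thesis using dJ[of m] by (simp add: right_diff_distrib)
  qed
  have "Cauchy X"
  proof (rule CauchyI')
    fix e :: real assume e: "0 < e"
    then obtain M where M: "1 / real (Suc M) < e\<^sup>2 / 4"
      using nat_approx_posE[of "e\<^sup>2 / 4"] by (auto simp: zero_less_power)
    have "dist (X m) (X n) < e" if "M \<le> m" "m < n" for m n
    proof -
      have "1 / real (Suc m) \<le> 1 / real (Suc M)" "1 / real (Suc n) \<le> 1 / real (Suc M)"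
        using that by (simp_all add: frac_le)
      moreover have "N < e\<^sup>2" if "a \<le> c" "b \<le> c" "N \<le> 2 * (p - d) + 2 * (q - d)" "p < d + a" "q < d + b"
          "c < e\<^sup>2 / 4" for a b c N p q :: real
        using that by argo
      ultimately have "(norm (X m - X n))\<^sup>2 < e\<^sup>2" using par[of "X m" "X n"] X[of m] X[of n] M by blast
      thus ?thesis using e by (simp add: power2_less_imp_less dist_norm)
    qed
    thus "\<exists>M. \<forall>m\<ge>M. \<forall>n>m. dist (X m) (X n) < e" by blast
  qed
  then obtain x where x: "X \<longlonglongrightarrow> x" using Cauchy_convergent convergent_def by blast
  have "(\<lambda>n. J (X n)) \<longlonglongrightarrow> J x" unfolding J_def by (intro tendsto_intros x f.tendsto)
  moreover have "(\<lambda>n. d + 1 / real (Suc n)) \<longlonglongrightarrow> d + 0"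
    by (intro tendsto_intros LIMSEQ_Suc[OF lim_1_over_n])
  ultimately have Jx: "J x \<le> d" using X by (intro LIMSEQ_le[of _ "J x" _ d]) (auto intro: less_imp_le)
  have "f y = inner x y" for y
  proof (rule ccontr)
    assume ne: "f y \<noteq> inner x y"
    define b where "b = inner x y - f y"
    define a where "a = (norm y)\<^sup>2"
    have ab: "0 \<le> t\<^sup>2 * a + 2 * t * b" for t
    proof -
      have "J (x + t *\<^sub>R y) = J x + (t\<^sup>2 * a + 2 * t * b)"
        by (simp only: J_def a_def b_def power2_norm_eq_inner f.scaleR f.add inner_simps inner_commute[of y x])
          (simp add: algebra_simps power2_eq_square)
      thus ?thesis using dJ[of "x + t *\<^sub>R y"] Jx by linarith
    qed
    have b0: "b \<noteq> 0" using ne by (simp add: b_def)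
    have a0: "0 \<le> a" by (simp add: a_def)
    \<comment> \<open>Moving by \<open>- c\<close> along \<open>y\<close> is short enough for the
      linear term of the quadratic in \<open>ab\<close> to dominate, so a nonzero slope
      \<open>b\<close> would push \<open>J\<close> below its minimum.\<close>
    define c where "c = b / (a + 1)"
    have b: "b = c * (a + 1)" using a0 by (simp add: c_def)
    have "(- c)\<^sup>2 * a + 2 * (- c) * b = - (c\<^sup>2 * (a + 2))"
      by (simp add: b algebra_simps power2_eq_square)
    moreover have "0 < c\<^sup>2 * (a + 2)" using a0 b0 b by auto
    ultimately show False using ab[of "- c"] by simp
  qed
  thus ?thesis by blast
qed

section \<open>Bounded complex-linear operators and their adjoints\<close>

lemma bounded_opsD: "T \<in> \<B> \<Longrightarrow> blinfun_apply T (c *\<^sub>C x) = c *\<^sub>C T x"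
  by (simp add: bounded_ops_def)

lemma bounded_opsI: "(\<And>c x. blinfun_apply T (c *\<^sub>C x) = c *\<^sub>C T x) \<Longrightarrow> T \<in> \<B>"
  by (simp add: bounded_ops_def)

lemma bounded_ops_closure [simp, intro]:
  "id_blinfun \<in> \<B>" "0 \<in> \<B>"
  "S \<in> \<B> \<Longrightarrow> T \<in> \<B> \<Longrightarrow> S + T \<in> \<B>"
  "S \<in> \<B> \<Longrightarrow> T \<in> \<B> \<Longrightarrow> S - T \<in> \<B>"
  "S \<in> \<B> \<Longrightarrow> T \<in> \<B> \<Longrightarrow> S o\<^sub>L T \<in> \<B>"
  "S \<in> \<B> \<Longrightarrow> r *\<^sub>R S \<in> \<B>"
  by (auto intro!: bounded_opsI simp: blinfun.add_left blinfun.diff_left blinfun.scaleR_left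
      scaleC_add_right scaleC_diff_right bounded_opsD scaleR_scaleC scaleC_scaleC mult.commute)

lemma bounded_ops_sum [intro]: "(\<And>i. i \<in> I \<Longrightarrow> T i \<in> \<B>) \<Longrightarrow> (\<Sum>i\<in>I. T i) \<in> \<B>"
  by (induction I rule: infinite_finite_induct) auto

text \<open>Complex-linearity is an intersection of closed conditions. This keeps norm limits in
  \<open>\<B>\<close>, both for the square root iteration and for the sum of the series of
  \<open>F\<close>.\<close>

lemma closed_bounded_ops: "closed (\<B> :: ('a::complex_inner \<Rightarrow>\<^sub>L 'a) set)"
proof -
  have eq: "\<B> = (\<Inter>c. \<Inter>x. {T :: 'a \<Rightarrow>\<^sub>L 'a. T (c *\<^sub>C x) = c *\<^sub>C T x})"
    by (auto simp: bounded_ops_def)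
  have cl: "closed {T :: 'a \<Rightarrow>\<^sub>L 'a. T (c *\<^sub>C x) = c *\<^sub>C T x}" for c x
    by (intro closed_Collect_eq continuous_intros
        bounded_linear.continuous_on[OF bounded_linear_scaleC])
  show ?thesis unfolding eq by (intro closed_INT ballI cl)
qed

text \<open>Riesz is applied to the real functional \<open>inner x (T y)\<close> for each
  \<open>x\<close>; complex-linearity of \<open>T\<close> upgrades this to \<open>cinner\<close>,
  which determines the representing vector and so makes it linear in \<open>x\<close>.\<close>

lemma adj_exists:
  fixes T :: "'a::chilbert_space \<Rightarrow>\<^sub>L 'a"
  assumes T: "T \<in> \<B>"
  shows "\<exists>T'. \<forall>x y. cinner (blinfun_apply T' x) y = cinner x (T y)"
proof -
  have "\<exists>z. \<forall>y. inner x (T y) = inner z y" for x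
    by (rule Riesz_representation)
      (intro bounded_linear_compose[OF bounded_linear_inner_right] blinfun.bounded_linear_right)
  then obtain f where f: "\<And>x y. inner x (T y) = inner (f x) y" by metis
  have fc: "cinner (f x) y = cinner x (T y)" for x y
    by (rule cinner_eq_of_inner_eq[of _ "\<lambda>y. y"]) (simp_all add: f bounded_opsD[OF T])
  have "bounded_linear f"
  proof (rule bounded_linear_intro[where K = "norm T"])
    show "f (x + y) = f x + f y" for x y
      by (rule cinner_eqI) (simp add: fc cinner_add_left)
    show "f (r *\<^sub>R x) = r *\<^sub>R f x" for r x
      by (rule cinner_eqI) (simp add: fc scaleR_scaleC cinner_scaleC_left)
    show "norm (f x) \<le> norm x * norm T" for x
    proof -
      have "norm (f x) * norm (f x) = inner x (T (f x))" by (simp add: f flip: power2_norm_eq_inner power2_eq_square)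
      also have "\<dots> \<le> norm x * norm (T (f x))" by (rule norm_cauchy_schwarz)
      also have "\<dots> \<le> norm x * (norm T * norm (f x))" by (intro mult_left_mono norm_blinfun) simp
      finally have "norm (f x) * norm (f x) \<le> (norm x * norm T) * norm (f x)" by (simp add: mult.assoc)
      thus ?thesis by (cases "norm (f x) = 0") simp_all
    qed
  qed
  thus ?thesis using fc by (intro exI[of _ "Blinfun f"]) (simp add: bounded_linear_Blinfun_apply)
qed

lemma adj_eqI:
  fixes T :: "'a::complex_inner \<Rightarrow>\<^sub>L 'a"
  assumes "\<And>x y. cinner (blinfun_apply T' x) y = cinner x (T y)"
  shows "adj T = T'"
  unfolding adj_def using assms by (intro the_equality blinfun_eqI cinner_eqI) auto

lemma cinner_adj_left:
  fixes T :: "'a::chilbert_space \<Rightarrow>\<^sub>L 'a"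
  assumes "T \<in> \<B>"
  shows "cinner (adj T x) y = cinner x (T y)"
  using adj_exists[OF assms] adj_eqI by metis

lemma cinner_adj_right:
  fixes T :: "'a::chilbert_space \<Rightarrow>\<^sub>L 'a"
  assumes "T \<in> \<B>"
  shows "cinner x (adj T y) = cinner (T x) y"
  using cinner_adj_left[OF assms] cinner_commute by metis

lemma adj_bounded_ops [simp, intro]:
  fixes T :: "'a::chilbert_space \<Rightarrow>\<^sub>L 'a"
  assumes "T \<in> \<B>"
  shows "adj T \<in> \<B>"
  by (intro bounded_opsI cinner_eqI) (simp add: cinner_adj_left[OF assms] cinner_scaleC_left)

lemma norm_adj_le:
  fixes T :: "'a::chilbert_space \<Rightarrow>\<^sub>L 'a"
  assumes "T \<in> \<B>"
  shows "norm (adj T) \<le> norm T"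
proof (rule norm_blinfun_bound)
  fix x
  have "norm (adj T x) * norm (adj T x) = cmod (cinner x (T (adj T x)))"
    by (simp add: cinner_adj_left[OF assms, symmetric] cinner_self norm_mult power2_eq_square)
  also have "\<dots> \<le> norm x * norm (T (adj T x))" by (rule cinner_Cauchy_Schwarz)
  also have "\<dots> \<le> norm x * (norm T * norm (adj T x))" by (intro mult_left_mono norm_blinfun) simp
  finally have "norm (adj T x) * norm (adj T x) \<le> (norm T * norm x) * norm (adj T x)"
    by (simp add: mult_ac)
  thus "norm (adj T x) \<le> norm T * norm x" by (cases "norm (adj T x) = 0") simp_all
qed simp

lemma adj_compose:
  fixes S T :: "'a::chilbert_space \<Rightarrow>\<^sub>L 'a"
  assumes "S \<in> \<B>" "T \<in> \<B>"
  shows "adj (S o\<^sub>L T) = adj T o\<^sub>L adj S"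
  by (rule adj_eqI) (simp add: cinner_adj_left assms)

lemma cinner_Re_op:
  fixes T :: "'a::chilbert_space \<Rightarrow>\<^sub>L 'a"
  assumes "T \<in> \<B>"
  shows "cinner x (Re_op T x) = complex_of_real (Re (cinner x (T x)))"
proof -
  have "cinner x (Re_op T x) = (1/2) * (cinner x (T x) + cinner (T x) x)"
    by (simp add: Re_op_def blinfun.add_left blinfun.scaleR_left scaleR_scaleC cinner_scaleC_right
        cinner_add_right cinner_adj_right[OF assms])
  also have "cinner (T x) x = cnj (cinner x (T x))" by (rule cinner_commute)
  finally show ?thesis by (simp add: complex_add_cnj)
qed

section \<open>Square roots\<close>

text \<open>The scalar majorant of the operator iteration below. It stays in [0,1] because (c + 1)/2
  is at most 1, and it increases because squaring is monotone there.\<close>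

lemma sqrt_iteration_scalar:
  fixes s :: "nat \<Rightarrow> real"
  assumes c: "0 \<le> c" "c \<le> 1" and s: "s 0 = 0" "\<And>n. s (Suc n) = (c + (s n)\<^sup>2) / 2"
  shows "0 \<le> s n" "s n \<le> 1" "s n \<le> s (Suc n)" "convergent s"
proof -
  have b: "0 \<le> s n \<and> s n \<le> 1" for n
  proof (induction n)
    case (Suc n)
    hence "(s n)\<^sup>2 \<le> 1" by (simp add: power_le_one)
    thus ?case using c by (simp add: s(2))
  qed (simp add: s)
  show "0 \<le> s n" "s n \<le> 1" using b by auto
  have m: "s n \<le> s (Suc n)" for n
  proof (induction n)
    case (Suc n)
    hence "(s n)\<^sup>2 \<le> (s (Suc n))\<^sup>2" using b by (intro power_mono) auto
    thus ?case by (simp add: s(2)[of "Suc n"] s(2)[of n])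
  qed (use c in \<open>simp add: s\<close>)
  show "s n \<le> s (Suc n)" by (rule m)
  have "incseq s" by (intro incseq_SucI m)
  then obtain L where "s \<longlonglongrightarrow> L" using b incseq_convergent[of s 1] by metis
  thus "convergent s" by (rule convergentI)
qed

text \<open>
  With \<open>C = I - G\<close>, the iteration \<open>U \<mapsto> (C + U\<^sup>2) / 2\<close> converges to some \<open>U\<close> with
  \<open>(I - U)\<^sup>2 = G\<close>; it is dominated by the corresponding scalar iteration.
\<close>

lemma sqrt_exists:
  fixes G :: "'a::chilbert_space \<Rightarrow>\<^sub>L 'a"
  assumes G: "G \<in> \<B>" and sa: "\<And>x y. cinner (G x) y = cinner x (G y)"
    and nm: "norm (id_blinfun - G) \<le> 1"
  shows "\<exists>R\<in>\<B>. R o\<^sub>L R = G \<and> (\<forall>x y. cinner (R x) y = cinner x (R y))"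
proof -
  define C where "C = id_blinfun - G"
  define U where "U = rec_nat 0 (\<lambda>_ u. (1/2) *\<^sub>R (C + (u o\<^sub>L u)))"
  define s where "s = rec_nat (0::real) (\<lambda>_ u. (norm C + u\<^sup>2) / 2)"
  have U: "U 0 = 0" "\<And>n. U (Suc n) = (1/2) *\<^sub>R (C + (U n o\<^sub>L U n))" by (simp_all add: U_def)
  have s: "s 0 = 0" "\<And>n. s (Suc n) = (norm C + (s n)\<^sup>2) / 2" by (simp_all add: s_def)
  have C1: "norm C \<le> 1" using nm by (simp add: C_def)
  note s_facts = sqrt_iteration_scalar[OF norm_ge_zero C1 s]
  have nU: "norm (U n) \<le> s n" for n
  proof (induction n)
    case (Suc n)
    have "norm (U n o\<^sub>L U n) \<le> (s n)\<^sup>2"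
      using norm_blinfun_compose[of "U n" "U n"] mult_mono[OF Suc Suc] s_facts(1)
      by (simp add: power2_eq_square)
    thus ?case using norm_triangle_ineq[of C "U n o\<^sub>L U n"] by (simp add: U s)
  qed (simp add: U s)
  have dU: "norm (U (Suc n) - U n) \<le> s (Suc n) - s n" for n
  proof (induction n)
    case 0 thus ?case by (simp add: U s)
  next
    case (Suc n)
    define D where "D = U (Suc n) - U n"
    define e where "e = s (Suc n) - s n"
    have D: "norm D \<le> e" using Suc by (simp add: D_def e_def)
    have e0: "0 \<le> e" using s_facts(3) by (simp add: e_def)
    \<comment> \<open>The splitting U'U' - UU = U'(U' - U) + (U' - U)U holds without knowing that
      the iterates commute; the scalar increments satisfy the same recursion.\<close>
    have "U (Suc (Suc n)) - U (Suc n) = (1/2) *\<^sub>R ((U (Suc n) o\<^sub>L D) + (D o\<^sub>L U n))"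
      by (rule blinfun_eqI)
        (simp add: U(2)[of "Suc n"] U(2)[of n] D_def blinfun.bilinear_simps algebra_simps)
    hence "norm (U (Suc (Suc n)) - U (Suc n)) \<le> (1/2) * (norm (U (Suc n) o\<^sub>L D) + norm (D o\<^sub>L U n))"
      by (simp add: norm_triangle_ineq)
    also have "\<dots> \<le> (1/2) * (s (Suc n) * e + e * s n)"
    proof (intro mult_left_mono add_mono)
      show "norm (U (Suc n) o\<^sub>L D) \<le> s (Suc n) * e"
        using norm_blinfun_compose[of "U (Suc n)" D] mult_mono[OF nU[of "Suc n"] D] s_facts(1) by simp
      show "norm (D o\<^sub>L U n) \<le> e * s n"
        using norm_blinfun_compose[of D "U n"] mult_mono[OF D nU[of n]] e0 by simp
    qed simp
    also have "\<dots> = s (Suc (Suc n)) - s (Suc n)"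
      by (simp add: s(2)[of "Suc n"] s(2)[of n] e_def power2_eq_square field_simps)
    finally show ?case .
  qed
  \<comment> \<open>Summing the increments: the distances of the \<open>U n\<close> are dominated by
    those of the convergent scalar sequence.\<close>
  have tel: "norm (U m - U n) \<le> s m - s n" if "n \<le> m" for m n
    using that
  proof (induction m rule: dec_induct)
    case (step m)
    thus ?case using dU[of m] norm_triangle_ineq[of "U (Suc m) - U m" "U m - U n"] by simp
  qed simp
  have "Cauchy s" using s_facts(4) by (simp add: Cauchy_convergent_iff)
  have "Cauchy U"
  proof (rule CauchyI')
    fix e :: real assume "0 < e"
    then obtain M where M: "\<And>m n. M \<le> m \<Longrightarrow> M \<le> n \<Longrightarrow> norm (s m - s n) < e"
      using CauchyD[OF \<open>Cauchy s\<close>] by blast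
    have "dist (U m) (U n) < e" if "M \<le> m" "m < n" for m n
      using tel[of m n] M[of n m] that by (simp add: dist_norm norm_minus_commute)
    thus "\<exists>M. \<forall>m\<ge>M. \<forall>n>m. dist (U m) (U n) < e" by blast
  qed
  then obtain V where V: "U \<longlonglongrightarrow> V" using Cauchy_convergent convergent_def by blast
  have "(\<lambda>n. U (Suc n)) \<longlonglongrightarrow> (1/2) *\<^sub>R (C + (V o\<^sub>L V))"
    unfolding U(2)
    by (intro tendsto_intros V bounded_bilinear.tendsto[OF bounded_bilinear_blinfun_compose])
  hence "V = (1/2) *\<^sub>R (C + (V o\<^sub>L V))" using LIMSEQ_Suc[OF V] LIMSEQ_unique by blast
  hence VV: "2 *\<^sub>R V = C + (V o\<^sub>L V)" by (metis scaleR_half_double scaleR_2 scaleR_add_right)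
  have CB: "C \<in> \<B>" using G by (simp add: C_def)
  have "U n \<in> \<B>" for n by (induction n) (auto simp: U CB)
  hence VB: "V \<in> \<B>" using closed_sequentially[OF closed_bounded_ops _ V] by blast
  have Csa: "cinner (C x) y = cinner x (C y)" for x y
    by (simp add: C_def blinfun.diff_left cinner_diff_left cinner_diff_right sa)
  have Usa: "cinner (U n x) y = cinner x (U n y)" for n x y
    by (induction n arbitrary: x y)
      (simp_all add: U blinfun.bilinear_simps scaleR_scaleC cinner_scaleC_left cinner_scaleC_right
        cinner_add_left cinner_add_right Csa)
  have Vx: "(\<lambda>n. U n x) \<longlonglongrightarrow> V x" for x by (intro tendsto_intros V)
  have Vsa: "cinner (V x) y = cinner x (V y)" for x y
  proof (rule LIMSEQ_unique)
    show "(\<lambda>n. cinner x (U n y)) \<longlonglongrightarrow> cinner x (V y)"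
      by (rule bounded_linear.tendsto[OF bounded_linear_cinner_right Vx])
    \<comment> \<open>The limit in the first argument is reduced by conjugation to one in the
      second.\<close>
    have "(\<lambda>n. cnj (cinner y (U n x))) \<longlonglongrightarrow> cnj (cinner y (V x))"
      by (intro tendsto_intros bounded_linear.tendsto[OF bounded_linear_cinner_right Vx])
    thus "(\<lambda>n. cinner x (U n y)) \<longlonglongrightarrow> cinner (V x) y"
      by (simp add: cinner_commute[symmetric] Usa[symmetric])
  qed
  \<comment> \<open>By \<open>VV\<close>, (I - V)^2 = I - 2V + V^2 = I - C = G.\<close>
  define R where "R = id_blinfun - V"
  have "R o\<^sub>L R = G"
  proof (rule blinfun_eqI)
    fix x
    have "V (V x) = 2 *\<^sub>R V x - C x"
      using arg_cong[OF VV, of "\<lambda>T. blinfun_apply T x"] by (simp add: blinfun.bilinear_simps)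
    thus "(R o\<^sub>L R) x = G x"
      by (simp add: R_def C_def blinfun.bilinear_simps scaleR_2)
  qed
  moreover have "R \<in> \<B>" using VB by (simp add: R_def)
  moreover have "cinner (R x) y = cinner x (R y)" for x y
    by (simp add: R_def blinfun.diff_left cinner_diff_left cinner_diff_right Vsa)
  ultimately show ?thesis by blast
qed

section \<open>Tensor products of operators\<close>

text \<open>Gram-Schmidt. A new vector either lies in the span already reached
  (\<open>u = 0\<close>) or contributes its normalized residual, to which all earlier vectors are
  orthogonal, so their expansions persist.\<close>

lemma exists_orthonormal_span:
  assumes "finite (Y :: 'a::complex_inner set)"
  shows "\<exists>F. finite F \<and> orthonormal F \<and> (\<forall>y\<in>Y. y = (\<Sum>f\<in>F. cinner f y *\<^sub>C f))"
  using assms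
proof (induction Y rule: finite_induct)
  case empty
  show ?case by (rule exI[of _ "{}"]) (simp add: orthonormal_def)
next
  case (insert y Y)
  then obtain F where F: "finite F" "orthonormal F"
    and Y: "\<And>z. z \<in> Y \<Longrightarrow> z = (\<Sum>f\<in>F. cinner f z *\<^sub>C f)" by blast
  define p where "p = (\<Sum>f\<in>F. cinner f y *\<^sub>C f)"
  define u where "u = y - p"
  have fu: "cinner f u = 0" if "f \<in> F" for f
    using cinner_orthonormal_sum[OF F(2,1) order_refl that, of "\<lambda>f. cinner f y"] that
    by (simp add: u_def p_def cinner_diff_right)
  show ?case
  proof (cases "u = 0")
    case True
    thus ?thesis using F Y by (intro exI[of _ F]) (auto simp: u_def p_def)
  next
    case False
    define g where "g = complex_of_real (1 / norm u) *\<^sub>C u"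
    have "norm g = 1" using False by (simp add: g_def norm_scaleC norm_divide)
    hence gg: "cinner g g = 1" by (simp add: cinner_self)
    have fg: "cinner f g = 0" if "f \<in> F" for f
      using fu[OF that] by (simp add: g_def cinner_scaleC_right)
    have gf: "cinner g f = 0" if "f \<in> F" for f
      using fg[OF that] cinner_commute[of g f] by simp
    have gF: "g \<notin> F" using fg gg by fastforce
    have on: "orthonormal (insert g F)"
      using F(2) gg fg gf gF unfolding orthonormal_def by auto
    have gsum: "cinner g (\<Sum>f\<in>F. c f *\<^sub>C f) = 0" for c
      by (simp add: cinner_sum_right cinner_scaleC_right gf)
    have "z = (\<Sum>f\<in>insert g F. cinner f z *\<^sub>C f)" if "z \<in> Y" for z
    proof -
      have "cinner g z = 0" using gsum Y[OF that] by metis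
      thus ?thesis using Y[OF that] F(1) gF by simp
    qed
    moreover have "y = (\<Sum>f\<in>insert g F. cinner f y *\<^sub>C f)"
    proof -
      have "cinner g y = cinner g u"
        using gsum[of "\<lambda>f. cinner f y"] by (simp add: u_def p_def cinner_diff_right)
      also have "\<dots> = norm u"
        using False by (simp add: g_def cinner_scaleC_left cinner_self power2_eq_square)
      finally have "cinner g y *\<^sub>C g = u" using False by (simp add: g_def scaleC_scaleC scaleC_one)
      thus ?thesis using F(1) gF by (simp add: u_def p_def)
    qed
    ultimately show ?thesis using F(1) on by (intro exI[of _ "insert g F"]) auto
  qed
qed

text \<open>Abstracts the tensor product so that every one-sided fact is proved once and then read
  for either factor: the map with its arguments exchanged satisfies the same axioms.\<close>

locale tensor_map =
  fixes t :: "'a::chilbert_space \<Rightarrow> 'b::chilbert_space \<Rightarrow> 'c::chilbert_space"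
  assumes add_left: "t (x + x') y = t x y + t x' y"
    and add_right: "t x (y + y') = t x y + t x y'"
    and scaleC_left: "t (c *\<^sub>C x) y = c *\<^sub>C t x y"
    and scaleC_right: "t x (c *\<^sub>C y) = c *\<^sub>C t x y"
    and cinner_t: "cinner (t x y) (t x' y') = cinner x x' * cinner y y'"
    and dense: "closure (span {t x y |x y. True}) = UNIV"
begin

lemma zero_left: "t 0 y = 0" using add_left[of 0 0 y] by simp
lemma zero_right: "t x 0 = 0" using add_right[of x 0 0] by simp

lemma scaleR_left: "t (r *\<^sub>R x) y = r *\<^sub>R t x y"
  by (simp add: scaleR_scaleC scaleC_left)

lemma sum_left: "t (\<Sum>i\<in>I. x i) y = (\<Sum>i\<in>I. t (x i) y)"
  by (induction I rule: infinite_finite_induct) (auto simp: zero_left add_left)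

lemma sum_right: "t x (\<Sum>i\<in>I. y i) = (\<Sum>i\<in>I. t x (y i))"
  by (induction I rule: infinite_finite_induct) (auto simp: zero_right add_right)

text \<open>Real scalars in a linear combination are absorbed into the left factor, so additivity
  carries the property to the span, and closedness to the whole space.\<close>

lemma induct_closed:
  assumes "\<And>x y. P (t x y)" "\<And>u v. P u \<Longrightarrow> P v \<Longrightarrow> P (u + v)" "closed {z. P z}"
  shows "P z"
proof -
  have "P v" if "v \<in> span {t x y |x y. True}" for v
    using that
  proof (induction rule: span_induct_alt)
    case base
    show ?case using assms(1)[of 0 0] by (simp add: zero_left)
  next
    case (step c x y)
    thus ?case using assms(1,2) by (auto simp flip: scaleR_left)
  qed
  hence "closure (span {t x y |x y. True}) \<subseteq> {z. P z}"
    by (intro closure_minimal assms(3)) auto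
  thus ?thesis using dense by auto
qed

lemma blinfun_eqI:
  fixes S T :: "'c \<Rightarrow>\<^sub>L 'd::real_normed_vector"
  assumes "\<And>x y. S (t x y) = T (t x y)"
  shows "S = T"
proof (rule Bounded_Linear_Function.blinfun_eqI)
  show "S z = T z" for z
    by (induction z rule: induct_closed)
      (auto simp: assms blinfun.add_right intro!: closed_Collect_eq continuous_intros)
qed

text \<open>Expanding the left factors in \<open>F\<close> and exchanging the sums leaves
  orthonormal left factors. On such vectors the tensor product looks like a finite direct sum of
  copies of the right factor.\<close>

lemma sum_orthonormal_left:
  assumes "\<And>i. i \<in> I \<Longrightarrow> x i = (\<Sum>f\<in>F. cinner f (x i) *\<^sub>C f)"
  shows "(\<Sum>i\<in>I. t (x i) (y i)) = (\<Sum>f\<in>F. t f (\<Sum>i\<in>I. cinner f (x i) *\<^sub>C y i))"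
proof -
  have "(\<Sum>i\<in>I. t (x i) (y i)) = (\<Sum>i\<in>I. t (\<Sum>f\<in>F. cinner f (x i) *\<^sub>C f) (y i))"
    using assms by simp
  also have "\<dots> = (\<Sum>i\<in>I. \<Sum>f\<in>F. cinner f (x i) *\<^sub>C t f (y i))"
    by (simp add: sum_left scaleC_left)
  also have "\<dots> = (\<Sum>f\<in>F. \<Sum>i\<in>I. cinner f (x i) *\<^sub>C t f (y i))" by (rule sum.swap)
  finally show ?thesis by (simp add: sum_right scaleC_right)
qed

lemma cinner_orthonormal_left:
  assumes F: "orthonormal F" "finite F"
  shows "cinner (\<Sum>f\<in>F. t f (a f)) (\<Sum>f\<in>F. t f (b f)) = (\<Sum>f\<in>F. cinner (a f) (b f))"
proof -
  have "cinner (\<Sum>f\<in>F. t f (a f)) (\<Sum>f\<in>F. t f (b f))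
      = (\<Sum>f\<in>F. \<Sum>g\<in>F. cinner f g * cinner (a f) (b g))"
    by (subst cinner_sum_left, simp only: cinner_sum_right cinner_t)
  also have "\<dots> = (\<Sum>f\<in>F. \<Sum>g\<in>F. if f = g then cinner (a f) (b g) else 0)"
    using F(1) by (intro sum.cong refl) (simp add: orthonormal_def)
  finally show ?thesis using F(2) by simp
qed

text \<open>This is the norm bound for I tensor T, stated before that operator exists. With
  orthonormal left factors, the squared norm is a sum over components and \<open>T\<close> acts on
  each separately.\<close>

lemma norm_sum_right_le:
  fixes T :: "'b \<Rightarrow>\<^sub>L 'b"
  assumes "finite I" "T \<in> \<B>"
  shows "norm (\<Sum>i\<in>I. t (x i) (T (y i))) \<le> norm T * norm (\<Sum>i\<in>I. t (x i) (y i))"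
proof -
  obtain F where F: "finite F" "orthonormal F" and "\<And>z. z \<in> x ` I \<Longrightarrow> z = (\<Sum>f\<in>F. cinner f z *\<^sub>C f)"
    using exists_orthonormal_span[of "x ` I"] assms(1) by blast
  hence x: "\<And>i. i \<in> I \<Longrightarrow> x i = (\<Sum>f\<in>F. cinner f (x i) *\<^sub>C f)" by blast
  define a where "a f = (\<Sum>i\<in>I. cinner f (x i) *\<^sub>C y i)" for f
  have nsq: "(norm (\<Sum>f\<in>F. t f (b f)))\<^sup>2 = (\<Sum>f\<in>F. (norm (b f))\<^sup>2)" for b
  proof -
    have "complex_of_real ((norm (\<Sum>f\<in>F. t f (b f)))\<^sup>2) = complex_of_real (\<Sum>f\<in>F. (norm (b f))\<^sup>2)"
      using cinner_orthonormal_left[OF F(2,1), of b b] by (simp add: cinner_self)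
    thus ?thesis by (simp only: of_real_eq_iff)
  qed
  have eq: "(\<Sum>i\<in>I. t (x i) (T (y i))) = (\<Sum>f\<in>F. t f (T (a f)))"
    by (simp add: sum_orthonormal_left[OF x] a_def blinfun.sum_right bounded_opsD[OF assms(2)])
  have "(norm (\<Sum>i\<in>I. t (x i) (T (y i))))\<^sup>2 = (\<Sum>f\<in>F. (norm (T (a f)))\<^sup>2)"
    by (simp add: eq nsq)
  also have "\<dots> \<le> (\<Sum>f\<in>F. (norm T * norm (a f))\<^sup>2)"
    by (intro sum_mono power_mono norm_blinfun) simp
  also have "\<dots> = (norm T)\<^sup>2 * (\<Sum>f\<in>F. (norm (a f))\<^sup>2)"
    by (simp add: power_mult_distrib sum_distrib_left)
  also have "(\<Sum>f\<in>F. (norm (a f))\<^sup>2) = (norm (\<Sum>i\<in>I. t (x i) (y i)))\<^sup>2"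
    by (simp add: sum_orthonormal_left[OF x] nsq a_def)
  finally have "(norm (\<Sum>i\<in>I. t (x i) (T (y i))))\<^sup>2 \<le> (norm T * norm (\<Sum>i\<in>I. t (x i) (y i)))\<^sup>2"
    by (simp add: power_mult_distrib)
  thus ?thesis by (rule power2_le_imp_le) simp
qed

lemma span_finite_sum:
  assumes "z \<in> span {t x y |x y. True}"
  shows "\<exists>m x y. z = (\<Sum>i<(m::nat). t (x i) (y i))"
  using assms
proof (induction rule: span_induct_alt)
  case base
  show ?case by (rule exI[of _ 0]) simp
next
  case (step c u v)
  obtain m x y where "v = (\<Sum>i<(m::nat). t (x i) (y i))" using step(2) by blast
  moreover obtain x' y' where "u = t x' y'" using step(1) by blast
  ultimately have "c *\<^sub>R u + v = (\<Sum>i<Suc m. t ((x(m := c *\<^sub>R x')) i) ((y(m := y')) i))"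
    by (simp add: scaleR_left)
  thus ?case by blast
qed

text \<open>One orthonormal family serves all vectors of \<open>V\<close> at once: the left factors
  from all their representations are collected before orthonormalizing.\<close>

lemma span_orthonormal_left:
  assumes "finite V" "V \<subseteq> span {t x y |x y. True}"
  shows "\<exists>F. finite F \<and> orthonormal F \<and> (\<forall>v\<in>V. \<exists>a. v = (\<Sum>f\<in>F. t f (a f)))"
proof -
  have "\<forall>v\<in>V. \<exists>m x y. v = (\<Sum>i<(m::nat). t (x i) (y i))"
    using assms(2) span_finite_sum by blast
  from bchoice[OF this] obtain m where "\<forall>v\<in>V. \<exists>x y. v = (\<Sum>i<(m v::nat). t (x i) (y i))" ..
  from bchoice[OF this] obtain x where "\<forall>v\<in>V. \<exists>y. v = (\<Sum>i<m v. t (x v i) (y i))" ..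
  from bchoice[OF this] obtain y where v: "\<forall>v\<in>V. v = (\<Sum>i<m v. t (x v i) (y v i))" ..
  define Y where "Y = (\<Union>v\<in>V. x v ` {..<m v})"
  have "finite Y" using assms(1) by (auto simp: Y_def)
  then obtain F where F: "finite F" "orthonormal F" "\<And>z. z \<in> Y \<Longrightarrow> z = (\<Sum>f\<in>F. cinner f z *\<^sub>C f)"
    using exists_orthonormal_span[of Y] by blast
  have "v = (\<Sum>f\<in>F. t f (\<Sum>i<m v. cinner f (x v i) *\<^sub>C y v i))" if "v \<in> V" for v
  proof -
    have "(\<Sum>i<m v. t (x v i) (y v i)) = (\<Sum>f\<in>F. t f (\<Sum>i<m v. cinner f (x v i) *\<^sub>C y v i))"
      by (rule sum_orthonormal_left) (use that F(3) in \<open>auto simp: Y_def\<close>)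
    thus ?thesis using bspec[OF v that] by simp
  qed
  hence "\<forall>v\<in>V. \<exists>a. v = (\<Sum>f\<in>F. t f (a f))" by (intro ballI exI)
  with F(1,2) show ?thesis by (intro exI[of _ F] conjI)
qed

text \<open>Positivity survives tensoring with an identity. Over a common orthonormal family of left
  factors, the amplified form is a sum of copies of the original one; density and continuity do the
  rest.\<close>

lemma amplify_nonneg:
  fixes G :: "'b \<Rightarrow>\<^sub>L 'b" and G' :: "'c \<Rightarrow>\<^sub>L 'c"
    and A :: "'j \<Rightarrow> 'b \<Rightarrow>\<^sub>L 'b" and A' :: "'j \<Rightarrow> 'c \<Rightarrow>\<^sub>L 'c"
  assumes J: "finite J"
    and G': "\<And>x y. G' (t x y) = t x (G y)" and A': "\<And>j x y. A' j (t x y) = t x (A j y)"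
    and nonneg: "\<And>h0 h. 0 \<le> Re (cinner h0 (G h0))
      + (\<Sum>j\<in>J. Re (cinner (h j) (G (h j))) + Re (cinner (h j) (A j h0)))"
  shows "0 \<le> Re (cinner u0 (G' u0))
      + (\<Sum>j\<in>J. Re (cinner (u j) (G' (u j))) + Re (cinner (u j) (A' j u0)))"
proof -
  let ?D = "span {t x y |x y. True}"
  define q where "q v0 v = Re (cinner v0 (G' v0))
      + (\<Sum>j\<in>J. Re (cinner (v j) (G' (v j))) + Re (cinner (v j) (A' j v0)))" for v0 v
  have qD: "0 \<le> q v0 v" if v: "v0 \<in> ?D" "\<And>j. v j \<in> ?D" for v0 v
  proof -
    have "insert v0 (v ` J) \<subseteq> ?D" using v by auto
    then obtain F where F: "finite F" "orthonormal F"
      and ex: "\<forall>w\<in>insert v0 (v ` J). \<exists>a. w = (\<Sum>f\<in>F. t f (a f))"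
      using span_orthonormal_left[of "insert v0 (v ` J)"] J by auto
    obtain a0 where a0: "v0 = (\<Sum>f\<in>F. t f (a0 f))" using ex by auto
    have "\<forall>j\<in>J. \<exists>a. v j = (\<Sum>f\<in>F. t f (a f))" using ex by auto
    from bchoice[OF this] obtain a where a: "\<forall>j\<in>J. v j = (\<Sum>f\<in>F. t f (a j f))" ..
    \<comment> \<open>Orthonormality removes all cross terms between different \<open>f\<close>,
      leaving one instance of the original form for each \<open>f\<close>.\<close>
    have "q v0 v = (\<Sum>f\<in>F. Re (cinner (a0 f) (G (a0 f)))
      + (\<Sum>j\<in>J. Re (cinner (a j f) (G (a j f))) + Re (cinner (a j f) (A j (a0 f)))))"
      using a unfolding q_def sum.distrib sum.swap[where A = F and B = J]
      by (simp add: a0 blinfun.sum_right G' A' cinner_orthonormal_left[OF F(2,1)])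
    also have "0 \<le> \<dots>" by (intro sum_nonneg nonneg)
    finally show ?thesis by simp
  qed
  \<comment> \<open>All the vectors are approximated simultaneously from the algebraic span, where
    the form is already known to be nonnegative.\<close>
  have "\<exists>s. (\<forall>n. s n \<in> ?D) \<and> s \<longlonglongrightarrow> w" for w
    using dense closure_sequential[of w ?D] by auto
  then obtain s where sD: "\<And>w n. s w n \<in> ?D" and s: "\<And>w. s w \<longlonglongrightarrow> w" by metis
  have inn: "(\<lambda>n. Re (cinner (f n) (T (g n)))) \<longlonglongrightarrow> Re (cinner a (T b))"
    if "f \<longlonglongrightarrow> a" "g \<longlonglongrightarrow> b" for f g :: "nat \<Rightarrow> 'c" and a b and T :: "'c \<Rightarrow>\<^sub>L 'c"
    unfolding inner_eq_Re_cinner[symmetric] by (intro tendsto_intros that)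
  have "(\<lambda>n. q (s u0 n) (\<lambda>j. s (u j) n)) \<longlonglongrightarrow> q u0 u"
    unfolding q_def by (intro tendsto_add tendsto_sum inn s)
  moreover have "0 \<le> q (s u0 n) (\<lambda>j. s (u j) n)" for n by (intro qD sD)
  ultimately show ?thesis unfolding q_def[symmetric] by (intro LIMSEQ_le_const) auto
qed

end

interpretation tensor: tensor_map "(\<otimes>\<^sub>v)"
  by unfold_locales (rule tensor_dense | simp add: tensor_add_left tensor_add_right
    tensor_scaleC_left tensor_scaleC_right cinner_tensor)+

interpretation flip: tensor_map "\<lambda>(y::'b::chilbert_space) (x::'a::chilbert_space). x \<otimes>\<^sub>v y"
proof unfold_locales
  show "closure (span {y \<otimes>\<^sub>v x |(x::'b) (y::'a). True}) = UNIV"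
    unfolding tensor_dense[symmetric] by (rule arg_cong[where f = "\<lambda>S. closure (span S)"]) blast
qed (simp_all add: tensor_add_left tensor_add_right tensor_scaleC_left tensor_scaleC_right cinner_tensor)

text \<open>Factor through S tensor I and I tensor T; each factor is bounded by one of the two
  readings of \<open>tensor_map\<close>.\<close>

lemma norm_sum_tensor_le:
  fixes S :: "'a::chilbert_space \<Rightarrow>\<^sub>L 'a" and T :: "'b::chilbert_space \<Rightarrow>\<^sub>L 'b"
  assumes "finite I" "S \<in> \<B>" "T \<in> \<B>"
  shows "norm (\<Sum>i\<in>I. S (x i) \<otimes>\<^sub>v T (y i)) \<le> norm S * norm T * norm (\<Sum>i\<in>I. x i \<otimes>\<^sub>v y i)"
proof -
  have "norm (\<Sum>i\<in>I. S (x i) \<otimes>\<^sub>v T (y i)) \<le> norm S * norm (\<Sum>i\<in>I. x i \<otimes>\<^sub>v T (y i))"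
    by (rule flip.norm_sum_right_le[OF assms(1,2)])
  also have "\<dots> \<le> norm S * (norm T * norm (\<Sum>i\<in>I. x i \<otimes>\<^sub>v y i))"
    by (intro mult_left_mono tensor.norm_sum_right_le[OF assms(1,3)]) simp
  finally show ?thesis by (simp add: mult.assoc)
qed

text \<open>
  The graph of \<open>S \<otimes>\<^sub>o T\<close> is constructed as the closed span of the pairs \<open>(x \<otimes>\<^sub>v y, S x \<otimes>\<^sub>v T y)\<close>.
\<close>

lemma tensor_op_exists:
  fixes S :: "'a::chilbert_space \<Rightarrow>\<^sub>L 'a" and T :: "'b::chilbert_space \<Rightarrow>\<^sub>L 'b"
  assumes S: "S \<in> \<B>" and T: "T \<in> \<B>"
  shows "\<exists>R\<in>\<B>. (\<forall>x y. blinfun_apply R (x \<otimes>\<^sub>v y) = S x \<otimes>\<^sub>v T y) \<and> norm R \<le> norm S * norm T"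
proof -
  define E where "E = {(x \<otimes>\<^sub>v y, S x \<otimes>\<^sub>v T y) |x y. True}"
  define \<Gamma> where "\<Gamma> = closure (span E)"
  define C where "C = norm S * norm T"
  have C: "0 \<le> C" by (simp add: C_def)
  have sub: "subspace \<Gamma>" unfolding \<Gamma>_def by (intro subspace_closure subspace_span)
  have rep: "\<exists>m x y. p = ((\<Sum>i<(m::nat). x i \<otimes>\<^sub>v y i), (\<Sum>i<m. S (x i) \<otimes>\<^sub>v T (y i)))"
    if "p \<in> span E" for p
    using that
  proof (induction rule: span_induct_alt)
    case base
    show ?case by (rule exI[of _ 0]) (simp add: zero_prod_def)
  next
    case (step c u v)
    obtain m x y where "v = ((\<Sum>i<(m::nat). x i \<otimes>\<^sub>v y i), (\<Sum>i<m. S (x i) \<otimes>\<^sub>v T (y i)))"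
      using step(2) by blast
    moreover obtain x' y' where "u = (x' \<otimes>\<^sub>v y', S x' \<otimes>\<^sub>v T y')" using step(1) unfolding E_def by blast
    ultimately have "c *\<^sub>R u + v = ((\<Sum>i<Suc m. (x(m := c *\<^sub>R x')) i \<otimes>\<^sub>v (y(m := y')) i),
        (\<Sum>i<Suc m. S ((x(m := c *\<^sub>R x')) i) \<otimes>\<^sub>v T ((y(m := y')) i)))"
      by (simp add: tensor.scaleR_left blinfun.scaleR_right add.commute)
    thus ?case by blast
  qed
  have "norm (snd p) \<le> C * norm (fst p)" if p: "p \<in> span E" for p
  proof -
    obtain m x y where "p = ((\<Sum>i<(m::nat). x i \<otimes>\<^sub>v y i), (\<Sum>i<m. S (x i) \<otimes>\<^sub>v T (y i)))"
      using rep[OF p] by blast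
    thus ?thesis using norm_sum_tensor_le[OF _ S T, of "{..<m}" x y] by (simp add: C_def)
  qed
  \<comment> \<open>The norm bound is a closed condition, hence holds on all of
    \<open>\<Gamma>\<close>; it yields single-valuedness as well as boundedness.\<close>
  moreover have "closed {p :: ('a, 'b) htensor \<times> ('a, 'b) htensor. norm (snd p) \<le> C * norm (fst p)}"
    by (intro closed_Collect_le continuous_intros)
  ultimately have "\<Gamma> \<subseteq> {p. norm (snd p) \<le> C * norm (fst p)}"
    unfolding \<Gamma>_def by (intro closure_minimal) auto
  hence bound: "norm w \<le> C * norm z" if "(z, w) \<in> \<Gamma>" for z w using that by auto
  \<comment> \<open>Approximate \<open>z\<close> by first components from the span; by the norm
    bound the matching second components are Cauchy, and their limit is the value at
    \<open>z\<close>.\<close>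
  have total: "\<exists>w. (z, w) \<in> \<Gamma>" for z
  proof -
    have "fst ` E = {x \<otimes>\<^sub>v y |x y. True}" unfolding E_def by force
    hence fE: "fst ` span E = span {x \<otimes>\<^sub>v y |x y. True}"
      using linear_span_image[OF linear_fst, of E] by simp
    obtain a where "\<And>n. a n \<in> fst ` span E" and az: "a \<longlonglongrightarrow> z"
      using closure_sequential[of z "fst ` span E"] tensor_dense unfolding fE by blast
    hence "\<forall>n. \<exists>b. (a n, b) \<in> span E" by (metis imageE prod.collapse)
    then obtain b where ab: "\<And>n. (a n, b n) \<in> span E" by metis
    have d: "dist (b m) (b n) \<le> C * dist (a m) (a n)" for m n
    proof -
      have "(a m, b m) - (a n, b n) \<in> \<Gamma>"
        using closure_subset[of "span E"] span_diff[OF ab[of m] ab[of n]] unfolding \<Gamma>_def by blast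
      thus ?thesis using bound by (simp add: dist_norm)
    qed
    have "Cauchy b"
    proof (rule metric_CauchyI)
      fix e :: real assume e: "0 < e"
      hence "0 < e / (C + 1)" using C by simp
      moreover have "Cauchy a" using az by (rule LIMSEQ_imp_Cauchy)
      ultimately obtain M where M: "\<And>m n. M \<le> m \<Longrightarrow> M \<le> n \<Longrightarrow> dist (a m) (a n) < e / (C + 1)"
        unfolding Cauchy_def by blast
      have "dist (b m) (b n) < e" if "M \<le> m" "M \<le> n" for m n
      proof -
        have "(C + 1) * dist (a m) (a n) < e" using M[OF that] C by (simp add: field_simps)
        moreover have "C * dist (a m) (a n) \<le> (C + 1) * dist (a m) (a n)"
          by (intro mult_right_mono) auto
        ultimately show ?thesis using d[of m n] by linarith
      qed
      thus "\<exists>M. \<forall>m\<ge>M. \<forall>n\<ge>M. dist (b m) (b n) < e" by blast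
    qed
    then obtain w where "b \<longlonglongrightarrow> w" using Cauchy_convergent convergent_def by blast
    hence "(\<lambda>n. (a n, b n)) \<longlonglongrightarrow> (z, w)" by (intro tendsto_intros az)
    hence "(z, w) \<in> \<Gamma>"
      unfolding \<Gamma>_def closure_sequential by (intro exI[of _ "\<lambda>n. (a n, b n)"] conjI allI ab)
    thus ?thesis ..
  qed
  have uniq: "w = w'" if "(z, w) \<in> \<Gamma>" "(z, w') \<in> \<Gamma>" for z w w'
    using bound[of 0 "w - w'"] subspace_diff[OF sub that] by simp
  define f where "f z = (SOME w. (z, w) \<in> \<Gamma>)" for z
  have f: "(z, f z) \<in> \<Gamma>" for z unfolding f_def by (rule someI_ex[OF total])
  have feq: "f z = w" if "(z, w) \<in> \<Gamma>" for z w using uniq f that by blast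
  have "bounded_linear f"
  proof (rule bounded_linear_intro[where K = C])
    show "f (x + y) = f x + f y" for x y using subspace_add[OF sub f f] by (intro feq) simp
    show "f (r *\<^sub>R x) = r *\<^sub>R f x" for r x using subspace_scale[OF sub f] by (intro feq) simp
    show "norm (f x) \<le> norm x * C" for x using bound[OF f] by (simp add: mult.commute)
  qed
  hence app: "blinfun_apply (Blinfun f) = f" by (rule bounded_linear_Blinfun_apply)
  have el: "f (x \<otimes>\<^sub>v y) = S x \<otimes>\<^sub>v T y" for x y
    by (rule feq) (auto simp: \<Gamma>_def E_def intro!: closure_subset[THEN subsetD] span_base)
  have "Blinfun f \<in> \<B>"
  proof (rule bounded_opsI)
    fix c z
    show "Blinfun f (c *\<^sub>C z) = c *\<^sub>C Blinfun f z"
    proof (induction z rule: tensor.induct_closed)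
      case (1 x y)
      show ?case by (simp add: app el bounded_opsD[OF S] flip: tensor_scaleC_left)
    next
      case 3
      show ?case
        by (intro closed_Collect_eq continuous_intros
            bounded_linear.continuous_on[OF bounded_linear_scaleC])
    qed (simp add: blinfun.add_right scaleC_add_right)
  qed
  moreover have "norm (Blinfun f) \<le> C"
    by (intro norm_blinfun_bound C) (simp add: app bound[OF f])
  ultimately show ?thesis using el by (intro bexI[of _ "Blinfun f"]) (simp_all add: app C_def)
qed

lemma tensor_op_eqI:
  fixes S :: "'a::chilbert_space \<Rightarrow>\<^sub>L 'a" and T :: "'b::chilbert_space \<Rightarrow>\<^sub>L 'b"
  assumes "R \<in> \<B>" "\<And>x y. blinfun_apply R (x \<otimes>\<^sub>v y) = S x \<otimes>\<^sub>v T y"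
  shows "S \<otimes>\<^sub>o T = R"
  unfolding tensor_op_def
  by (rule the_equality) (auto simp: assms intro!: tensor.blinfun_eqI)

lemma
  fixes S :: "'a::chilbert_space \<Rightarrow>\<^sub>L 'a" and T :: "'b::chilbert_space \<Rightarrow>\<^sub>L 'b"
  assumes "S \<in> \<B>" "T \<in> \<B>"
  shows tensor_op_apply [simp]: "(S \<otimes>\<^sub>o T) (x \<otimes>\<^sub>v y) = S x \<otimes>\<^sub>v T y"
    and tensor_op_bounded_ops [simp, intro]: "S \<otimes>\<^sub>o T \<in> \<B>"
    and norm_tensor_op_le: "norm (S \<otimes>\<^sub>o T) \<le> norm S * norm T"
  using tensor_op_exists[OF assms] tensor_op_eqI by metis+

lemma tensor_op_compose:
  fixes S S' :: "'a::chilbert_space \<Rightarrow>\<^sub>L 'a" and T T' :: "'b::chilbert_space \<Rightarrow>\<^sub>L 'b"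
  assumes "S \<in> \<B>" "T \<in> \<B>" "S' \<in> \<B>" "T' \<in> \<B>"
  shows "(S \<otimes>\<^sub>o T) o\<^sub>L (S' \<otimes>\<^sub>o T') = (S o\<^sub>L S') \<otimes>\<^sub>o (T o\<^sub>L T')"
  by (rule tensor_op_eqI[symmetric]) (simp_all add: assms)

lemma tensor_op_id [simp]: "id_blinfun \<otimes>\<^sub>o id_blinfun = id_blinfun"
  by (rule tensor_op_eqI) simp_all

lemma tensor_op_add_left:
  fixes S S' :: "'a::chilbert_space \<Rightarrow>\<^sub>L 'a" and T :: "'b::chilbert_space \<Rightarrow>\<^sub>L 'b"
  assumes "S \<in> \<B>" "S' \<in> \<B>" "T \<in> \<B>"
  shows "(S + S') \<otimes>\<^sub>o T = S \<otimes>\<^sub>o T + S' \<otimes>\<^sub>o T"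
  by (rule tensor_op_eqI) (simp_all add: assms blinfun.add_left tensor_add_left)

lemma tensor_op_add_right:
  fixes S :: "'a::chilbert_space \<Rightarrow>\<^sub>L 'a" and T T' :: "'b::chilbert_space \<Rightarrow>\<^sub>L 'b"
  assumes "S \<in> \<B>" "T \<in> \<B>" "T' \<in> \<B>"
  shows "S \<otimes>\<^sub>o (T + T') = S \<otimes>\<^sub>o T + S \<otimes>\<^sub>o T'"
  by (rule tensor_op_eqI) (simp_all add: assms blinfun.add_left tensor_add_right)

lemma tensor_op_zero_left: "T \<in> \<B> \<Longrightarrow> 0 \<otimes>\<^sub>o T = 0"
  by (rule tensor_op_eqI) (simp_all add: tensor.zero_left)

lemma adj_tensor_op:
  fixes S :: "'a::chilbert_space \<Rightarrow>\<^sub>L 'a" and T :: "'b::chilbert_space \<Rightarrow>\<^sub>L 'b"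
  assumes S: "S \<in> \<B>" and T: "T \<in> \<B>"
  shows "adj (S \<otimes>\<^sub>o T) = adj S \<otimes>\<^sub>o adj T"
proof (rule adj_eqI)
  note B = adj_bounded_ops[OF S] adj_bounded_ops[OF T] S T
  \<comment> \<open>\<open>cinner\<close> is conjugate-linear in its first argument, so closedness
    is shown for the conjugated equation.\<close>
  have lin: "closed {z. cinner (R z) w = cinner z v}" for R :: "('a, 'b) htensor \<Rightarrow>\<^sub>L ('a, 'b) htensor" and w v
  proof -
    have "closed {z. cinner w (R z) = cinner v z}"
      by (intro closed_Collect_eq
          bounded_linear.continuous_on[OF bounded_linear_cinner_right] continuous_intros)
    moreover have "cinner (R z) w = cinner z v \<longleftrightarrow> cinner w (R z) = cinner v z" for z
      by (metis cinner_commute)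
    ultimately show ?thesis by simp
  qed
  have el: "cinner ((adj S \<otimes>\<^sub>o adj T) (x \<otimes>\<^sub>v y)) w = cinner (x \<otimes>\<^sub>v y) ((S \<otimes>\<^sub>o T) w)" for x y w
    by (induction w rule: tensor.induct_closed)
      (auto simp: B cinner_tensor cinner_adj_left blinfun.add_right cinner_add_right
        intro!: closed_Collect_eq bounded_linear.continuous_on[OF bounded_linear_cinner_right]
          continuous_intros)
  show "cinner ((adj S \<otimes>\<^sub>o adj T) z) w = cinner z ((S \<otimes>\<^sub>o T) w)" for z w
    by (induction z rule: tensor.induct_closed)
      (use el lin in \<open>auto simp: blinfun.add_right cinner_add_left\<close>)
qed

section \<open>Orthonormal families and weighted shifts\<close>

text \<open>Were \<open>E\<close> finite, the residual of each \<open>x\<close> after projection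
  onto \<open>E\<close> would be orthogonal to \<open>E\<close> and vanish by Parseval, making the
  space finite-dimensional.\<close>

lemma infinite_maximal_orthonormal:
  fixes B E :: "'x::chilbert_space set"
  assumes B: "infinite B" "independent B"
    and E: "orthonormal E" and max: "\<And>C. orthonormal C \<Longrightarrow> E \<subseteq> C \<Longrightarrow> C = E"
  shows "infinite E"
proof
  assume fin: "finite E"
  \<comment> \<open>\<open>span\<close> and \<open>independent\<close> are taken over the reals, so
    a complex spanning set must be joined by its multiples by \<open>\<i>\<close>.\<close>
  let ?S = "E \<union> (\<lambda>b. \<i> *\<^sub>C b) ` E"
  have "x \<in> span ?S" for x
  proof -
    define p where "p = (\<Sum>b\<in>E. cinner b x *\<^sub>C b)"
    have "cinner b (x - p) = 0" if "b \<in> E" for b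
      using cinner_orthonormal_sum[OF E fin order_refl that, of "\<lambda>b. cinner b x"] that
      by (simp add: p_def cinner_diff_right)
    hence "(norm (x - p))\<^sup>2 = 0"
      using Parseval(2)[OF E max, of "x - p"] fin by simp
    hence xp: "x = p" by simp
    have "c *\<^sub>C b \<in> span ?S" if "b \<in> E" for c b
    proof -
      have "c *\<^sub>C b = Re c *\<^sub>R b + Im c *\<^sub>R (\<i> *\<^sub>C b)"
      proof -
        have "Re c *\<^sub>R b + Im c *\<^sub>R (\<i> *\<^sub>C b) = (complex_of_real (Re c) + complex_of_real (Im c) * \<i>) *\<^sub>C b"
          by (simp add: scaleR_scaleC scaleC_scaleC scaleC_add_left)
        also have "complex_of_real (Re c) + complex_of_real (Im c) * \<i> = c"
          by (simp add: complex_eq_iff)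
        finally show ?thesis ..
      qed
      moreover have "b \<in> span ?S" "\<i> *\<^sub>C b \<in> span ?S" using that by (auto intro: span_base)
      ultimately show ?thesis by (simp add: span_add span_scale)
    qed
    thus ?thesis unfolding xp unfolding p_def by (intro span_sum)
  qed
  hence "finite B" using independent_span_bound[OF _ B(2), of ?S] fin by blast
  thus False using B(1) by blast
qed

text \<open>Words over a finite alphabet are countable, so they can label distinct members of an
  infinite orthonormal set.\<close>

lemma exists_orthonormal_words:
  assumes "\<exists>B :: 'x::chilbert_space set. infinite B \<and> independent B"
  shows "\<exists>e :: 'n::finite list \<Rightarrow> 'x. \<forall>v w. cinner (e v) (e w) = (if v = w then 1 else 0)"
proof -
  obtain E :: "'x set" where E: "orthonormal E" and max: "\<And>C. orthonormal C \<Longrightarrow> E \<subseteq> C \<Longrightarrow> C = E"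
    using exists_maximal_orthonormal by metis
  have "infinite E" using assms infinite_maximal_orthonormal[OF _ _ E max] by blast
  then obtain g :: "nat \<Rightarrow> 'x" where g: "inj g" "range g \<subseteq> E" using infinite_countable_subset by blast
  define e where "e w = g (to_nat w)" for w :: "'n list"
  have "cinner (e v) (e w) = (if v = w then 1 else 0)" for v w
  proof -
    have "e v \<in> E" "e w \<in> E" "e v = e w \<longleftrightarrow> v = w"
      using g by (auto simp: e_def inj_eq)
    thus ?thesis using E unfolding orthonormal_def by auto
  qed
  thus ?thesis by blast
qed

section \<open>Rank-one operators and truncated creation operators\<close>

definition ketbra :: "'a::complex_inner \<Rightarrow> 'a \<Rightarrow> 'a \<Rightarrow>\<^sub>L 'a" where
  "ketbra a b = Blinfun (\<lambda>x. cinner b x *\<^sub>C a)"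

lemma ketbra_apply [simp]: "ketbra a b x = cinner b x *\<^sub>C a"
proof -
  have "bounded_linear (\<lambda>x. cinner b x *\<^sub>C a)"
  proof (rule bounded_linear_intro[where K = "norm a * norm b"])
    show "norm (cinner b x *\<^sub>C a) \<le> norm x * (norm a * norm b)" for x
      using mult_left_mono[OF cinner_Cauchy_Schwarz[of b x], of "norm a"]
      by (simp add: norm_scaleC mult_ac)
  qed (simp_all add: cinner_add_right scaleC_add_left scaleR_scaleC scaleC_scaleC cinner_scaleC_right)
  thus ?thesis by (simp add: ketbra_def bounded_linear_Blinfun_apply)
qed

lemma ketbra_bounded_ops [simp, intro]: "ketbra a b \<in> \<B>"
  by (rule bounded_opsI) (simp add: cinner_scaleC_right scaleC_scaleC)

lemma finite_words [simp]:
  "finite {w :: 'n::finite list. length w = k}"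
  "finite {w :: 'n::finite list. length w < k}"
  "finite {w :: 'n::finite list. length w \<le> k}"
  using finite_lists_length_le[of "UNIV :: 'n set" k] by (auto elim!: rev_finite_subset)

text \<open>
  The left creation operators, transplanted to an orthonormal family indexed by words, scaled by
  \<open>r\<close>, and cut off so that products of more than \<open>k\<close> of them vanish on the words of length at most \<open>k\<close>.
\<close>

definition trunc_shift :: "('n::finite list \<Rightarrow> 'x::chilbert_space) \<Rightarrow> real \<Rightarrow> nat \<Rightarrow> 'n \<Rightarrow> 'x \<Rightarrow>\<^sub>L 'x" where
  "trunc_shift e r k i = r *\<^sub>R (\<Sum>w | length w < k. ketbra (e (i # w)) (e w))"

locale word_basis =
  fixes e :: "'n::finite list \<Rightarrow> 'x::chilbert_space"
  assumes cinner_e: "cinner (e v) (e w) = (if v = w then 1 else 0)"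
begin

lemma e_eq_iff: "e v = e w \<longleftrightarrow> v = w"
  using cinner_e[of v w] cinner_e[of v v] by (metis zero_neq_one)

lemma trunc_shift_bounded_ops [simp, intro]: "trunc_shift e r k i \<in> \<B>"
  unfolding trunc_shift_def by auto

lemma trunc_shift_e:
  "trunc_shift e r k i (e w) = (if length w < k then r *\<^sub>R e (i # w) else 0)"
proof -
  have "cinner (e v) (e w) *\<^sub>C e (i # v) = (if v = w then e (i # v) else 0)" for v
    by (simp add: cinner_e scaleC_one)
  hence "trunc_shift e r k i (e w) = r *\<^sub>R (\<Sum>v | length v < k. if v = w then e (i # v) else 0)"
    by (simp add: trunc_shift_def blinfun.scaleR_left blinfun.sum_left)
  thus ?thesis by simp
qed

lemma adj_trunc_shift:
  "adj (trunc_shift e r k i) = r *\<^sub>R (\<Sum>w | length w < k. ketbra (e w) (e (i # w)))"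
proof (rule adj_eqI)
  fix x y
  have "cinner (ketbra (e w) (e (i # w)) x) y = cinner x (ketbra (e (i # w)) (e w) y)" for w
    by (simp add: cinner_scaleC_left cinner_scaleC_right mult.commute cinner_commute[of x])
  thus "cinner ((r *\<^sub>R (\<Sum>w | length w < k. ketbra (e w) (e (i # w)))) x) y
      = cinner x (trunc_shift e r k i y)"
    by (simp only: trunc_shift_def blinfun.scaleR_left blinfun.sum_left scaleR_scaleC
        cinner_scaleC_left cinner_scaleC_right cinner_sum_left cinner_sum_right complex_cnj_complex_of_real)
qed

text \<open>The row product is \<open>r\<^sup>2\<close> times the orthogonal projection onto the
  span of the \<open>e v\<close> with \<open>v\<close> nonempty of length at most \<open>k\<close>,
  and Bessel bounds that projection by 1.\<close>

lemma trunc_shift_row_ball: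
  assumes r: "0 \<le> r" "r < 1"
  shows "trunc_shift e r k \<in> row_ball UNIV"
proof -
  define V where "V = {v :: 'n list. v \<noteq> [] \<and> length v \<le> k}"
  have finV: "finite V" by (rule finite_subset[OF _ finite_words(3)[of k]]) (auto simp: V_def)
  have on: "orthonormal (range e)" by (auto simp: orthonormal_def cinner_e e_eq_iff)
  have "norm (\<Sum>i\<in>UNIV. trunc_shift e r k i o\<^sub>L adj (trunc_shift e r k i)) \<le> r\<^sup>2"
  proof (rule norm_blinfun_bound)
    fix x
    define f where "f v = cinner (e v) x *\<^sub>C e v" for v
    have "(trunc_shift e r k i o\<^sub>L adj (trunc_shift e r k i)) x = r\<^sup>2 *\<^sub>R (\<Sum>w | length w < k. f (i # w))" for i
    proof -
      have "(trunc_shift e r k i o\<^sub>L adj (trunc_shift e r k i)) x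
          = r *\<^sub>R (\<Sum>w | length w < k. cinner (e (i # w)) x *\<^sub>C trunc_shift e r k i (e w))"
        by (simp add: adj_trunc_shift blinfun.scaleR_left blinfun.sum_left blinfun.scaleR_right
            blinfun.sum_right bounded_opsD)
      also have "\<dots> = r *\<^sub>R (\<Sum>w | length w < k. r *\<^sub>R f (i # w))"
        by (simp add: trunc_shift_e f_def scaleR_scaleC scaleC_scaleC mult.commute)
      finally show ?thesis by (simp add: scaleR_right.sum power2_eq_square)
    qed
    hence "(\<Sum>i\<in>UNIV. trunc_shift e r k i o\<^sub>L adj (trunc_shift e r k i)) x
        = r\<^sup>2 *\<^sub>R (\<Sum>i\<in>UNIV. \<Sum>w | length w < k. f (i # w))"
      by (simp add: blinfun.sum_left scaleR_right.sum)
    also have "(\<Sum>i\<in>UNIV. \<Sum>w | length w < k. f (i # w)) = (\<Sum>(i, w)\<in>UNIV \<times> {w. length w < k}. f (i # w))"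
      by (rule sum.cartesian_product)
    \<comment> \<open>Every nonempty word has a unique first letter and tail, so each
      \<open>v\<close> in \<open>V\<close> occurs exactly once.\<close>
    also have "\<dots> = (\<Sum>v\<in>V. f v)"
      by (rule sum.reindex_bij_witness[of _ "\<lambda>v. (hd v, tl v)" "\<lambda>(i, w). i # w"])
        (auto simp: V_def neq_Nil_conv)
    also have "\<dots> = (\<Sum>b\<in>e ` V. cinner b x *\<^sub>C b)"
      by (subst sum.reindex) (auto simp: inj_on_def e_eq_iff f_def)
    finally have "norm ((\<Sum>i\<in>UNIV. trunc_shift e r k i o\<^sub>L adj (trunc_shift e r k i)) x)
        = r\<^sup>2 * norm (\<Sum>b\<in>e ` V. cinner b x *\<^sub>C b)" by simp
    also have "norm (\<Sum>b\<in>e ` V. cinner b x *\<^sub>C b) \<le> norm x"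
    proof (rule power2_le_imp_le)
      have "(norm (\<Sum>b\<in>e ` V. cinner b x *\<^sub>C b))\<^sup>2 = (\<Sum>b\<in>e ` V. (cmod (cinner b x))\<^sup>2)"
        by (rule norm_sq_orthonormal_sum[OF on]) (use finV in auto)
      also have "\<dots> \<le> (norm x)\<^sup>2" by (rule Bessel[OF on]) (use finV in auto)
      finally show "(norm (\<Sum>b\<in>e ` V. cinner b x *\<^sub>C b))\<^sup>2 \<le> (norm x)\<^sup>2" .
    qed simp
    finally show "norm ((\<Sum>i\<in>UNIV. trunc_shift e r k i o\<^sub>L adj (trunc_shift e r k i)) x) \<le> r\<^sup>2 * norm x"
      by (simp add: mult_left_mono)
  qed simp
  also have "r\<^sup>2 < 1" using r by (simp add: power_less_one_iff abs_square_less_1)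
  finally show ?thesis
    by (auto simp: row_ball_def ops_on_def cinner_self dest: spec[of _ 0])
      (metis cinner_self norm_eq_zero of_real_eq_0_iff power_eq_0_iff blinfun.zero_right zero_less_numeral)
qed

text \<open>Each letter is prepended with a factor \<open>r\<close> until the length would exceed
  \<open>k\<close>. The bound on \<open>w\<close> matters for the empty \<open>\<alpha>\<close>,
  which acts as the identity.\<close>

lemma word_op_trunc_shift:
  assumes "length w \<le> k"
  shows "word_op id_blinfun (trunc_shift e r k) \<alpha> (e w)
    = (if length \<alpha> + length w \<le> k then r ^ length \<alpha> *\<^sub>R e (\<alpha> @ w) else 0)"
  using assms by (induction \<alpha>) (auto simp: trunc_shift_e blinfun.scaleR_right)

end

lemma word_op_bounded_ops:
  assumes "\<And>i. X i \<in> \<B>"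
  shows "word_op id_blinfun X \<alpha> \<in> \<B>"
  by (induction \<alpha>) (auto simp: assms)

lemma subspace_id_UNIV: "subspace_id UNIV = id_blinfun"
  unfolding subspace_id_def
proof (rule the_equality)
  fix P :: "'a \<Rightarrow>\<^sub>L 'a"
  assume P: "P \<in> \<B> \<and> (\<forall>x. P x \<in> UNIV \<and> (\<forall>y\<in>UNIV. cinner y (x - P x) = 0))"
  show "P = id_blinfun"
  proof (rule blinfun_eqI)
    fix x
    have "cinner (x - P x) (x - P x) = 0" using P by blast
    thus "P x = id_blinfun x" by (simp add: cinner_self)
  qed
qed simp

lemma hilbert_subspace_UNIV: "hilbert_subspace UNIV"
  by (simp add: hilbert_subspace_def)

section \<open>Positivity of the coefficient matrix\<close>

text \<open>The inequality for the real part is tested on \<open>z\<close>, which carries the vector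
  \<open>g w\<close> at the basis vector \<open>e w\<close> for the empty word and the words of
  length \<open>k\<close>.\<close>

lemma coeff_matrix_scaled:
  fixes A :: "'n::finite list \<Rightarrow> ('h::chilbert_space \<Rightarrow>\<^sub>L 'h)"
  assumes universe: "\<exists>B :: 'x::chilbert_space set. infinite B \<and> independent B"
    and holomorphic: "universal_holomorphic TYPE('x) A"
    and ReF: "\<And>(M :: 'x set) X. hilbert_subspace M \<Longrightarrow> X \<in> row_ball M \<Longrightarrow>
      op_le (Re_op (holomorphic_eval A M X)) (subspace_id M \<otimes>\<^sub>o id_blinfun)"
    and k: "1 \<le> k" and r: "0 \<le> r" "r < 1"
  shows "r ^ k * (\<Sum>\<alpha> | length \<alpha> = k. Re (cinner (g \<alpha>) (A \<alpha> (g []))))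
    \<le> Re (cinner (g []) ((id_blinfun - A []) (g [])))
      + (\<Sum>\<alpha> | length \<alpha> = k. Re (cinner (g \<alpha>) ((id_blinfun - A []) (g \<alpha>))))"
proof -
  obtain e :: "'n list \<Rightarrow> 'x" where "\<forall>v w. cinner (e v) (e w) = (if v = w then 1 else 0)"
    using exists_orthonormal_words[OF universe] by blast
  then interpret word_basis e by (simp add: word_basis_def)
  define X where "X = trunc_shift e r k"
  define W where "W = insert [] {\<alpha> :: 'n list. length \<alpha> = k}"
  define z where "z = (\<Sum>w\<in>W. e w \<otimes>\<^sub>v g w)"
  define h where "h = homogeneous_part A UNIV X"
  define F where "F = holomorphic_eval A UNIV X"
  have finW: "finite W" by (simp add: W_def)
  have WS: "(\<Sum>w\<in>W. c w) = c [] + (\<Sum>\<alpha> | length \<alpha> = k. c \<alpha>)" for c :: "'n list \<Rightarrow> complex"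
    using k by (simp add: W_def)
  have Wk: "length w \<le> k" if "w \<in> W" for w using that by (auto simp: W_def)
  have AB [simp]: "A \<alpha> \<in> \<B>" for \<alpha> using holomorphic by (simp add: universal_holomorphic_def)
  have wB [simp]: "word_op id_blinfun X \<alpha> \<in> \<B>" for \<alpha> by (rule word_op_bounded_ops) (simp add: X_def)
  have Xb: "X \<in> row_ball UNIV" unfolding X_def by (rule trunc_shift_row_ball[OF r])
  have sm: "summable h"
    using holomorphic[unfolded universal_holomorphic_def, THEN conjunct2, rule_format,
        OF hilbert_subspace_UNIV Xb] unfolding h_def .
  have h: "h j = (\<Sum>\<alpha> | length \<alpha> = j. word_op id_blinfun X \<alpha> \<otimes>\<^sub>o A \<alpha>)" for j
    by (simp add: h_def homogeneous_part_def subspace_id_UNIV)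
  have hB: "h j \<in> \<B>" for j unfolding h by auto
  have F: "F = suminf h" by (simp add: F_def h_def holomorphic_eval_def)
  have "(\<Sum>j<n. h j) \<in> \<B>" for n by (intro bounded_ops_sum hB)
  hence FB: "F \<in> \<B>"
    unfolding F by (rule closed_sequentially[OF closed_bounded_ops _ summable_LIMSEQ[OF sm]])
  \<comment> \<open>If \<open>\<alpha> @ w = v\<close>, the product has length at most
    \<open>k\<close>, so the cut-off does not interfere; otherwise truncation or orthogonality gives
    0.\<close>
  have ew: "cinner (e v) (word_op id_blinfun X \<alpha> (e w)) = (if \<alpha> @ w = v then complex_of_real (r ^ length \<alpha>) else 0)"
    if "v \<in> W" "w \<in> W" for v w \<alpha>
    using Wk[OF that(1)] Wk[OF that(2)]
    by (auto simp: X_def word_op_trunc_shift cinner_e scaleR_scaleC cinner_scaleC_right)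
  define T where "T j v \<alpha> w = (if \<alpha> @ w = v then complex_of_real (r ^ j) * cinner (g v) (A \<alpha> (g w)) else 0)"
    for j v \<alpha> w
  have zh: "cinner z (h j z) = (\<Sum>v\<in>W. \<Sum>\<alpha> | length \<alpha> = j. \<Sum>w\<in>W. T j v \<alpha> w)" for j
    unfolding z_def cinner_sum_left
  proof (rule sum.cong[OF refl])
    fix v assume v: "v \<in> W"
    have "cinner (e v \<otimes>\<^sub>v g v) (h j (\<Sum>w\<in>W. e w \<otimes>\<^sub>v g w))
       = (\<Sum>\<alpha> | length \<alpha> = j. \<Sum>w\<in>W. cinner (e v) (word_op id_blinfun X \<alpha> (e w)) * cinner (g v) (A \<alpha> (g w)))"
      by (simp add: h blinfun.sum_left blinfun.sum_right cinner_sum_right cinner_tensor)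
        (rule sum.swap)
    also have "\<dots> = (\<Sum>\<alpha> | length \<alpha> = j. \<Sum>w\<in>W. T j v \<alpha> w)"
      using v by (intro sum.cong refl) (auto simp: ew T_def)
    finally show "cinner (e v \<otimes>\<^sub>v g v) (h j (\<Sum>w\<in>W. e w \<otimes>\<^sub>v g w)) = \<dots>" .
  qed
  have z0: "cinner z (h 0 z) = (\<Sum>w\<in>W. cinner (g w) (A [] (g w)))"
    unfolding zh using finW by (intro sum.cong refl) (simp add: T_def)
  have zk: "cinner z (h k z) = complex_of_real (r ^ k) * (\<Sum>\<alpha> | length \<alpha> = k. cinner (g \<alpha>) (A \<alpha> (g [])))"
  proof -
    have "(\<Sum>w\<in>W. T k v \<alpha> w) = (if v = \<alpha> then complex_of_real (r ^ k) * cinner (g \<alpha>) (A \<alpha> (g [])) else 0)"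
      if "v \<in> W" "length \<alpha> = k" for v \<alpha>
    proof -
      \<comment> \<open>A word of length \<open>k\<close> followed by \<open>w\<close> can equal a
        word of length at most \<open>k\<close> only if \<open>w\<close> is empty.\<close>
      have "(\<Sum>w\<in>W. T k v \<alpha> w) = (\<Sum>w\<in>W. if w = [] then T k v \<alpha> [] else 0)"
        using Wk[OF that(1)] that(2) by (intro sum.cong refl) (auto simp: T_def)
      thus ?thesis using finW by (auto simp: T_def W_def)
    qed
    hence "cinner z (h k z) = (\<Sum>v\<in>W. \<Sum>\<alpha> | length \<alpha> = k.
        if v = \<alpha> then complex_of_real (r ^ k) * cinner (g \<alpha>) (A \<alpha> (g [])) else 0)"
      unfolding zh by (intro sum.cong refl) auto
    also have "\<dots> = (\<Sum>\<alpha> | length \<alpha> = k. \<Sum>v\<in>W.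
        if v = \<alpha> then complex_of_real (r ^ k) * cinner (g \<alpha>) (A \<alpha> (g [])) else 0)"
      by (rule sum.swap)
    also have "\<dots> = (\<Sum>\<alpha> | length \<alpha> = k. complex_of_real (r ^ k) * cinner (g \<alpha>) (A \<alpha> (g [])))"
      using finW by (intro sum.cong refl) (simp add: W_def)
    finally show ?thesis by (simp add: sum_distrib_left)
  qed
  \<comment> \<open>Words in \<open>W\<close> have length 0 or \<open>k\<close>, so lengths inside
    \<open>W\<close> can differ only by 0 or \<open>k\<close>. The series of forms thus collapses to
    two terms.\<close>
  have zj: "cinner z (h j z) = 0" if "j \<notin> {0, k}" for j
    unfolding zh
  proof (intro sum.neutral ballI)
    fix v \<alpha> w :: "'n list" assume "v \<in> W" "\<alpha> \<in> {\<alpha>. length \<alpha> = j}" "w \<in> W"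
    hence "length v = 0 \<or> length v = k" "length w = 0 \<or> length w = k" "length \<alpha> = j"
      unfolding W_def by auto
    hence "length (\<alpha> @ w) \<noteq> length v" using that by fastforce
    hence "\<alpha> @ w \<noteq> v" by blast
    thus "T j v \<alpha> w = 0" by (simp add: T_def)
  qed
  have "cinner z (F z) = (\<Sum>j. cinner z (h j z))"
    unfolding F
    by (rule bounded_linear.suminf[OF bounded_linear_compose[OF bounded_linear_cinner_right
          blinfun.bounded_linear_left] sm])
  also have "\<dots> = (\<Sum>j\<in>{0, k}. cinner z (h j z))"
    by (rule suminf_finite) (auto simp: zj)
  also have "\<dots> = (\<Sum>w\<in>W. cinner (g w) (A [] (g w)))
      + complex_of_real (r ^ k) * (\<Sum>\<alpha> | length \<alpha> = k. cinner (g \<alpha>) (A \<alpha> (g [])))"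
    using k by (simp add: z0 zk)
  finally have zF: "cinner z (F z) = \<dots>" .
  have zz: "cinner z z = (\<Sum>w\<in>W. cinner (g w) (g w))"
  proof -
    have "cinner z z = (\<Sum>v\<in>W. \<Sum>w\<in>W. if v = w then cinner (g v) (g w) else 0)"
      unfolding z_def cinner_sum_left cinner_sum_right
      by (intro sum.cong refl) (simp add: cinner_tensor cinner_e)
    thus ?thesis using finW by simp
  qed
  have "positive_op (id_blinfun - Re_op F)"
    using ReF[OF hilbert_subspace_UNIV Xb] by (simp add: op_le_def F_def subspace_id_UNIV)
  hence "cinner z ((id_blinfun - Re_op F) z) \<in> \<real>\<^sub>\<ge>\<^sub>0" by (simp add: positive_op_def)
  moreover have "cinner z ((id_blinfun - Re_op F) z) = cinner z z - complex_of_real (Re (cinner z (F z)))"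
    by (simp add: blinfun.diff_left cinner_diff_right cinner_Re_op[OF FB])
  ultimately have "Re (cinner z (F z)) \<le> Re (cinner z z)"
    by (simp add: complex_nonneg_Reals_iff)
  thus ?thesis
    unfolding zF zz WS by (simp add: blinfun.diff_left cinner_diff_right sum_subtractf)
qed

lemma coeff_matrix_nonneg:
  fixes A :: "'n::finite list \<Rightarrow> ('h::chilbert_space \<Rightarrow>\<^sub>L 'h)"
  assumes universe: "\<exists>B :: 'x::chilbert_space set. infinite B \<and> independent B"
    and holomorphic: "universal_holomorphic TYPE('x) A"
    and ReF: "\<And>(M :: 'x set) X. hilbert_subspace M \<Longrightarrow> X \<in> row_ball M \<Longrightarrow>
      op_le (Re_op (holomorphic_eval A M X)) (subspace_id M \<otimes>\<^sub>o id_blinfun)"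
    and k: "1 \<le> k"
  shows "0 \<le> Re (cinner h0 ((id_blinfun - A []) h0))
      + (\<Sum>\<alpha> | length \<alpha> = k. Re (cinner (h \<alpha>) ((id_blinfun - A []) (h \<alpha>))) + Re (cinner (h \<alpha>) (A \<alpha> h0)))"
proof -
  \<comment> \<open>The sign turns an upper bound on the off-diagonal sum into nonnegativity of the
    form. The slot of the empty word is free for \<open>h0\<close> because \<open>k\<close> is at
    least 1.\<close>
  define g where "g = (\<lambda>\<alpha>. - h \<alpha>)([] := h0)"
  have g: "g [] = h0" "\<And>\<alpha>. length \<alpha> = k \<Longrightarrow> g \<alpha> = - h \<alpha>" using k by (auto simp: g_def)
  define S where "S = (\<Sum>\<alpha> | length \<alpha> = k. Re (cinner (g \<alpha>) (A \<alpha> (g []))))"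
  define R where "R = Re (cinner (g []) ((id_blinfun - A []) (g [])))
      + (\<Sum>\<alpha> | length \<alpha> = k. Re (cinner (g \<alpha>) ((id_blinfun - A []) (g \<alpha>))))"
  have "S \<le> R"
  proof (rule field_le_mult_one_interval)
    fix s :: real assume s: "0 < s" "s < 1"
    \<comment> \<open>Radius chosen so that its \<open>k\<close>-th power is \<open>s\<close>; an
      inequality valid for all \<open>s\<close> in (0,1) then passes to the limit 1.\<close>
    have "root k s ^ k = s" "0 \<le> root k s" "root k s < 1"
      using k s by auto
    thus "s * S \<le> R"
      using coeff_matrix_scaled[OF universe holomorphic ReF k, of "root k s" g] unfolding S_def R_def by simp
  qed
  moreover have "S = - (\<Sum>\<alpha> | length \<alpha> = k. Re (cinner (h \<alpha>) (A \<alpha> h0)))"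
    by (simp add: S_def g cinner_minus_left sum_negf)
  moreover have "R = Re (cinner h0 ((id_blinfun - A []) h0))
      + (\<Sum>\<alpha> | length \<alpha> = k. Re (cinner (h \<alpha>) ((id_blinfun - A []) (h \<alpha>))))"
    by (simp add: R_def g cinner_minus_left cinner_minus_right blinfun.minus_right)
  ultimately show ?thesis by (simp add: sum.distrib)
qed

text \<open>The matrix form is twice the expression in \<open>nonneg\<close>: each entry below the
  diagonal pairs with its adjoint to give twice a real part.\<close>

lemma positive_coeff_matrix:
  fixes A :: "'n::finite list \<Rightarrow> ('h::chilbert_space \<Rightarrow>\<^sub>L 'h)"
  assumes A: "\<And>\<alpha>. A \<alpha> \<in> \<B>" and A0: "positive_op (A [])"
    and nonneg: "\<And>h0 h. 0 \<le> Re (cinner h0 ((id_blinfun - A []) h0))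
      + (\<Sum>\<alpha> | length \<alpha> = k. Re (cinner (h \<alpha>) ((id_blinfun - A []) (h \<alpha>))) + Re (cinner (h \<alpha>) (A \<alpha> h0)))"
  shows "positive_op_matrix (block_index k) (coeff_matrix A)"
  unfolding positive_op_matrix_def
proof
  fix v :: "'n list option \<Rightarrow> 'h"
  let ?G = "id_blinfun - A []" and ?L = "{\<alpha> :: 'n list. length \<alpha> = k}"
  \<comment> \<open>Positivity of the matrix includes reality of its form; on the diagonal this
    comes from positivity of \<open>A []\<close>.\<close>
  have Greal: "cinner x (?G x) = complex_of_real (Re (cinner x (?G x)))" for x
  proof -
    have "cinner x (A [] x) \<in> \<real>" using A0 nonneg_Reals_subset_Reals by (auto simp: positive_op_def)
    hence "cinner x (?G x) \<in> \<real>" by (simp add: blinfun.diff_left cinner_diff_right cinner_self)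
    thus ?thesis by (simp add: of_real_Re)
  qed
  have two: "cinner x ((2 *\<^sub>R ?G) y) = 2 * cinner x (?G y)" for x y
    by (simp add: blinfun.scaleR_left scaleR_scaleC cinner_scaleC_right)
  have bs: "sum f (block_index k) = f None + (\<Sum>\<alpha>\<in>?L. f (Some \<alpha>))" for f :: "'n list option \<Rightarrow> 'z::comm_monoid_add"
    by (simp add: block_index_def sum.reindex image_iff)
  have diag: "(\<Sum>\<beta>\<in>?L. coeff_matrix A (Some \<alpha>) (Some \<beta>) (v (Some \<beta>))) = (2 *\<^sub>R ?G) (v (Some \<alpha>))"
    if "length \<alpha> = k" for \<alpha>
  proof -
    have "(\<Sum>\<beta>\<in>?L. coeff_matrix A (Some \<alpha>) (Some \<beta>) (v (Some \<beta>)))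
        = (\<Sum>\<beta>\<in>?L. if \<alpha> = \<beta> then (2 *\<^sub>R ?G) (v (Some \<beta>)) else 0)"
      by (intro sum.cong refl) simp
    thus ?thesis using that by simp
  qed
  let ?R = "\<lambda>p. \<Sum>q\<in>block_index k. coeff_matrix A p q (v q)"
  have row_None: "?R None = (2 *\<^sub>R ?G) (v None) + (\<Sum>\<alpha>\<in>?L. adj (A \<alpha>) (v (Some \<alpha>)))"
    by (simp only: bs coeff_matrix.simps)
  have row_Some: "?R (Some \<alpha>) = A \<alpha> (v None) + (2 *\<^sub>R ?G) (v (Some \<alpha>))" if "length \<alpha> = k" for \<alpha>
    by (simp only: bs diag[OF that] coeff_matrix.simps(3))
  have "(\<Sum>p\<in>block_index k. cinner (v p) (?R p))
      = cinner (v None) (?R None) + (\<Sum>\<alpha>\<in>?L. cinner (v (Some \<alpha>)) (?R (Some \<alpha>)))"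
    by (rule bs)
  also have "(\<Sum>\<alpha>\<in>?L. cinner (v (Some \<alpha>)) (?R (Some \<alpha>)))
      = (\<Sum>\<alpha>\<in>?L. cinner (v (Some \<alpha>)) (A \<alpha> (v None) + (2 *\<^sub>R ?G) (v (Some \<alpha>))))"
    by (intro sum.cong refl arg_cong[where f = "cinner _"] row_Some) simp
  also have "cinner (v None) (?R None) + \<dots>
      = 2 * cinner (v None) (?G (v None)) + (\<Sum>\<alpha>\<in>?L. cinner (A \<alpha> (v None)) (v (Some \<alpha>)))
        + (\<Sum>\<alpha>\<in>?L. cinner (v (Some \<alpha>)) (A \<alpha> (v None)) + 2 * cinner (v (Some \<alpha>)) (?G (v (Some \<alpha>))))"
    by (simp only: row_None two cinner_adj_right[OF A] cinner_add_right cinner_sum_right)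
  also have "\<dots> = 2 * cinner (v None) (?G (v None))
        + (\<Sum>\<alpha>\<in>?L. (cinner (A \<alpha> (v None)) (v (Some \<alpha>)) + cinner (v (Some \<alpha>)) (A \<alpha> (v None)))
          + 2 * cinner (v (Some \<alpha>)) (?G (v (Some \<alpha>))))"
    by (simp add: sum.distrib)
  also have "\<dots> = 2 * complex_of_real (Re (cinner (v None) (?G (v None))))
        + (\<Sum>\<alpha>\<in>?L. complex_of_real (2 * Re (cinner (v (Some \<alpha>)) (A \<alpha> (v None))))
          + 2 * complex_of_real (Re (cinner (v (Some \<alpha>)) (?G (v (Some \<alpha>))))))"
  proof -
    have "cinner x y + cinner y x = complex_of_real (2 * Re (cinner y x))" for x y :: 'h
      by (subst cinner_commute) (simp add: add.commute complex_add_cnj)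
    thus ?thesis using Greal by (simp only:)
  qed
  also have "\<dots> = complex_of_real (2 * (Re (cinner (v None) (?G (v None)))
      + (\<Sum>\<alpha>\<in>?L. Re (cinner (v (Some \<alpha>)) (?G (v (Some \<alpha>)))) + Re (cinner (v (Some \<alpha>)) (A \<alpha> (v None))))))"
    by (simp add: sum.distrib sum_distrib_left algebra_simps)
  also have "\<dots> \<in> \<real>\<^sub>\<ge>\<^sub>0"
    using nonneg[of "v None" "\<lambda>\<alpha>. v (Some \<alpha>)"] by (subst nonneg_Reals_of_real_iff) simp
  finally show "(\<Sum>p\<in>block_index k. cinner (v p) (\<Sum>q\<in>block_index k. coeff_matrix A p q (v q))) \<in> \<real>\<^sub>\<ge>\<^sub>0" .
qed

section \<open>Positive contractions\<close>

lemma blinfun_compose_id [simp]: "id_blinfun o\<^sub>L T = T" "T o\<^sub>L id_blinfun = T"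
  by (rule blinfun_eqI; simp)+

lemma adj_id [simp]: "adj id_blinfun = (id_blinfun :: 'a::complex_inner \<Rightarrow>\<^sub>L 'a)"
  by (rule adj_eqI) simp

text \<open>Polarization: the defect \<open>D\<close> vanishes on the diagonal, and evaluating it at
  x + y and x + iy kills its symmetric and antisymmetric parts.\<close>

lemma selfadjoint_of_real_form:
  fixes T :: "'a::complex_inner \<Rightarrow>\<^sub>L 'a"
  assumes T: "T \<in> \<B>" and real: "\<And>x. Im (cinner x (T x)) = 0"
  shows "cinner (T x) y = cinner x (T y)"
proof -
  define D where "D x y = cinner (T x) y - cinner x (T y)" for x y
  have D0: "D z z = 0" for z
  proof -
    have "cinner (T z) z = cnj (cinner z (T z))" by (rule cinner_commute)
    thus ?thesis using real[of z] by (simp add: D_def complex_eq_iff)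
  qed
  have "D (x + y) (x + y) = D x x + D y y + (D x y + D y x)"
    by (simp add: D_def blinfun.add_right cinner_add_left cinner_add_right)
  hence 1: "D x y + D y x = 0" by (simp add: D0)
  have "D (x + \<i> *\<^sub>C y) (x + \<i> *\<^sub>C y) = D x x + D y y + \<i> * (D x y - D y x)"
    by (simp add: D_def blinfun.add_right bounded_opsD[OF T] cinner_add_left cinner_add_right
        cinner_scaleC_left cinner_scaleC_right algebra_simps)
  hence 2: "D x y - D y x = 0" by (simp add: D0)
  have "2 * D x y = (D x y + D y x) + (D x y - D y x)" by simp
  hence "D x y = 0" unfolding 1 2 by simp
  thus ?thesis by (simp add: D_def)
qed

text \<open>Uses \<open>T - T\<^sup>2 = T (I - T) T + (I - T) T (I - T)\<close>.\<close>

lemma norm_le_one_of_positive: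
  fixes T :: "'a::complex_inner \<Rightarrow>\<^sub>L 'a"
  assumes sa: "\<And>x y. cinner (T x) y = cinner x (T y)"
    and pos: "\<And>x. 0 \<le> Re (cinner x (T x))" and le: "\<And>x. 0 \<le> Re (cinner x ((id_blinfun - T) x))"
  shows "norm T \<le> 1"
proof (rule norm_blinfun_bound)
  fix x
  have sai: "inner (T u) v = inner u (T v)" for u v by (simp add: inner_eq_Re_cinner sa)
  have "0 \<le> inner (T x) (T x - T (T x)) + inner (x - T x) (T (x - T x))"
    using le[of "T x"] pos[of "x - T x"] by (simp add: inner_eq_Re_cinner blinfun.diff_left)
  also have "\<dots> = inner x (T x) - inner (T x) (T x)"
    by (simp add: blinfun.diff_right inner_diff_left inner_diff_right sai)
  finally have "inner (T x) (T x) \<le> inner x (T x)" by simp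
  also have "\<dots> \<le> inner x x"
    using le[of x] by (simp add: inner_eq_Re_cinner blinfun.diff_left cinner_diff_right)
  finally have "(norm (T x))\<^sup>2 \<le> (norm x)\<^sup>2" by (simp add: power2_norm_eq_inner)
  thus "norm (T x) \<le> 1 * norm x" using power2_le_imp_le[OF _ norm_ge_zero] by simp
qed simp

text \<open>Test the form at \<eta> = T \<xi>.\<close>

lemma norm_le_of_form:
  fixes T :: "'a::complex_inner \<Rightarrow>\<^sub>L 'a"
  assumes "0 \<le> c" "\<And>\<xi> \<eta>. cmod (cinner \<eta> (T \<xi>)) \<le> c * norm \<xi> * norm \<eta>"
  shows "norm T \<le> c"
proof (rule norm_blinfun_bound)
  fix \<xi>
  have "norm (T \<xi>) * norm (T \<xi>) \<le> (c * norm \<xi>) * norm (T \<xi>)"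
    using assms(2)[of "T \<xi>" \<xi>] by (simp add: cinner_self norm_mult power2_eq_square)
  thus "norm (T \<xi>) \<le> c * norm \<xi>" using assms(1) by (cases "norm (T \<xi>) = 0") simp_all
qed (rule assms(1))

text \<open>The \<open>E j\<close> are isometries with mutually orthogonal ranges, and
  \<open>p\<close> is the projection of \<open>z\<close> onto the sum of these ranges, so its norm
  is at most that of \<open>z\<close>.\<close>

lemma Bessel_isometries:
  fixes E :: "'j \<Rightarrow> ('a::chilbert_space \<Rightarrow>\<^sub>L 'a)"
  assumes fin: "finite J" and E: "\<And>j. j \<in> J \<Longrightarrow> E j \<in> \<B>"
    and orth: "\<And>i j. i \<in> J \<Longrightarrow> j \<in> J \<Longrightarrow> adj (E i) o\<^sub>L E j = (if i = j then id_blinfun else 0)"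
  shows "(\<Sum>j\<in>J. (norm (adj (E j) z))\<^sup>2) \<le> (norm z)\<^sup>2"
proof -
  define a where "a j = adj (E j) z" for j
  define p where "p = (\<Sum>j\<in>J. E j (a j))"
  have aE: "adj (E i) (E j x) = (if i = j then x else 0)" if "i \<in> J" "j \<in> J" for i j x
    using arg_cong[OF orth[OF that], of "\<lambda>T. blinfun_apply T x"] by (simp split: if_splits)
  have Ep: "adj (E j) p = a j" if "j \<in> J" for j
    using that fin by (simp add: p_def blinfun.sum_right aE)
  have pw: "inner p w = (\<Sum>j\<in>J. inner (a j) (adj (E j) w))" for w
    by (simp add: p_def inner_eq_Re_cinner cinner_sum_left cinner_adj_right[OF E])
  have "inner p p = (\<Sum>j\<in>J. (norm (a j))\<^sup>2)" unfolding pw by (simp add: Ep power2_norm_eq_inner)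
  moreover have "inner p z = (\<Sum>j\<in>J. (norm (a j))\<^sup>2)"
    unfolding pw by (simp add: a_def power2_norm_eq_inner)
  ultimately have s: "(norm p)\<^sup>2 = (\<Sum>j\<in>J. (norm (a j))\<^sup>2)" "(norm p)\<^sup>2 = inner p z"
    by (simp_all add: power2_norm_eq_inner)
  have "norm p * norm p \<le> norm p * norm z"
    using norm_cauchy_schwarz[of p z] s(2) by (simp add: power2_eq_square)
  hence "norm p \<le> norm z" by (cases "norm p = 0") simp_all
  hence "(norm p)\<^sup>2 \<le> (norm z)\<^sup>2" by (intro power_mono) simp_all
  thus ?thesis using s(1) by (simp add: a_def)
qed

text \<open>The discriminant criterion, after \<open>u\<close> has rotated \<open>c\<close> onto the
  negative real axis. For positive \<open>a\<close> the vertex is s = |c|/(2a); for a = 0 a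
  nonconstant affine function would become negative.\<close>

lemma quadratic_form_Cauchy_Schwarz:
  fixes a b :: real and c :: complex
  assumes a: "0 \<le> a" and nonneg: "\<And>s u. cmod u = 1 \<Longrightarrow> 0 \<le> s\<^sup>2 * a + b + s * Re (u * c)"
  shows "(cmod c)\<^sup>2 \<le> 4 * a * b"
proof (cases "c = 0")
  case True
  thus ?thesis using nonneg[of 1 0] a by simp
next
  case False
  define u where "u = - cnj c / cmod c"
  have u: "cmod u = 1" using False by (simp add: u_def norm_divide)
  have "u * c = - complex_of_real (cmod c)"
    using False by (simp add: u_def complex_norm_square[symmetric] mult.commute[of "cnj c"] power2_eq_square)
  hence q: "0 \<le> s\<^sup>2 * a + b - s * cmod c" for s using nonneg[OF u, of s] by simp
  show ?thesis
  proof (cases "a = 0")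
    case True
    have "0 \<le> b - ((b + 1) / cmod c) * cmod c" using q[of "(b + 1) / cmod c"] True by simp
    thus ?thesis using False by simp
  next
    case a0: False
    have "0 \<le> 4 * a * ((cmod c / (2 * a))\<^sup>2 * a + b - (cmod c / (2 * a)) * cmod c)"
      using a q[of "cmod c / (2 * a)"] by simp
    also have "\<dots> = 4 * a * b - (cmod c)\<^sup>2"
      using a0 by (simp add: field_simps power2_eq_square)
    finally show ?thesis by simp
  qed
qed

section \<open>Words in the left creation operators\<close>

lemma creation_bounded_ops [simp, intro]: "creation i \<in> \<B>"
proof (rule bounded_opsI)
  show "creation i (c *\<^sub>C x) = c *\<^sub>C creation i x" for c x
    unfolding creation.rep_eq by transfer (auto split: list.splits)
qed

text \<open>The range of \<open>creation i\<close> consists of families supported on words beginning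
  with \<open>i\<close>; different letters give disjoint supports, and equal letters only reindex
  the sum.\<close>

lemma cinner_creation:
  "cinner (creation i x) (creation j y) = (if i = j then cinner x y else 0)"
proof (cases "i = j")
  case True
  have "cinner (creation i x) (creation i y)
      = (\<Sum>\<^sub>\<infinity>w\<in>(#) i ` UNIV. cnj (Rep_ell2 (creation_map i x) w) * Rep_ell2 (creation_map i y) w)"
    unfolding creation.rep_eq cinner_ell2.rep_eq
    by (rule infsum_cong_neutral) (auto simp: creation_map.rep_eq split: list.splits)
  also have "\<dots> = cinner x y"
    unfolding cinner_ell2.rep_eq by (subst infsum_reindex) (auto simp: o_def creation_map.rep_eq)
  finally show ?thesis using True by simp
next
  case False
  have "cinner (creation i x) (creation j y) = (\<Sum>\<^sub>\<infinity>w::'a list. 0)"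
    unfolding creation.rep_eq cinner_ell2.rep_eq
    by (rule infsum_cong) (use False in \<open>auto simp: creation_map.rep_eq split: list.splits\<close>)
  thus ?thesis using False by simp
qed

lemma cinner_word_creation:
  assumes "length \<alpha> = length \<beta>"
  shows "cinner (word_op id_blinfun creation \<alpha> x) (word_op id_blinfun creation \<beta> y)
    = (if \<alpha> = \<beta> then cinner x y else 0)"
  using assms by (induction \<alpha> \<beta> rule: list_induct2) (auto simp: cinner_creation)

lemma adj_word_creation_compose:
  fixes \<alpha> \<beta> :: "'n::finite list"
  assumes "length \<alpha> = length \<beta>"
  shows "adj (word_op id_blinfun creation \<alpha>) o\<^sub>L word_op id_blinfun creation \<beta>
    = (if \<alpha> = \<beta> then id_blinfun else 0)"
proof (intro blinfun_eqI cinner_eqI)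
  fix x y :: "'n fock"
  have B: "word_op id_blinfun creation \<alpha> \<in> \<B>" by (rule word_op_bounded_ops) simp
  show "cinner ((adj (word_op id_blinfun creation \<alpha>) o\<^sub>L word_op id_blinfun creation \<beta>) x) y
      = cinner ((if \<alpha> = \<beta> then id_blinfun else 0) x) y"
    using assms by (auto simp: cinner_adj_left[OF B] cinner_word_creation)
qed

section \<open>The norm estimate\<close>

text \<open>I tensor T tensor I, acting on the middle factor of the left-nested product. It commutes
  with operators of the form S tensor I tensor Y.\<close>

definition ampl :: "('h::chilbert_space \<Rightarrow>\<^sub>L 'h)
    \<Rightarrow> ((('f::chilbert_space, 'h) htensor, 'k::chilbert_space) htensor \<Rightarrow>\<^sub>L (('f, 'h) htensor, 'k) htensor)" where
  "ampl T = (id_blinfun \<otimes>\<^sub>o T) \<otimes>\<^sub>o id_blinfun"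

lemma ampl_bounded_ops [simp, intro]: "T \<in> \<B> \<Longrightarrow> ampl T \<in> \<B>"
  by (simp add: ampl_def)

lemma ampl_compose: "S \<in> \<B> \<Longrightarrow> T \<in> \<B> \<Longrightarrow> ampl S o\<^sub>L ampl T = ampl (S o\<^sub>L T)"
  by (simp add: ampl_def tensor_op_compose)

lemma ampl_add: "S \<in> \<B> \<Longrightarrow> T \<in> \<B> \<Longrightarrow> ampl (S + T) = ampl S + ampl T"
  by (simp add: ampl_def tensor_op_add_left tensor_op_add_right)

lemma ampl_id [simp]: "ampl id_blinfun = id_blinfun"
  by (simp add: ampl_def)

lemma adj_ampl: "T \<in> \<B> \<Longrightarrow> adj (ampl T) = ampl (adj T)"
  by (simp add: ampl_def adj_tensor_op)

text \<open>Two amplifications in succession: the identity is first placed on the left of the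
  coefficients, then on the right through the exchanged reading \<open>flip\<close>.\<close>

lemma ampl_nonneg:
  fixes G :: "'h::chilbert_space \<Rightarrow>\<^sub>L 'h" and A :: "'j \<Rightarrow> 'h \<Rightarrow>\<^sub>L 'h"
    and \<xi> :: "(('f::chilbert_space, 'h) htensor, 'k::chilbert_space) htensor"
  assumes J: "finite J" and G: "G \<in> \<B>" and A: "\<And>j. A j \<in> \<B>"
    and nonneg: "\<And>h0 h. 0 \<le> Re (cinner h0 (G h0))
      + (\<Sum>j\<in>J. Re (cinner (h j) (G (h j))) + Re (cinner (h j) (A j h0)))"
  shows "0 \<le> Re (cinner \<xi> (ampl G \<xi>))
      + (\<Sum>j\<in>J. Re (cinner (\<eta> j) (ampl G (\<eta> j))) + Re (cinner (\<eta> j) (ampl (A j) \<xi>)))"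
  unfolding ampl_def
proof (rule flip.amplify_nonneg[where G = "id_blinfun \<otimes>\<^sub>o G" and A = "\<lambda>j. id_blinfun \<otimes>\<^sub>o A j", OF J])
  show "0 \<le> Re (cinner u ((id_blinfun \<otimes>\<^sub>o G) u))
      + (\<Sum>j\<in>J. Re (cinner (v j) ((id_blinfun \<otimes>\<^sub>o G) (v j))) + Re (cinner (v j) ((id_blinfun \<otimes>\<^sub>o A j) u)))"
    for u :: "('f, 'h) htensor" and v
    by (rule tensor.amplify_nonneg[OF J _ _ nonneg]) (simp_all add: G A)
qed (simp_all add: G A)

text \<open>Scaling \<xi> by a real \<open>s\<close> times a phase \<open>u\<close> makes the
  amplified positive form quadratic in \<open>s\<close>, and its discriminant bounds the
  off-diagonal part. \<open>R\<close> is the square root of the diagonal entry.\<close>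

lemma ampl_Cauchy_Schwarz:
  fixes R :: "'h::chilbert_space \<Rightarrow>\<^sub>L 'h" and A :: "'j \<Rightarrow> 'h \<Rightarrow>\<^sub>L 'h"
    and \<xi> :: "(('f::chilbert_space, 'h) htensor, 'k::chilbert_space) htensor"
  assumes J: "finite J" and R: "R \<in> \<B>" "adj R = R" and A: "\<And>j. A j \<in> \<B>"
    and nonneg: "\<And>h0 h. 0 \<le> Re (cinner h0 ((R o\<^sub>L R) h0))
      + (\<Sum>j\<in>J. Re (cinner (h j) ((R o\<^sub>L R) (h j))) + Re (cinner (h j) (A j h0)))"
  shows "cmod (\<Sum>j\<in>J. cinner (\<eta> j) (ampl (A j) \<xi>))
    \<le> 2 * norm (ampl R \<xi>) * sqrt (\<Sum>j\<in>J. (norm (ampl R (\<eta> j)))\<^sup>2)"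
proof -
  define c where "c = (\<Sum>j\<in>J. cinner (\<eta> j) (ampl (A j) \<xi>))"
  define a where "a = (norm (ampl R \<xi>))\<^sup>2"
  define b where "b = (\<Sum>j\<in>J. (norm (ampl R (\<eta> j)))\<^sup>2)"
  have form: "cinner z (ampl (R o\<^sub>L R) z) = complex_of_real ((norm (ampl R z))\<^sup>2)"
    for z :: "(('f, 'h) htensor, 'k) htensor"
  proof -
    have "cinner z (ampl (R o\<^sub>L R) z) = cinner (ampl R z) (ampl R z)"
      using R by (simp add: ampl_compose[symmetric] cinner_adj_left[symmetric] adj_ampl)
    thus ?thesis by (simp add: cinner_self)
  qed
  have "(cmod c)\<^sup>2 \<le> 4 * a * b"
  proof (rule quadratic_form_Cauchy_Schwarz)
    fix s :: real and u :: complex assume u: "cmod u = 1"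
    define w where "w = complex_of_real s * u"
    have "0 \<le> Re (cinner (w *\<^sub>C \<xi>) (ampl (R o\<^sub>L R) (w *\<^sub>C \<xi>)))
      + (\<Sum>j\<in>J. Re (cinner (\<eta> j) (ampl (R o\<^sub>L R) (\<eta> j))) + Re (cinner (\<eta> j) (ampl (A j) (w *\<^sub>C \<xi>))))"
      by (rule ampl_nonneg[OF J _ A nonneg]) (use R in simp)
    also have "Re (cinner (w *\<^sub>C \<xi>) (ampl (R o\<^sub>L R) (w *\<^sub>C \<xi>))) = s\<^sup>2 * a"
      unfolding form by (simp add: a_def bounded_opsD[OF ampl_bounded_ops[OF R(1)]] norm_scaleC w_def
          norm_mult u power_mult_distrib)
    also have "(\<Sum>j\<in>J. Re (cinner (\<eta> j) (ampl (R o\<^sub>L R) (\<eta> j))) + Re (cinner (\<eta> j) (ampl (A j) (w *\<^sub>C \<xi>))))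
        = b + Re (w * c)"
    proof -
      have "(\<Sum>j\<in>J. cinner (\<eta> j) (ampl (A j) (w *\<^sub>C \<xi>))) = w * c"
        by (simp add: c_def bounded_opsD[OF ampl_bounded_ops[OF A]] cinner_scaleC_right sum_distrib_left)
      hence "(\<Sum>j\<in>J. Re (cinner (\<eta> j) (ampl (A j) (w *\<^sub>C \<xi>)))) = Re (w * c)" by (metis Re_sum)
      thus ?thesis by (simp add: sum.distrib form b_def)
    qed
    also have "Re (w * c) = s * Re (u * c)" by (simp add: w_def mult.assoc)
    finally show "0 \<le> s\<^sup>2 * a + b + s * Re (u * c)" by simp
  qed (simp add: a_def)
  hence "cmod c \<le> sqrt (4 * a * b)" by (rule real_le_rsqrt)
  also have "\<dots> = 2 * norm (ampl R \<xi>) * sqrt b" by (simp add: real_sqrt_mult a_def)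
  finally show ?thesis by (simp add: c_def b_def)
qed

lemma norm_le_sqrt_column:
  fixes Y :: "'j \<Rightarrow> ('k::chilbert_space \<Rightarrow>\<^sub>L 'k)"
  assumes "finite J" "\<And>j. Y j \<in> \<B>" "i \<in> J"
  shows "norm (Y i) \<le> sqrt (norm (\<Sum>j\<in>J. adj (Y j) o\<^sub>L Y j))"
proof (rule norm_blinfun_bound)
  fix x
  let ?M = "\<Sum>j\<in>J. adj (Y j) o\<^sub>L Y j"
  have "(norm (Y i x))\<^sup>2 \<le> (\<Sum>j\<in>J. (norm (Y j x))\<^sup>2)"
    by (rule member_le_sum[OF assms(3)]) (simp_all add: assms(1))
  also have "\<dots> = inner x (?M x)"
    by (simp add: blinfun.sum_left inner_eq_Re_cinner cinner_sum_right cinner_adj_right[OF assms(2)]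
        cinner_self del: of_real_power)
  also have "\<dots> \<le> norm x * norm (?M x)" by (rule norm_cauchy_schwarz)
  also have "\<dots> \<le> norm x * (norm ?M * norm x)" by (intro mult_left_mono norm_blinfun) simp
  also have "\<dots> = (sqrt (norm ?M) * norm x)\<^sup>2" by (simp add: power_mult_distrib power2_eq_square)
  finally show "norm (Y i x) \<le> sqrt (norm ?M) * norm x" by (rule power2_le_imp_le) simp
qed simp

text \<open>Write each summand as \<open>V \<alpha>\<close> after \<open>ampl (A \<alpha>)\<close>
  and move \<open>V \<alpha>\<close> onto \<eta>. Cauchy-Schwarz then applies with the family
  \<open>adj (V \<alpha>) \<eta>\<close>, whose total size Bessel controls because the isometries
  \<open>E \<alpha>\<close> have orthogonal ranges.\<close>

lemma homogeneous_form_bound: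
  fixes A :: "'n::finite list \<Rightarrow> ('h::chilbert_space \<Rightarrow>\<^sub>L 'h)"
    and Y :: "'n list \<Rightarrow> ('k::chilbert_space \<Rightarrow>\<^sub>L 'k)"
    and \<xi> \<eta> :: "(('n fock, 'h) htensor, 'k) htensor"
  assumes R: "R \<in> \<B>" "adj R = R" and A: "\<And>\<alpha>. A \<alpha> \<in> \<B>" and Y: "\<And>\<alpha>. Y \<alpha> \<in> \<B>"
    and nonneg: "\<And>h0 h. 0 \<le> Re (cinner h0 ((R o\<^sub>L R) h0))
      + (\<Sum>\<alpha> | length \<alpha> = k. Re (cinner (h \<alpha>) ((R o\<^sub>L R) (h \<alpha>))) + Re (cinner (h \<alpha>) (A \<alpha> h0)))"
    and y: "0 \<le> y" "\<And>\<alpha>. length \<alpha> = k \<Longrightarrow> norm (Y \<alpha>) \<le> y"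
  shows "cmod (cinner \<eta> ((\<Sum>\<alpha> | length \<alpha> = k. word_op id_blinfun creation \<alpha> \<otimes>\<^sub>o A \<alpha> \<otimes>\<^sub>o Y \<alpha>) \<xi>))
    \<le> 2 * y * norm (ampl R \<xi>) * norm (ampl R \<eta>)"
proof -
  define S where "S = word_op id_blinfun (creation :: 'n \<Rightarrow> _)"
  have S [simp]: "S \<alpha> \<in> \<B>" for \<alpha> unfolding S_def by (rule word_op_bounded_ops) simp
  note [simp] = A Y R(1)
  define E where "E \<alpha> = S \<alpha> \<otimes>\<^sub>o (id_blinfun :: 'h \<Rightarrow>\<^sub>L 'h) \<otimes>\<^sub>o (id_blinfun :: 'k \<Rightarrow>\<^sub>L 'k)" for \<alpha>
  define V where "V \<alpha> = S \<alpha> \<otimes>\<^sub>o (id_blinfun :: 'h \<Rightarrow>\<^sub>L 'h) \<otimes>\<^sub>o Y \<alpha>" for \<alpha>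
  have EB [simp]: "E \<alpha> \<in> \<B>" and VB [simp]: "V \<alpha> \<in> \<B>" for \<alpha> by (simp_all add: E_def V_def)
  have orth: "adj (E \<alpha>) o\<^sub>L E \<beta> = (if \<alpha> = \<beta> then id_blinfun else 0)"
    if "length \<alpha> = k" "length \<beta> = k" for \<alpha> \<beta>
  proof -
    have "adj (S \<alpha>) o\<^sub>L S \<beta> = (if \<alpha> = \<beta> then id_blinfun else 0)"
      unfolding S_def by (rule adj_word_creation_compose) (simp add: that)
    hence "adj (E \<alpha>) o\<^sub>L E \<beta> = (if \<alpha> = \<beta> then id_blinfun else 0) \<otimes>\<^sub>o id_blinfun \<otimes>\<^sub>o id_blinfun"
      by (simp add: E_def adj_tensor_op tensor_op_compose)
    thus ?thesis by (simp add: tensor_op_zero_left)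
  qed
  have V_le: "norm (adj (V \<alpha>) z) \<le> y * norm (adj (E \<alpha>) z)" if "length \<alpha> = k" for \<alpha> z
  proof -
    define U where "U = (id_blinfun :: ('n fock, 'h) htensor \<Rightarrow>\<^sub>L _) \<otimes>\<^sub>o Y \<alpha>"
    have U [simp]: "U \<in> \<B>" by (simp add: U_def)
    have "V \<alpha> = E \<alpha> o\<^sub>L U" by (simp add: V_def E_def U_def tensor_op_compose)
    hence "adj (V \<alpha>) z = adj U (adj (E \<alpha>) z)" by (simp add: adj_compose)
    also have "norm \<dots> \<le> norm (adj U) * norm (adj (E \<alpha>) z)" by (rule norm_blinfun)
    also have "\<dots> \<le> y * norm (adj (E \<alpha>) z)"
    proof (rule mult_right_mono)
      have "norm (adj U) \<le> norm U" by (rule norm_adj_le) simp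
      also have "\<dots> \<le> norm (id_blinfun :: ('n fock, 'h) htensor \<Rightarrow>\<^sub>L _) * norm (Y \<alpha>)"
        unfolding U_def by (rule norm_tensor_op_le) simp_all
      also have "\<dots> \<le> 1 * norm (Y \<alpha>)" by (intro mult_right_mono norm_blinfun_id_le) simp
      finally show "norm (adj U) \<le> y" using y(2)[OF that] by simp
    qed simp
    finally show ?thesis .
  qed
  \<comment> \<open>\<open>V \<alpha>\<close> is the identity on the coefficient factor, so it
    commutes with \<open>ampl R\<close>; taking adjoints gives the same for
    \<open>adj (V \<alpha>)\<close>.\<close>
  have RV: "ampl R (adj (V \<alpha>) z) = adj (V \<alpha>) (ampl R z)" for \<alpha> z
  proof -
    have "V \<alpha> o\<^sub>L ampl R = ampl R o\<^sub>L V \<alpha>" by (simp add: V_def ampl_def tensor_op_compose)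
    hence "adj (V \<alpha> o\<^sub>L ampl R) = adj (ampl R o\<^sub>L V \<alpha>)" by simp
    hence "ampl R o\<^sub>L adj (V \<alpha>) = adj (V \<alpha>) o\<^sub>L ampl R" by (simp add: adj_compose adj_ampl R(2))
    from arg_cong[OF this, of "\<lambda>T. blinfun_apply T z"] show ?thesis by simp
  qed
  have "(\<Sum>\<alpha> | length \<alpha> = k. (norm (ampl R (adj (V \<alpha>) \<eta>)))\<^sup>2)
      \<le> (\<Sum>\<alpha> | length \<alpha> = k. y\<^sup>2 * (norm (adj (E \<alpha>) (ampl R \<eta>)))\<^sup>2)"
    unfolding RV power_mult_distrib[symmetric] using V_le by (intro sum_mono power_mono) auto
  also have "\<dots> = y\<^sup>2 * (\<Sum>\<alpha> | length \<alpha> = k. (norm (adj (E \<alpha>) (ampl R \<eta>)))\<^sup>2)"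
    by (simp add: sum_distrib_left)
  also have "\<dots> \<le> y\<^sup>2 * (norm (ampl R \<eta>))\<^sup>2"
    by (intro mult_left_mono Bessel_isometries) (auto simp: orth)
  finally have col: "sqrt (\<Sum>\<alpha> | length \<alpha> = k. (norm (ampl R (adj (V \<alpha>) \<eta>)))\<^sup>2) \<le> y * norm (ampl R \<eta>)"
    using y(1) by (intro real_le_lsqrt) (simp_all add: power_mult_distrib sum_nonneg)
  have "S \<alpha> \<otimes>\<^sub>o A \<alpha> \<otimes>\<^sub>o Y \<alpha> = V \<alpha> o\<^sub>L ampl (A \<alpha>)" for \<alpha>
    by (simp add: V_def ampl_def tensor_op_compose)
  hence "cinner \<eta> ((\<Sum>\<alpha> | length \<alpha> = k. S \<alpha> \<otimes>\<^sub>o A \<alpha> \<otimes>\<^sub>o Y \<alpha>) \<xi>)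
      = (\<Sum>\<alpha> | length \<alpha> = k. cinner (adj (V \<alpha>) \<eta>) (ampl (A \<alpha>) \<xi>))"
    by (simp add: blinfun.sum_left cinner_sum_right cinner_adj_left)
  also have "cmod \<dots> \<le> 2 * norm (ampl R \<xi>) * sqrt (\<Sum>\<alpha> | length \<alpha> = k. (norm (ampl R (adj (V \<alpha>) \<eta>)))\<^sup>2)"
    by (rule ampl_Cauchy_Schwarz[OF _ R A nonneg]) simp
  also have "\<dots> \<le> 2 * norm (ampl R \<xi>) * (y * norm (ampl R \<eta>))"
    by (intro mult_left_mono col) simp
  finally show ?thesis by (simp add: S_def mult_ac)
qed

lemma Bohr_inequality:
  fixes A :: "'n::finite list \<Rightarrow> ('h::chilbert_space \<Rightarrow>\<^sub>L 'h)"
    and Y :: "'n list \<Rightarrow> ('k::chilbert_space \<Rightarrow>\<^sub>L 'k)"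
  defines "U \<equiv> \<lambda>k. \<Sum>\<alpha> | length \<alpha> = k. word_op id_blinfun creation \<alpha> \<otimes>\<^sub>o A \<alpha> \<otimes>\<^sub>o Y \<alpha>"
    and "y \<equiv> \<lambda>k. sqrt (norm (\<Sum>\<alpha> | length \<alpha> = Suc k. adj (Y \<alpha>) o\<^sub>L Y \<alpha>))"
  assumes A: "\<And>\<alpha>. A \<alpha> \<in> \<B>" and A0: "positive_op (A [])"
    and nonneg: "\<And>k h0 h. 0 \<le> Re (cinner h0 ((id_blinfun - A []) h0))
      + (\<Sum>\<alpha> | length \<alpha> = Suc k. Re (cinner (h \<alpha>) ((id_blinfun - A []) (h \<alpha>))) + Re (cinner (h \<alpha>) (A \<alpha> h0)))"
    and Y: "\<And>\<alpha>. Y \<alpha> \<in> \<B>" and Y0: "norm (Y []) \<le> 1"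
    and sy: "summable y" and y: "suminf y \<le> 1/2"
  shows "summable U" and "norm (suminf U) \<le> 1"
proof -
  define G where "G = id_blinfun - A []"
  have GB: "G \<in> \<B>" by (simp add: G_def A)
  have Apos: "0 \<le> Re (cinner x (A [] x))" "Im (cinner x (A [] x)) = 0" for x
    using A0 by (auto simp: positive_op_def complex_nonneg_Reals_iff)
  have Gpos: "0 \<le> Re (cinner x (G x))" for x
    using nonneg[where k = 0 and ?h0.0 = x and h = "\<lambda>_. 0"] by (simp add: G_def)
  have Asa: "cinner (A [] x) z = cinner x (A [] z)" for x z
    by (rule selfadjoint_of_real_form[OF A Apos(2)])
  have Gsa: "cinner (G x) z = cinner x (G z)" for x z
    by (simp add: G_def blinfun.diff_left cinner_diff_left cinner_diff_right Asa)
  have "norm (A []) \<le> 1" by (rule norm_le_one_of_positive[OF Asa Apos(1)]) (use Gpos in \<open>simp add: G_def\<close>)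
  hence "norm (id_blinfun - G) \<le> 1" by (simp add: G_def)
  from sqrt_exists[OF GB Gsa this]
  obtain R where R: "R \<in> \<B>" "R o\<^sub>L R = G" "\<And>x z. cinner (R x) z = cinner x (R z)" by blast
  have "norm G \<le> 1" by (rule norm_le_one_of_positive[OF Gsa Gpos]) (use Apos in \<open>simp add: G_def\<close>)
  hence "norm (id_blinfun - A []) \<le> 1" by (simp add: G_def)
  from sqrt_exists[OF A Asa this]
  obtain Q where Q: "Q \<in> \<B>" "Q o\<^sub>L Q = A []" "\<And>x z. cinner (Q x) z = cinner x (Q z)" by blast
  have Ra: "adj R = R" and Qa: "adj Q = Q" by (rule adj_eqI, rule R Q)+
  define r where "r \<xi> = norm (ampl R \<xi>)" for \<xi> :: "(('n fock, 'h) htensor, 'k) htensor"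
  define q where "q \<xi> = norm (ampl Q \<xi>)" for \<xi> :: "(('n fock, 'h) htensor, 'k) htensor"
  \<comment> \<open>A_0 + G = I, so the forms of the two squared roots add up to the squared
    norm.\<close>
  have rq: "(q \<xi>)\<^sup>2 + (r \<xi>)\<^sup>2 = (norm \<xi>)\<^sup>2" for \<xi>
  proof -
    have sq: "inner \<xi> (ampl (T o\<^sub>L T) \<xi>) = (norm (ampl T \<xi>))\<^sup>2" if "T \<in> \<B>" "adj T = T" for T
      using that by (simp add: inner_eq_Re_cinner ampl_compose[symmetric] cinner_adj_left[symmetric]
          adj_ampl cinner_self del: of_real_power)
    have "ampl (A []) + ampl G = (ampl (A [] + G) :: (('n fock, 'h) htensor, 'k) htensor \<Rightarrow>\<^sub>L _)"
      by (rule ampl_add[symmetric]) (simp_all add: A GB)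
    hence "ampl (A []) + ampl G = (id_blinfun :: (('n fock, 'h) htensor, 'k) htensor \<Rightarrow>\<^sub>L _)"
      by (simp add: G_def)
    hence "inner \<xi> (ampl (A []) \<xi>) + inner \<xi> (ampl G \<xi>) = inner \<xi> \<xi>"
      by (metis blinfun.add_left inner_add_right id_blinfun.rep_eq)
    thus ?thesis
      using sq[OF Q(1) Qa] sq[OF R(1) Ra] by (simp add: Q(2) R(2) q_def r_def power2_norm_eq_inner)
  qed
  have r0: "0 \<le> r \<xi>" and q0: "0 \<le> q \<xi>" for \<xi> by (simp_all add: r_def q_def)
  have r_le: "r \<xi> \<le> norm \<xi>" for \<xi>
    using rq[of \<xi>] by (intro power2_le_imp_le[OF _ norm_ge_zero]) (metis le_add_same_cancel2 zero_le_power2)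
  have y0: "0 \<le> y k" for k by (simp add: y_def)
  \<comment> \<open>The index is shifted: \<open>y k\<close> is the column norm in degree
    \<open>Suc k\<close>. It dominates each single \<open>Y \<alpha>\<close> of that degree.\<close>
  have bS: "cmod (cinner \<eta> (U (Suc k) \<xi>)) \<le> 2 * y k * r \<xi> * r \<eta>" for k \<xi> \<eta>
    unfolding U_def r_def
  proof (rule homogeneous_form_bound[OF R(1) Ra A Y _ y0])
    show "norm (Y \<alpha>) \<le> y k" if "length \<alpha> = Suc k" for \<alpha>
      unfolding y_def by (rule norm_le_sqrt_column) (simp_all add: Y that)
  qed (use nonneg in \<open>simp add: R(2) G_def\<close>)
  \<comment> \<open>Since A_0 = Q^2, the constant term is the contraction \<open>Z\<close> between
    two copies of \<open>ampl Q\<close>.\<close>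
  have b0: "cmod (cinner \<eta> (U 0 \<xi>)) \<le> q \<xi> * q \<eta>" for \<xi> \<eta>
  proof -
    define Z where "Z = (id_blinfun :: ('n fock, 'h) htensor \<Rightarrow>\<^sub>L _) \<otimes>\<^sub>o Y []"
    have "U 0 = id_blinfun \<otimes>\<^sub>o (Q o\<^sub>L Q) \<otimes>\<^sub>o Y []" by (simp add: U_def Q(2))
    also have "\<dots> = ampl Q o\<^sub>L (Z o\<^sub>L ampl Q)"
      by (simp add: ampl_def Z_def tensor_op_compose Y Q(1))
    finally have "cinner \<eta> (U 0 \<xi>) = cinner (ampl Q \<eta>) (Z (ampl Q \<xi>))"
      by (simp add: cinner_adj_left[OF ampl_bounded_ops[OF Q(1)], symmetric] adj_ampl Q(1) Qa)
    also have "cmod \<dots> \<le> q \<eta> * norm (Z (ampl Q \<xi>))" unfolding q_def by (rule cinner_Cauchy_Schwarz)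
    also have "norm (Z (ampl Q \<xi>)) \<le> norm Z * q \<xi>" unfolding q_def by (rule norm_blinfun)
    also have "norm Z \<le> 1"
    proof -
      have "norm Z \<le> norm (id_blinfun :: ('n fock, 'h) htensor \<Rightarrow>\<^sub>L _) * norm (Y [])"
        unfolding Z_def by (rule norm_tensor_op_le) (simp_all add: Y)
      also have "\<dots> \<le> 1 * 1" by (intro mult_mono norm_blinfun_id_le Y0) simp_all
      finally show ?thesis by simp
    qed
    finally show ?thesis using q0 by (simp add: mult_left_mono mult_right_mono mult.commute)
  qed
  have nU: "norm (U (Suc k)) \<le> 2 * y k" for k
  proof (rule norm_le_of_form)
    fix \<xi> \<eta> :: "(('n fock, 'h) htensor, 'k) htensor"
    have "2 * y k * r \<xi> * r \<eta> \<le> 2 * y k * norm \<xi> * norm \<eta>"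
      by (intro mult_mono r_le) (simp_all add: y0 r0)
    thus "cmod (cinner \<eta> (U (Suc k) \<xi>)) \<le> 2 * y k * norm \<xi> * norm \<eta>" using bS[of \<eta> k \<xi>] by linarith
  qed (simp add: y0)
  have "summable (\<lambda>k. U (Suc k))"
    by (rule summable_comparison_test'[OF summable_mult[OF sy, of 2], of 0]) (rule nU)
  thus sU: "summable U" by (simp only: summable_Suc_iff)
  show "norm (suminf U) \<le> 1"
  proof (rule norm_le_of_form)
    fix \<xi> \<eta> :: "(('n fock, 'h) htensor, 'k) htensor"
    have bl: "bounded_linear (\<lambda>T :: (('n fock, 'h) htensor, 'k) htensor \<Rightarrow>\<^sub>L _. cinner \<eta> (T \<xi>))"
      by (rule bounded_linear_compose[OF bounded_linear_cinner_right blinfun.bounded_linear_left])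
    have sc: "summable (\<lambda>k. cinner \<eta> (U k \<xi>))" by (rule bounded_linear.summable[OF bl sU])
    have sr: "summable (\<lambda>k. 2 * y k * r \<xi> * r \<eta>)" by (intro summable_mult summable_mult2 sy)
    have "cinner \<eta> (suminf U \<xi>) = (\<Sum>k. cinner \<eta> (U k \<xi>))"
      by (rule bounded_linear.suminf[OF bl sU])
    also have "\<dots> = cinner \<eta> (U 0 \<xi>) + (\<Sum>k. cinner \<eta> (U (Suc k) \<xi>))"
      using suminf_split_head[OF sc] by simp
    also have "cmod \<dots> \<le> cmod (cinner \<eta> (U 0 \<xi>)) + cmod (\<Sum>k. cinner \<eta> (U (Suc k) \<xi>))"
      by (rule norm_triangle_ineq)
    also have "cmod (\<Sum>k. cinner \<eta> (U (Suc k) \<xi>)) \<le> (\<Sum>k. 2 * y k * r \<xi> * r \<eta>)"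
      by (rule norm_suminf_le[OF bS sr])
    also have "(\<Sum>k. 2 * y k * r \<xi> * r \<eta>) = suminf y * (2 * (r \<xi> * r \<eta>))"
      using suminf_mult2[OF sy, of "2 * (r \<xi> * r \<eta>)"] by (simp add: mult_ac)
    \<comment> \<open>The hypothesis 1/2 exactly cancels the factor 2 of the Cauchy-Schwarz
      estimate.\<close>
    also have "\<dots> \<le> (1/2) * (2 * (r \<xi> * r \<eta>))" by (intro mult_right_mono y) (simp add: r0)
    also have "cmod (cinner \<eta> (U 0 \<xi>)) \<le> q \<xi> * q \<eta>" by (rule b0)
    finally have "cmod (cinner \<eta> (suminf U \<xi>)) \<le> q \<xi> * q \<eta> + r \<xi> * r \<eta>" by simp
    also have "\<dots> \<le> norm \<xi> * norm \<eta>"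
    proof (rule power2_le_imp_le)
      \<comment> \<open>Lagrange's identity, that is, Cauchy-Schwarz in the plane for the pairs (q,
        r) at \<xi> and \<eta>.\<close>
      have "(q \<xi> * q \<eta> + r \<xi> * r \<eta>)\<^sup>2 + (q \<xi> * r \<eta> - r \<xi> * q \<eta>)\<^sup>2
          = ((q \<xi>)\<^sup>2 + (r \<xi>)\<^sup>2) * ((q \<eta>)\<^sup>2 + (r \<eta>)\<^sup>2)"
        by (simp add: power2_eq_square algebra_simps)
      thus "(q \<xi> * q \<eta> + r \<xi> * r \<eta>)\<^sup>2 \<le> (norm \<xi> * norm \<eta>)\<^sup>2"
        unfolding rq power_mult_distrib using zero_le_power2[of "q \<xi> * r \<eta> - r \<xi> * q \<eta>"] by linarith
    qed simp
    finally show "cmod (cinner \<eta> (suminf U \<xi>)) \<le> 1 * norm \<xi> * norm \<eta>" by simp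
  qed simp
qed

text \<open>\<open>universe\<close> provides an orthonormal family indexed by all words, on which
  the truncated shifts act. Sums over degrees from 1 onward are written with
  \<open>Suc k\<close>.\<close>

theorem theorem2p4:
  fixes A :: "'n::finite list \<Rightarrow> ('h::chilbert_space \<Rightarrow>\<^sub>L 'h)"
  assumes universe: "\<exists>B :: 'x::chilbert_space set. infinite B \<and> independent B"
    and holomorphic: "universal_holomorphic TYPE('x) A"
    and F0: "positive_op (A [])"
    and ReF: "\<And>(M :: 'x set) X. hilbert_subspace M \<Longrightarrow> X \<in> row_ball M \<Longrightarrow>
      op_le (Re_op (holomorphic_eval A M X)) (subspace_id M \<otimes>\<^sub>o id_blinfun)"
  shows "(\<forall>k\<ge>1. positive_op_matrix (block_index k) (coeff_matrix A)) \<and>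
    (\<forall>Y :: 'n list \<Rightarrow> ('k::chilbert_space \<Rightarrow>\<^sub>L 'k).
      (\<forall>\<alpha>. Y \<alpha> \<in> \<B>) \<longrightarrow>
      norm (Y []) \<le> 1 \<longrightarrow>
      summable (\<lambda>k. sqrt (norm (\<Sum>\<alpha> | length \<alpha> = Suc k. adj (Y \<alpha>) o\<^sub>L Y \<alpha>))) \<longrightarrow>
      (\<Sum>k. sqrt (norm (\<Sum>\<alpha> | length \<alpha> = Suc k. adj (Y \<alpha>) o\<^sub>L Y \<alpha>))) \<le> 1/2 \<longrightarrow>
      summable (\<lambda>k. \<Sum>\<alpha> | length \<alpha> = k. word_op id_blinfun creation \<alpha> \<otimes>\<^sub>o A \<alpha> \<otimes>\<^sub>o Y \<alpha>) \<and>
      norm (\<Sum>k. \<Sum>\<alpha> | length \<alpha> = k. word_op id_blinfun creation \<alpha> \<otimes>\<^sub>o A \<alpha> \<otimes>\<^sub>o Y \<alpha>) \<le> 1)"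
proof -
  have A: "A \<alpha> \<in> \<B>" for \<alpha> using holomorphic by (simp add: universal_holomorphic_def)
  note nonneg = coeff_matrix_nonneg[OF universe holomorphic ReF]
  show ?thesis
  proof (intro conjI allI impI)
    fix k :: nat assume "1 \<le> k"
    show "positive_op_matrix (block_index k) (coeff_matrix A)"
      by (rule positive_coeff_matrix[OF A F0 nonneg[OF _ _ \<open>1 \<le> k\<close>]])
  next
    fix Y :: "'n list \<Rightarrow> ('k \<Rightarrow>\<^sub>L 'k)"
    assume Y: "\<forall>\<alpha>. Y \<alpha> \<in> \<B>" "norm (Y []) \<le> 1"
      "summable (\<lambda>k. sqrt (norm (\<Sum>\<alpha> | length \<alpha> = Suc k. adj (Y \<alpha>) o\<^sub>L Y \<alpha>)))"
      "(\<Sum>k. sqrt (norm (\<Sum>\<alpha> | length \<alpha> = Suc k. adj (Y \<alpha>) o\<^sub>L Y \<alpha>))) \<le> 1/2"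
    note Bohr = Bohr_inequality[OF A F0 nonneg spec[OF Y(1)] Y(2,3,4)]
    show "summable (\<lambda>k. \<Sum>\<alpha> | length \<alpha> = k. word_op id_blinfun creation \<alpha> \<otimes>\<^sub>o A \<alpha> \<otimes>\<^sub>o Y \<alpha>)"
      by (rule Bohr(1)) simp_all
    show "norm (\<Sum>k. \<Sum>\<alpha> | length \<alpha> = k. word_op id_blinfun creation \<alpha> \<otimes>\<^sub>o A \<alpha> \<otimes>\<^sub>o Y \<alpha>) \<le> 1"
      by (rule Bohr(2)) simp_all
  qed
qed

end
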